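(* For every $s\in\mathbb N\cup\{0\}$ and $k\in\mathbb N$ there is a constant $c_{s,k}=c(s,k)>0$ such that the following holds. Let $F(U)=\sum_{j=1}^k a_jU^j$ be a real polynomial of degree $k$ with $F(0)=0$, let $A_k:=\max\{j|a_j|:1\le j\le k\}$, and let $\epsilon>0$. Let $U$ be the solution of the Cauchy problem $U_t+U_{xxx}+F(U)U_x=0$, $x\in\mathbb R$, $t>0$, with initial data $U_0(x)$, and let $u$ be the solution of the Cauchy problem $u_t+u_{xxx}+uu_x=0$, $x\in\mathbb R$, $t>0$, with initial data $u_0(x)$. For $s\in\mathbb N\cup\{0\}$ set $$T_s=c_{s,k}\min\Big\{\Big(A_k\sum_{j=1}^k\|U_0\|_{H^{s+1}(\mathbb R)}^j\Big)^{-1},\ \|u_0\|_{H^{s+1}(\mathbb R)}^{-1}\Big\}.$$ (i) ($L^2$ distance) If $u_0,U_0\in H^2(\mathbb R)$ satisfy $$\|u_0\|_{H^2(\mathbb R)}\le c_0\epsilon,\quad \|U_0\|_{H^2(\mathbb R)}\le C_0\epsilon,\quad \|u_0-U_0\|_{L^2(\mathbb R)}\le C\max\{\epsilon^2,\epsilon^{k+1}\}$$ for some constants $c_0,C_0,C$, then for each fixed finite $T\in(0,T_1]$ there exists a constant $\widetilde C=\widetilde C(k,T)$ such that $$\sup_{t\in[0,T]}\|u(t)-U(t)\|_{L^2_x(\mathbb R)}\le\widetilde C\max\{\epsilon^2,\epsilon^{k+1}\}.$$ (ii) ($H^s$ and $L^\infty$ distance for any $s\in\mathbb N$) Let $s\in\mathbb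 N$. If $u_0,U_0\in H^{s+1}(\mathbb R)$ satisfy $$\|u_0\|_{H^{s+1}(\mathbb R)}\le c_{0,s}\epsilon,\quad \|U_0\|_{H^{s+1}(\mathbb R)}\le C_{0,s}\epsilon,\quad \|u_0-U_0\|_{H^s(\mathbb R)}\le C_s\max\{\epsilon^2,\epsilon^{k+1}\}$$ for some constants $c_{0,s},C_{0,s},C_s$, then for each fixed finite $T\in(0,T_s]$ there exists a constant $\widetilde C_s=\widetilde C(s,k,T)$ such that $$\sup_{t\in[0,T]}\|u(t)-U(t)\|_{L^\infty_x(\mathbb R)}\le\sup_{t\in[0,T]}\|u(t)-U(t)\|_{H^s_x(\mathbb R)}\le\widetilde C_s\max\{\epsilon^2,\epsilon^{k+1}\}.$$ Here $\widetilde C$ and $\widetilde C_s$ do not depend on $\epsilon$ or on the particular data and solutions; besides the indicated quantities they may depend on the coefficients $a_1,\dots,a_k$ and on the constants in the hypotheses ($c_0,C_0,C$, respectively $c_{0,s},C_{0,s},C_s$).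
   Context: $\mathbb N=\{1,2,3,\dots\}$. All data and solutions are real-valued and $H^s(\mathbb R)$ is the usual $L^2$-based Sobolev space. For $\sigma\in\mathbb N$, $\sigma\ge2$, and data in $H^\sigma(\mathbb R)$, "the solution" of either Cauchy problem means its unique strong solution, continuous in $t$ with values in $H^\sigma_x(\mathbb R)$ on its interval of existence (local existence and uniqueness is a known theorem of Staffilani, 1997, valid in $H^\sigma(\mathbb R)$ for $\sigma>1/2$); in (i) take $\sigma=2$ and in (ii) take $\sigma=s+1$. Both solutions are understood to exist on $[0,T]$ for the times $T$ in the claim. The reciprocal of $0$ is read as $+\infty$. *)

theory Defs
  imports
    "HOL-Analysis.Analysis"
    "HOL-Probability.Essential_Supremum"
    "HOL-Computational_Algebra.Polynomial"
begin

text \<open>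
  Elements of \<open>L\<^sup>2(\<real>)\<close> and \<open>H\<^sup>n(\<real>)\<close> are represented by Borel functions; two functions
  that agree almost everywhere represent the same element.
\<close>

definition L2 :: "(real \<Rightarrow> real) set" where
  "L2 = {f \<in> borel_measurable lborel. integrable lborel (\<lambda>x. (f x)\<^sup>2)}"

definition L2_norm :: "(real \<Rightarrow> real) \<Rightarrow> real" where
  "L2_norm f = sqrt (LINT x|lborel. (f x)\<^sup>2)"

definition Linf_norm :: "(real \<Rightarrow> real) \<Rightarrow> ereal" where
  "Linf_norm f = esssup lborel (\<lambda>x. ereal \<bar>f x\<bar>)"

definition test_function :: "(real \<Rightarrow> real) \<Rightarrow> bool" where
  "test_function \<phi> \<longleftrightarrow>
     (\<forall>n x. ((deriv ^^ n) \<phi>) differentiable (at x)) \<and> (\<exists>R. \<forall>x. \<bar>x\<bar> > R \<longrightarrow> \<phi> x = 0)"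

definition has_weak_deriv :: "nat \<Rightarrow> (real \<Rightarrow> real) \<Rightarrow> (real \<Rightarrow> real) \<Rightarrow> bool" where
  "has_weak_deriv j f g \<longleftrightarrow> g \<in> L2 \<and>
     (\<forall>\<phi>. test_function \<phi> \<longrightarrow>
        (LINT x|lborel. f x * (deriv ^^ j) \<phi> x) = (-1) ^ j * (LINT x|lborel. g x * \<phi> x))"

text \<open>The weak derivative is determined up to a null set only; this selects a representative.\<close>

definition weak_deriv :: "nat \<Rightarrow> (real \<Rightarrow> real) \<Rightarrow> real \<Rightarrow> real" where
  "weak_deriv j f = (SOME g. has_weak_deriv j f g)"

definition sobolev :: "nat \<Rightarrow> (real \<Rightarrow> real) set" where
  "sobolev n = {f \<in> L2. \<forall>j\<le>n. \<exists>g. has_weak_deriv j f g}"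

definition sobolev_norm :: "nat \<Rightarrow> (real \<Rightarrow> real) \<Rightarrow> real" where
  "sobolev_norm n f = sqrt (\<Sum>j\<le>n. (L2_norm (weak_deriv j f))\<^sup>2)"

definition continuous_in_sobolev :: "nat \<Rightarrow> real \<Rightarrow> (real \<Rightarrow> real \<Rightarrow> real) \<Rightarrow> bool" where
  "continuous_in_sobolev n T u \<longleftrightarrow>
     (\<forall>t\<in>{0..T}. u t \<in> sobolev n) \<and>
     (\<forall>t\<in>{0..T}. ((\<lambda>\<tau>. sobolev_norm n (\<lambda>x. u \<tau> x - u t x)) \<longlongrightarrow> 0) (at t within {0..T}))"

text \<open>
  \<open>u t x\<close> solves \<open>u\<^sub>t + u\<^sub>x\<^sub>x\<^sub>x + F(u) u\<^sub>x = 0\<close> on \<open>[0,T]\<close> with datum \<open>u0\<close>, in the class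
  \<open>C([0,T]; H\<^sup>n)\<close> with \<open>n \<ge> 2\<close>. The third derivative of \<open>u t\<close> lies only in \<open>H\<^sup>n\<^sup>-\<^sup>3\<close>, so the equation
  is read in the sense of distributions in \<open>x\<close>, at each time. As
  \<open>u\<^sub>x\<^sub>x\<^sub>x + F(u) u\<^sub>x\<close> is a continuous function of \<open>t\<close> with values in \<open>H\<^sup>n\<^sup>-\<^sup>3\<close>, this is the same as
  requiring \<open>u\<close> to be \<open>C\<^sup>1\<close> in time with values in \<open>H\<^sup>n\<^sup>-\<^sup>3\<close> and to satisfy the equation there.
\<close>

definition gkdv_solution ::
  "nat \<Rightarrow> (real \<Rightarrow> real) \<Rightarrow> real \<Rightarrow> (real \<Rightarrow> real) \<Rightarrow> (real \<Rightarrow> real \<Rightarrow> real) \<Rightarrow> bool" where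
  "gkdv_solution n F T u0 u \<longleftrightarrow>
     continuous_in_sobolev n T u \<and>
     (AE x in lborel. u 0 x = u0 x) \<and>
     (\<forall>\<phi>. test_function \<phi> \<longrightarrow> (\<forall>t\<in>{0<..<T}.
        ((\<lambda>\<tau>. LINT x|lborel. u \<tau> x * \<phi> x) has_real_derivative
           (LINT x|lborel. u t x * (deriv ^^ 3) \<phi> x)
           - (LINT x|lborel. F (u t x) * weak_deriv 1 (u t) x * \<phi> x)) (at t)))"

definition coeff_bound :: "real poly \<Rightarrow> real" where
  "coeff_bound F = Max ((\<lambda>j. real j * \<bar>coeff F j\<bar>) ` {1..degree F})"

text \<open>The type \<^typ>\<open>ereal\<close> provides the convention that the reciprocal of \<open>0\<close> is \<open>\<infinity>\<close>.\<close>

definition time_bound ::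
  "real \<Rightarrow> nat \<Rightarrow> real poly \<Rightarrow> (real \<Rightarrow> real) \<Rightarrow> (real \<Rightarrow> real) \<Rightarrow> ereal" where
  "time_bound c s F U0 u0 =
     ereal c * min (inverse (ereal (coeff_bound F * (\<Sum>j=1..degree F. sobolev_norm (s+1) U0 ^ j))))
                   (inverse (ereal (sobolev_norm (s+1) u0)))"

end

theory Submission
  imports Defs
begin

text \<open>
  The difference \<open>w = u - U\<close> solves the linear equation \<open>w\<^sub>t + w\<^sub>x\<^sub>x\<^sub>x + N = 0\<close> with
  \<open>N = u u\<^sub>x - F(U) U\<^sub>x\<close>. The dispersive part preserves every \<open>H\<^sup>r\<close> norm, so the norm of \<open>w\<close> grows
  at most at the rate \<open>\<parallel>N\<parallel>\<close>. Both terms of \<open>N\<close> are at least quadratic in solutions of size \<open>\<epsilon>\<close>: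
  by the algebra property of Sobolev spaces they are bounded in \<open>H\<^sup>r\<close> by a sum of powers \<open>\<epsilon>\<^sup>j\<^sup>+\<^sup>1\<close> with
  \<open>1 \<le> j \<le> k\<close>, as soon as \<open>u\<close> and \<open>U\<close> are of size \<open>\<epsilon>\<close> in \<open>H\<^sup>m\<close>, where \<open>m > r\<close> makes room for the
  derivative in \<open>N\<close> (\<open>gkdv_difference_le\<close>).

  That \<open>u\<close> and \<open>U\<close> keep the size of their data is where the restriction on \<open>T\<close> enters. In the
  \<open>H\<^sup>m\<close> energy identity the nonlinearity carries one derivative too many, but the principal part
  \<open>\<langle>F(U) \<partial>\<^sup>m\<^sup>+\<^sup>1 U, \<partial>\<^sup>m U\<rangle>\<close> reduces to \<open>- 1/2 \<langle>(F(U))\<^sub>x \<partial>\<^sup>m U, \<partial>\<^sup>m U\<rangle>\<close> by integration by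
  parts. Hence the squared norm \<open>y\<close> obeys \<open>y' \<le> C A \<Sum> y\<^sup>j\<^sup>/\<^sup>2 y\<close>, and the norm cannot double before a time
  that is a constant multiple of the reciprocal of \<open>A \<Sum> \<parallel>U\<^sub>0\<parallel>\<^sup>j\<close> (\<open>gkdv_norm_less\<close>). The equation for \<open>u\<close> is the case \<open>F(z) = z\<close>.

  Solutions are merely continuous in time with values in \<open>H\<^sup>m\<close> and solve the equation weakly, so the
  energies are regularized: \<open>\<parallel>\<partial>\<^sup>j w\<parallel>\<^sup>2\<close> is replaced by \<open>\<langle>w, \<psi> \<star> w\<rangle>\<close>, where
  \<open>\<psi> = (-1)\<^sup>j \<rho>\<^sup>(\<^sup>2\<^sup>j\<^sup>)\<close> and \<open>\<rho>\<close> is an even mollifier. This form is differentiable in time although the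
  equation is only tested against fixed functions (\<open>energy_identity\<close>), its dispersive contribution
  vanishes by parity, and it converges to the energy. The skew symmetry survives as a commutator
  estimate: after symmetrization of \<open>\<langle>a v, \<rho>' \<star> v\<rangle>\<close> the kernel is
  \<open>(a(x) - a(y)) \<rho>'(x - y)\<close>, which is bounded in \<open>L\<^sup>1\<close> uniformly in the scale of \<open>\<rho>\<close>
  (\<open>skew_form_le\<close>).
\<close>



section \<open>The Hilbert space structure of square-integrable functions\<close>

definition L2_inner :: "(real \<Rightarrow> real) \<Rightarrow> (real \<Rightarrow> real) \<Rightarrow> real" where
  "L2_inner f g = (LINT x|lborel. f x * g x)"

abbreviation L1_norm :: "(real \<Rightarrow> real) \<Rightarrow> real" where
  "L1_norm f \<equiv> (LINT x|lborel. \<bar>f x\<bar>)"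

lemma L2_measurable [measurable_dest]: "f \<in> L2 \<Longrightarrow> f \<in> borel_measurable borel"
  by (simp add: L2_def)

lemma L2_integrable_square: "f \<in> L2 \<Longrightarrow> integrable lborel (\<lambda>x. (f x)\<^sup>2)"
  by (simp add: L2_def)

lemma L2I: "f \<in> borel_measurable borel \<Longrightarrow> integrable lborel (\<lambda>x. (f x)\<^sup>2) \<Longrightarrow> f \<in> L2"
  by (simp add: L2_def)

lemma L2_bound:
  assumes "g \<in> L2" "f \<in> borel_measurable borel" "AE x in lborel. \<bar>f x\<bar> \<le> C * \<bar>g x\<bar>"
  shows "f \<in> L2"
proof (rule L2I[OF assms(2)])
  have "integrable lborel (\<lambda>x. C\<^sup>2 * (g x)\<^sup>2)"
    using L2_integrable_square[OF assms(1)] by simp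
  then show "integrable lborel (\<lambda>x. (f x)\<^sup>2)"
  proof (rule Bochner_Integration.integrable_bound)
    show "(\<lambda>x. (f x)\<^sup>2) \<in> borel_measurable lborel" using assms(2) by simp
    show "AE x in lborel. norm ((f x)\<^sup>2) \<le> norm (C\<^sup>2 * (g x)\<^sup>2)"
      using assms(3)
    proof eventually_elim
      case (elim x)
      have "\<bar>f x\<bar>\<^sup>2 \<le> (C * \<bar>g x\<bar>)\<^sup>2" by (rule power_mono[OF elim]) simp
      then show ?case by (simp add: power_mult_distrib)
    qed
  qed
qed

lemma L2_zero [simp]: "(\<lambda>x. 0) \<in> L2"
  by (simp add: L2_def)

lemma L2_cmult [intro]: "f \<in> L2 \<Longrightarrow> (\<lambda>x. c * f x) \<in> L2"
  by (rule L2_bound[where g=f and C="\<bar>c\<bar>"]) (auto simp: abs_mult dest: L2_measurable)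

lemma L2_add [intro]:
  assumes "f \<in> L2" "g \<in> L2" shows "(\<lambda>x. f x + g x) \<in> L2"
proof (rule L2I)
  note [measurable] = L2_measurable[OF assms(1)] L2_measurable[OF assms(2)]
  show "(\<lambda>x. f x + g x) \<in> borel_measurable borel" by measurable
  have "integrable lborel (\<lambda>x. 2 * (f x)\<^sup>2 + 2 * (g x)\<^sup>2)"
    using assms[THEN L2_integrable_square] by simp
  then show "integrable lborel (\<lambda>x. (f x + g x)\<^sup>2)"
  proof (rule Bochner_Integration.integrable_bound)
    have "(f x + g x)\<^sup>2 \<le> 2 * (f x)\<^sup>2 + 2 * (g x)\<^sup>2" for x
      using sum_squares_bound[of "f x" "g x"] by (simp add: power2_sum)
    then show "AE x in lborel. norm ((f x + g x)\<^sup>2) \<le> norm (2 * (f x)\<^sup>2 + 2 * (g x)\<^sup>2)"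
      by simp
  qed simp
qed

lemma L2_uminus [intro]: "f \<in> L2 \<Longrightarrow> (\<lambda>x. - f x) \<in> L2"
  using L2_cmult[of f "-1"] by simp

lemma L2_diff [intro]: "f \<in> L2 \<Longrightarrow> g \<in> L2 \<Longrightarrow> (\<lambda>x. f x - g x) \<in> L2"
  using L2_add[of f "\<lambda>x. - g x"] by auto

lemma integrable_L2_mult:
  assumes "f \<in> L2" "g \<in> L2" shows "integrable lborel (\<lambda>x. f x * g x)"
proof -
  note [measurable] = L2_measurable[OF assms(1)] L2_measurable[OF assms(2)]
  have "integrable lborel (\<lambda>x. (f x)\<^sup>2 + (g x)\<^sup>2)"
    using assms[THEN L2_integrable_square] by simp
  then show ?thesis
  proof (rule Bochner_Integration.integrable_bound)
    have "\<bar>f x * g x\<bar> \<le> (f x)\<^sup>2 + (g x)\<^sup>2" for x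
      using sum_squares_bound[of "\<bar>f x\<bar>" "\<bar>g x\<bar>"] abs_ge_zero[of "f x * g x"]
      unfolding abs_mult mult.assoc power2_abs by linarith
    then show "AE x in lborel. norm (f x * g x) \<le> norm ((f x)\<^sup>2 + (g x)\<^sup>2)"
      by simp
  qed simp
qed

lemma L2_norm_nonneg [simp]: "0 \<le> L2_norm f"
  by (simp add: L2_norm_def)

lemma L2_norm_square: "(L2_norm f)\<^sup>2 = (LINT x|lborel. (f x)\<^sup>2)"
  by (simp add: L2_norm_def)

lemma L2_norm_square_inner: "(L2_norm f)\<^sup>2 = L2_inner f f"
  unfolding L2_norm_square L2_inner_def by (simp add: power2_eq_square)

lemma L2_norm_zero [simp]: "L2_norm (\<lambda>x. 0) = 0"
  by (simp add: L2_norm_def)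

lemma L2_norm_cmult: "L2_norm (\<lambda>x. c * f x) = \<bar>c\<bar> * L2_norm f"
  by (simp add: L2_norm_def power_mult_distrib real_sqrt_mult)

lemma L2_norm_cong_AE:
  assumes "AE x in lborel. f x = g x" "f \<in> borel_measurable borel" "g \<in> borel_measurable borel"
  shows "L2_norm f = L2_norm g"
  unfolding L2_norm_def
  by (rule arg_cong[where f=sqrt], rule integral_cong_AE) (use assms in auto)

lemma L2_norm_eq_0_imp_AE:
  assumes "f \<in> L2" "L2_norm f = 0" shows "AE x in lborel. f x = 0"
proof -
  have "(LINT x|lborel. (f x)\<^sup>2) = 0" using assms(2) by (simp add: L2_norm_def)
  then have "AE x in lborel. (f x)\<^sup>2 = 0"
    using integral_nonneg_eq_0_iff_AE[OF L2_integrable_square[OF assms(1)]] by simp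
  then show ?thesis by simp
qed

lemma L2_inner_commute: "L2_inner f g = L2_inner g f"
  by (simp add: L2_inner_def mult.commute)

lemma L2_inner_cmult_left: "L2_inner (\<lambda>x. c * f x) g = c * L2_inner f g"
  by (simp add: L2_inner_def mult.assoc)

lemma L2_inner_cmult_right: "L2_inner g (\<lambda>x. c * f x) = c * L2_inner g f"
  by (metis L2_inner_cmult_left L2_inner_commute)

lemma L2_inner_add_left:
  "f \<in> L2 \<Longrightarrow> g \<in> L2 \<Longrightarrow> h \<in> L2 \<Longrightarrow> L2_inner (\<lambda>x. f x + g x) h = L2_inner f h + L2_inner g h"
  by (simp add: L2_inner_def distrib_right integrable_L2_mult)

lemma L2_inner_add_right:
  "f \<in> L2 \<Longrightarrow> g \<in> L2 \<Longrightarrow> h \<in> L2 \<Longrightarrow> L2_inner h (\<lambda>x. f x + g x) = L2_inner h f + L2_inner h g"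
  by (simp add: L2_inner_def distrib_left integrable_L2_mult)

lemma L2_inner_diff_left:
  "f \<in> L2 \<Longrightarrow> g \<in> L2 \<Longrightarrow> h \<in> L2 \<Longrightarrow> L2_inner (\<lambda>x. f x - g x) h = L2_inner f h - L2_inner g h"
  by (simp add: L2_inner_def left_diff_distrib integrable_L2_mult)

lemma L2_inner_diff_right:
  "f \<in> L2 \<Longrightarrow> g \<in> L2 \<Longrightarrow> h \<in> L2 \<Longrightarrow> L2_inner h (\<lambda>x. f x - g x) = L2_inner h f - L2_inner h g"
  by (simp add: L2_inner_def right_diff_distrib integrable_L2_mult)

lemma L2_abs_mult_le:
  assumes f: "f \<in> L2" and g: "g \<in> L2"
  shows "(LINT x|lborel. \<bar>f x * g x\<bar>) \<le> L2_norm f * L2_norm g"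
proof (cases "L2_norm f = 0 \<or> L2_norm g = 0")
  case True
  then have "AE x in lborel. f x = 0 \<or> g x = 0"
    using L2_norm_eq_0_imp_AE[OF f] L2_norm_eq_0_imp_AE[OF g] by fastforce
  then have "AE x in lborel. \<bar>f x * g x\<bar> = 0" by eventually_elim auto
  then have "(LINT x|lborel. \<bar>f x * g x\<bar>) = 0" by (rule integral_eq_zero_AE)
  then show ?thesis by simp
next
  case False
  define a where "a = L2_norm f"
  define b where "b = L2_norm g"
  have pos: "0 < a" "0 < b"
    using False L2_norm_nonneg[of f] L2_norm_nonneg[of g] by (auto simp: a_def b_def less_le)
  \<comment> \<open>The weight \<open>b / a\<close> makes the two sides of the arithmetic-geometric inequality balance.\<close>
  have le: "\<bar>f x * g x\<bar> \<le> (b / a) / 2 * (f x)\<^sup>2 + (a / b) / 2 * (g x)\<^sup>2" for x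
  proof -
    have "0 \<le> (b * \<bar>f x\<bar> - a * \<bar>g x\<bar>)\<^sup>2 / (2 * a * b)" using pos by simp
    also have "\<dots> = (b / a) / 2 * (f x)\<^sup>2 + (a / b) / 2 * (g x)\<^sup>2 - \<bar>f x * g x\<bar>"
      using pos by (simp add: power2_diff power_mult_distrib abs_mult field_simps power2_eq_square)
    finally show ?thesis by simp
  qed
  have i: "integrable lborel (\<lambda>x. (b / a) / 2 * (f x)\<^sup>2 + (a / b) / 2 * (g x)\<^sup>2)"
    by (intro Bochner_Integration.integrable_add integrable_mult_right L2_integrable_square f g)
  have "(LINT x|lborel. \<bar>f x * g x\<bar>)
      \<le> (LINT x|lborel. (b / a) / 2 * (f x)\<^sup>2 + (a / b) / 2 * (g x)\<^sup>2)"
    by (rule integral_mono[OF _ i])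
       (use le f g in \<open>auto intro!: integrable_abs integrable_L2_mult\<close>)
  also have "\<dots> = (b / a) / 2 * a\<^sup>2 + (a / b) / 2 * b\<^sup>2"
    unfolding a_def b_def L2_norm_square
    by (subst Bochner_Integration.integral_add)
       (intro integrable_mult_right L2_integrable_square f g | simp)+
  also have "\<dots> = a * b" using pos by (simp add: power2_eq_square)
  finally show ?thesis by (simp add: a_def b_def)
qed

lemma L2_Cauchy_Schwarz:
  assumes "f \<in> L2" "g \<in> L2"
  shows "\<bar>L2_inner f g\<bar> \<le> L2_norm f * L2_norm g"
proof -
  have "\<bar>L2_inner f g\<bar> \<le> (LINT x|lborel. \<bar>f x * g x\<bar>)"
    unfolding L2_inner_def by (rule integral_abs_bound)
  with L2_abs_mult_le[OF assms] show ?thesis by linarith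
qed

lemma L2_norm_triangle:
  assumes "f \<in> L2" "g \<in> L2"
  shows "L2_norm (\<lambda>x. f x + g x) \<le> L2_norm f + L2_norm g"
proof (rule power2_le_imp_le)
  have "(L2_norm (\<lambda>x. f x + g x))\<^sup>2 = (L2_norm f)\<^sup>2 + 2 * L2_inner f g + (L2_norm g)\<^sup>2"
    using assms by (simp add: L2_norm_square_inner L2_inner_add_left L2_inner_add_right L2_add
        L2_inner_commute[of g f])
  also have "\<dots> \<le> (L2_norm f + L2_norm g)\<^sup>2"
    using L2_Cauchy_Schwarz[OF assms] by (simp add: power2_sum)
  finally show "(L2_norm (\<lambda>x. f x + g x))\<^sup>2 \<le> (L2_norm f + L2_norm g)\<^sup>2" .
qed simp

lemma L2_norm_triangle_diff:
  assumes "f \<in> L2" "g \<in> L2"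
  shows "L2_norm (\<lambda>x. f x - g x) \<le> L2_norm f + L2_norm g"
  using L2_norm_triangle[OF assms(1) L2_uminus[OF assms(2)]] L2_norm_cmult[of "-1" g] by simp

lemma L2_norm_mono_AE:
  assumes "g \<in> L2" "f \<in> borel_measurable borel" "AE x in lborel. \<bar>f x\<bar> \<le> C * \<bar>g x\<bar>" "0 \<le> C"
  shows "L2_norm f \<le> C * L2_norm g"
proof -
  have f: "f \<in> L2" using assms(1-3) by (rule L2_bound)
  have "L2_norm f \<le> L2_norm (\<lambda>x. C * g x)"
    unfolding L2_norm_def
  proof (rule real_sqrt_le_mono, rule integral_mono_AE)
    show "AE x in lborel. (f x)\<^sup>2 \<le> (C * g x)\<^sup>2"
      using assms(3) by eventually_elim (use assms(4) in \<open>simp add: abs_le_square_iff[symmetric] abs_mult\<close>)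
  qed (use f assms(1) in \<open>auto intro!: L2_integrable_square\<close>)
  then show ?thesis using assms(4) by (simp add: L2_norm_cmult)
qed

lemma integral_shift: "(LINT x|lborel. f (x + z)) = (LINT x|lborel. f x :: real)" for z :: real
  using lborel_integral_real_affine[of 1 f z] by (simp add: add.commute)

lemma integrable_shift_iff:
  "integrable lborel (\<lambda>x. f (x + z)) \<longleftrightarrow> integrable lborel (f :: real \<Rightarrow> real)" for z :: real
  using lborel_integrable_real_affine_iff[of 1 f z] by (simp add: add.commute)

lemma L2_shift:
  assumes "f \<in> L2" shows "(\<lambda>x. f (x + z)) \<in> L2"
proof (rule L2I)
  note [measurable] = L2_measurable[OF assms]
  show "(\<lambda>x. f (x + z)) \<in> borel_measurable borel" by measurable
  show "integrable lborel (\<lambda>x. (f (x + z))\<^sup>2)"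
    using L2_integrable_square[OF assms] integrable_shift_iff[of "\<lambda>x. (f x)\<^sup>2" z] by simp
qed

lemma L2_norm_shift: "L2_norm (\<lambda>x. f (x + z)) = L2_norm f"
  unfolding L2_norm_def using integral_shift[of "\<lambda>x. (f x)\<^sup>2" z] by simp

lemma tendsto_L2_norm_0:
  assumes lim: "AE x in lborel. (\<lambda>n. f n x) \<longlonglongrightarrow> 0" and g: "g \<in> L2"
    and m: "\<And>n. f n \<in> borel_measurable borel"
    and bd: "\<And>n. AE x in lborel. \<bar>f n x\<bar> \<le> \<bar>g x\<bar>"
  shows "(\<lambda>n. L2_norm (f n)) \<longlonglongrightarrow> 0"
proof -
  have "(\<lambda>n. LINT x|lborel. (f n x)\<^sup>2) \<longlonglongrightarrow> (LINT x::real|lborel. 0)"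
  proof (rule integral_dominated_convergence[where w="\<lambda>x. (g x)\<^sup>2"])
    show "AE x in lborel. (\<lambda>n. (f n x)\<^sup>2) \<longlonglongrightarrow> 0"
      using lim by eventually_elim (auto intro!: tendsto_eq_intros)
    show "AE x in lborel. norm ((f n x)\<^sup>2) \<le> (g x)\<^sup>2" for n
      using bd[of n] by eventually_elim (simp add: abs_le_square_iff[symmetric])
  qed (use g m in \<open>auto intro: L2_integrable_square\<close>)
  then have "(\<lambda>n. sqrt (LINT x|lborel. (f n x)\<^sup>2)) \<longlonglongrightarrow> sqrt 0"
    by (intro tendsto_real_sqrt) simp
  then show ?thesis by (simp add: L2_norm_def)
qed

section \<open>Continuity of translation\<close>

text \<open>
  Continuity at \<open>0\<close> is stated along sequences, which is the form that dominated convergence uses.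
\<close>

definition translation_continuous :: "(real \<Rightarrow> real) \<Rightarrow> bool" where
  "translation_continuous g \<longleftrightarrow>
     (\<forall>Z. Z \<longlonglongrightarrow> 0 \<longrightarrow> (\<lambda>n. L2_norm (\<lambda>x. g (x + Z n) - g x)) \<longlonglongrightarrow> 0)"

lemma translation_continuous_approx:
  assumes g: "g \<in> L2"
    and ex: "\<And>e. e > 0 \<Longrightarrow> \<exists>h\<in>L2. translation_continuous h \<and> L2_norm (\<lambda>x. g x - h x) < e"
  shows "translation_continuous g"
  unfolding translation_continuous_def
proof (intro allI impI)
  fix Z :: "nat \<Rightarrow> real" assume Z: "Z \<longlonglongrightarrow> 0"
  show "(\<lambda>n. L2_norm (\<lambda>x. g (x + Z n) - g x)) \<longlonglongrightarrow> 0"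
  proof (rule LIMSEQ_I)
    fix e :: real assume "e > 0"
    then obtain h where h: "h \<in> L2" "translation_continuous h" "L2_norm (\<lambda>x. g x - h x) < e / 3"
      using ex[of "e / 3"] by auto
    have "(\<lambda>n. L2_norm (\<lambda>x. h (x + Z n) - h x)) \<longlonglongrightarrow> 0"
      using h(2) Z by (simp add: translation_continuous_def)
    then obtain N where N: "\<And>n. n \<ge> N \<Longrightarrow> L2_norm (\<lambda>x. h (x + Z n) - h x) < e / 3"
      using LIMSEQ_D[of _ 0 "e / 3"] \<open>e > 0\<close> by force
    have "L2_norm (\<lambda>x. g (x + Z n) - g x) < e" if "n \<ge> N" for n
    proof -
      let ?d = "\<lambda>x. g x - h x"
      have d: "?d \<in> L2" "(\<lambda>x. ?d (x + Z n)) \<in> L2" "(\<lambda>x. h (x + Z n) - h x) \<in> L2"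
        using g h(1) L2_shift[of "?d"] L2_shift[OF h(1)] by (auto intro: L2_diff)
      have "(\<lambda>x. g (x + Z n) - g x) = (\<lambda>x. (?d (x + Z n) - ?d x) + (h (x + Z n) - h x))"
        by auto
      then have "L2_norm (\<lambda>x. g (x + Z n) - g x)
          \<le> L2_norm (\<lambda>x. ?d (x + Z n) - ?d x) + L2_norm (\<lambda>x. h (x + Z n) - h x)"
        using L2_norm_triangle[OF L2_diff[OF d(2,1)] d(3)] by simp
      moreover have "L2_norm (\<lambda>x. ?d (x + Z n) - ?d x) \<le> L2_norm (\<lambda>x. ?d (x + Z n)) + L2_norm ?d"
        by (rule L2_norm_triangle_diff[OF d(2,1)])
      moreover have "L2_norm (\<lambda>x. ?d (x + Z n)) = L2_norm ?d" by (rule L2_norm_shift)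
      ultimately show ?thesis using h(3) N[OF that] by linarith
    qed
    then show "\<exists>N. \<forall>n\<ge>N. norm (L2_norm (\<lambda>x. g (x + Z n) - g x) - 0) < e" by auto
  qed
qed

lemma translation_continuous_add:
  assumes "f \<in> L2" "g \<in> L2" "translation_continuous f" "translation_continuous g"
  shows "translation_continuous (\<lambda>x. f x + g x)"
  unfolding translation_continuous_def
proof (intro allI impI)
  fix Z :: "nat \<Rightarrow> real" assume Z: "Z \<longlonglongrightarrow> 0"
  have lim: "(\<lambda>n. L2_norm (\<lambda>x. f (x + Z n) - f x) + L2_norm (\<lambda>x. g (x + Z n) - g x)) \<longlonglongrightarrow> 0 + 0"
    by (rule tendsto_add) (use assms Z in \<open>auto simp: translation_continuous_def\<close>)
  show "(\<lambda>n. L2_norm (\<lambda>x. f (x + Z n) + g (x + Z n) - (f x + g x))) \<longlonglongrightarrow> 0"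
  proof (rule tendsto_sandwich[OF _ _ tendsto_const])
    show "\<forall>\<^sub>F n in sequentially. L2_norm (\<lambda>x. f (x + Z n) + g (x + Z n) - (f x + g x))
        \<le> L2_norm (\<lambda>x. f (x + Z n) - f x) + L2_norm (\<lambda>x. g (x + Z n) - g x)"
    proof (intro always_eventually allI)
      fix n
      have "(\<lambda>x. f (x + Z n) + g (x + Z n) - (f x + g x))
          = (\<lambda>x. (f (x + Z n) - f x) + (g (x + Z n) - g x))" by auto
      then show "L2_norm (\<lambda>x. f (x + Z n) + g (x + Z n) - (f x + g x))
        \<le> L2_norm (\<lambda>x. f (x + Z n) - f x) + L2_norm (\<lambda>x. g (x + Z n) - g x)"
        using L2_norm_triangle[of "\<lambda>x. f (x + Z n) - f x" "\<lambda>x. g (x + Z n) - g x"] assms(1,2)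
        by (simp add: L2_diff L2_shift)
    qed
  qed (use lim in auto)
qed

lemma translation_continuous_cmult:
  assumes "translation_continuous f"
  shows "translation_continuous (\<lambda>x. c * f x)"
  unfolding translation_continuous_def
proof (intro allI impI)
  fix Z :: "nat \<Rightarrow> real" assume Z: "Z \<longlonglongrightarrow> 0"
  have "(\<lambda>n. \<bar>c\<bar> * L2_norm (\<lambda>x. f (x + Z n) - f x)) \<longlonglongrightarrow> \<bar>c\<bar> * 0"
    by (rule tendsto_mult_left) (use assms Z in \<open>auto simp: translation_continuous_def\<close>)
  then show "(\<lambda>n. L2_norm (\<lambda>x. c * f (x + Z n) - c * f x)) \<longlonglongrightarrow> 0"
    by (simp flip: L2_norm_cmult add: right_diff_distrib)
qed

lemma indicator_in_L2:
  assumes "A \<in> sets borel" "emeasure lborel A < \<infinity>"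
  shows "(indicator A :: real \<Rightarrow> real) \<in> L2"
  by (rule L2I) (use assms in \<open>auto simp: power2_eq_square indicator_inter_arith[symmetric]\<close>)

text \<open>
  For an open set \<open>U\<close> the indicator is lower semicontinuous, so the part of \<open>U\<close> that leaves \<open>U\<close>
  under a small translation has small measure by dominated convergence. The part that enters has the
  same measure, because translation preserves the measure of \<open>U\<close>.
\<close>

lemma translation_continuous_open:
  assumes U: "open U" "emeasure lborel U < \<infinity>"
  shows "translation_continuous (indicator U)"
  unfolding translation_continuous_def
proof (intro allI impI)
  fix Z :: "nat \<Rightarrow> real" assume Z: "Z \<longlonglongrightarrow> 0"
  let ?i = "indicator U :: real \<Rightarrow> real"
  have [measurable]: "U \<in> sets borel" using U by simp
  have int: "integrable lborel ?i" using U by simp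
  have ints: "integrable lborel (\<lambda>x. ?i (x + z))" for z
    using int integrable_shift_iff[of ?i z] by simp
  have intm: "integrable lborel (\<lambda>x. ?i x * ?i (x + z))" for z
    by (rule Bochner_Integration.integrable_bound[OF int]) (auto simp: indicator_def)
  have eq: "(LINT x|lborel. (?i (x + z) - ?i x)\<^sup>2) = 2 * (LINT x|lborel. ?i x - ?i x * ?i (x + z))" for z
  proof -
    have "(LINT x|lborel. (?i (x + z) - ?i x)\<^sup>2)
        = (LINT x|lborel. ?i (x + z) + ?i x - 2 * (?i x * ?i (x + z)))"
      by (rule Bochner_Integration.integral_cong) (auto simp: indicator_def)
    also have "\<dots> = (LINT x|lborel. ?i (x + z)) + (LINT x|lborel. ?i x) - 2 * (LINT x|lborel. ?i x * ?i (x + z))"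
      using int ints intm by simp
    also have "(LINT x|lborel. ?i (x + z)) = (LINT x|lborel. ?i x)" by (rule integral_shift)
    finally show ?thesis using int intm[of z] by simp
  qed
  have "(\<lambda>n. LINT x|lborel. ?i x - ?i x * ?i (x + Z n)) \<longlonglongrightarrow> (LINT x::real|lborel. 0)"
  proof (rule integral_dominated_convergence[where w="?i"])
    show "AE x in lborel. (\<lambda>n. ?i x - ?i x * ?i (x + Z n)) \<longlonglongrightarrow> 0"
    proof (rule AE_I2)
      fix x :: real
      have "\<forall>\<^sub>F n in sequentially. ?i x - ?i x * ?i (x + Z n) = 0"
      proof (cases "x \<in> U")
        case True
        have "(\<lambda>n. x + Z n) \<longlonglongrightarrow> x + 0" by (intro tendsto_intros Z)
        then have "\<forall>\<^sub>F n in sequentially. x + Z n \<in> U"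
          using U(1) True by (simp add: topological_tendstoD)
        then show ?thesis by eventually_elim (simp add: True)
      qed simp
      then show "(\<lambda>n. ?i x - ?i x * ?i (x + Z n)) \<longlonglongrightarrow> 0" by (rule tendsto_eventually)
    qed
  qed (use int in \<open>auto simp: indicator_def\<close>)
  then have "(\<lambda>n. sqrt (LINT x|lborel. (?i (x + Z n) - ?i x)\<^sup>2)) \<longlonglongrightarrow> sqrt (2 * 0)"
    unfolding eq by (intro tendsto_intros) simp
  then show "(\<lambda>n. L2_norm (\<lambda>x. ?i (x + Z n) - ?i x)) \<longlonglongrightarrow> 0"
    by (simp add: L2_norm_def)
qed

text \<open>
  Outer regularity makes the indicators of open sets dense among those of all sets of finite measure.
\<close>

lemma translation_continuous_indicator:
  assumes A: "A \<in> sets borel" "emeasure lborel A < \<infinity>"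
  shows "translation_continuous (indicator A)"
proof (rule translation_continuous_approx[OF indicator_in_L2[OF A]])
  fix e :: real assume e: "e > 0"
  obtain U where U: "open U" "A \<subseteq> U" "emeasure lborel (U - A) < ennreal (e\<^sup>2)"
    using outer_regular_lborel[OF A(1), of "e\<^sup>2"] e by auto
  have [measurable]: "U \<in> sets borel" "A \<in> sets borel" using U A by auto
  have "emeasure lborel U \<le> emeasure lborel A + emeasure lborel (U - A)"
    using U(2) by (subst plus_emeasure) (auto intro!: emeasure_mono)
  also have "\<dots> < \<infinity>"
    using A(2) less_trans[OF U(3) ennreal_less_top] by simp
  finally have fin: "emeasure lborel U < \<infinity>" .
  have "(L2_norm (\<lambda>x. indicator A x - indicator U x))\<^sup>2 = (LINT x|lborel. indicator (U - A) x)"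
    unfolding L2_norm_square
    by (rule Bochner_Integration.integral_cong) (use U(2) in \<open>auto simp: indicator_def\<close>)
  also have "\<dots> = measure lborel (U - A)" by simp
  also have "\<dots> < e\<^sup>2"
    using U(3) less_trans[OF U(3) ennreal_less_top]
    by (simp add: emeasure_eq_ennreal_measure less_top ennreal_less_iff)
  finally have "L2_norm (\<lambda>x. indicator A x - indicator U x) < e"
    using e by (simp add: power2_less_imp_less)
  then show "\<exists>h\<in>L2. translation_continuous h \<and> L2_norm (\<lambda>x. indicator A x - h x) < e"
    using translation_continuous_open[OF U(1) fin] indicator_in_L2[of U] fin by auto
qed

lemma translation_continuous_nonneg:
  assumes "f \<in> borel_measurable borel" "\<And>x. 0 \<le> f x" "integrable lborel (\<lambda>x. (f x)\<^sup>2)"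
  shows "translation_continuous f"
proof -
  have "f \<in> borel_measurable lborel" using assms(1) by simp
  from this assms(2,3) show ?thesis
  proof (induction f rule: borel_measurable_induct_real)
    case (set A)
    have "(\<lambda>x. (indicator A x)\<^sup>2 :: real) = indicator A" by (auto simp: indicator_def)
    then have "integrable lborel (indicator A :: real \<Rightarrow> real)" using set by simp
    then have "emeasure lborel A < \<infinity>" using set by (simp add: integrable_indicator_iff)
    then show ?case using set by (intro translation_continuous_indicator) auto
  next
    case (mult u c)
    show ?case
    proof (cases "c = 0")
      case True
      then show ?thesis by (simp add: translation_continuous_def)
    next
      case False
      then have "integrable lborel (\<lambda>x. (u x)\<^sup>2)" using mult by (simp add: power_mult_distrib)
      then show ?thesis using mult by (intro translation_continuous_cmult) auto
    qed
  next
    case (add u v)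
    have "(\<lambda>x. v x + u x) \<in> L2" using add by (intro L2I) auto
    then have "u \<in> L2" "v \<in> L2"
      using add by (auto intro!: L2_bound[where g="\<lambda>x. v x + u x" and C=1])
    then show ?case using add by (intro translation_continuous_add) (auto simp: L2_def)
  next
    case (seq U)
    have f: "f \<in> L2" using assms by (intro L2I) auto
    have le: "U i x \<le> f x" for i x
      using seq.hyps(3,4) by (intro incseq_le) (auto simp: incseq_def le_fun_def)
    have U: "U i \<in> L2" for i
      using seq.hyps(1,2)[of i] order_trans[OF le abs_ge_self, of i] by (intro L2_bound[OF f, where C=1]) auto
    have lim: "(\<lambda>i. L2_norm (\<lambda>x. f x - U i x)) \<longlonglongrightarrow> 0"
    proof (rule tendsto_L2_norm_0[OF _ f])
      have "(\<lambda>n. f x - U n x) \<longlonglongrightarrow> f x - f x" for x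
        using seq.hyps(4)[of x] by (intro tendsto_diff tendsto_const) simp
      then show "AE x in lborel. (\<lambda>n. f x - U n x) \<longlonglongrightarrow> 0" by simp
      show "(\<lambda>x. f x - U n x) \<in> borel_measurable borel" for n
        using f U by (intro borel_measurable_diff L2_measurable)
      show "AE x in lborel. \<bar>f x - U n x\<bar> \<le> \<bar>f x\<bar>" for n
      proof (rule AE_I2)
        show "\<bar>f x - U n x\<bar> \<le> \<bar>f x\<bar>" for x
          using le[of n x] seq.hyps(2)[of n x] by linarith
      qed
    qed
    show ?case
    proof (rule translation_continuous_approx[OF f])
      fix e :: real assume "e > 0"
      then obtain i where "L2_norm (\<lambda>x. f x - U i x) < e"
        using LIMSEQ_D[OF lim, of e] by force
      moreover have "translation_continuous (U i)" using seq.IH U by (simp add: L2_def)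
      ultimately show "\<exists>h\<in>L2. translation_continuous h \<and> L2_norm (\<lambda>x. f x - h x) < e"
        using U by auto
    qed
  qed
qed

lemma translation_continuous_L2:
  assumes "f \<in> L2" shows "translation_continuous f"
proof -
  note [measurable] = L2_measurable[OF assms]
  have pos: "(\<lambda>x. max 0 (g x)) \<in> L2" if "g \<in> L2" for g :: "real \<Rightarrow> real"
    using that by (intro L2_bound[OF that, where C=1]) (auto dest: L2_measurable)
  have p: "(\<lambda>x. max 0 (f x)) \<in> L2" "(\<lambda>x. max 0 (- f x)) \<in> L2"
    using pos[OF assms] pos[OF L2_uminus[OF assms]] by auto
  have "translation_continuous (\<lambda>x. max 0 (f x) + (-1) * max 0 (- f x))"
    using p by (intro translation_continuous_add translation_continuous_cmult
        translation_continuous_nonneg L2_cmult) (auto dest: L2_measurable L2_integrable_square)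
  also have "(\<lambda>x. max 0 (f x) + (-1) * max 0 (- f x)) = f" by auto
  finally show ?thesis .
qed


section \<open>Smooth functions and mollifiers\<close>

text \<open>
  The derivative of a product is a sum of products of functions that are differentiable once less. With
  a bound on the order this becomes an induction, which smoothness alone does not offer.
\<close>

definition differentiable_upto :: "nat \<Rightarrow> (real \<Rightarrow> real) \<Rightarrow> bool" where
  "differentiable_upto n f \<longleftrightarrow> (\<forall>i\<le>n. \<forall>x. (deriv ^^ i) f differentiable (at x))"

definition smooth :: "(real \<Rightarrow> real) \<Rightarrow> bool" where
  "smooth f \<longleftrightarrow> (\<forall>n x. (deriv ^^ n) f differentiable (at x))"

lemma smooth_iff_upto: "smooth f \<longleftrightarrow> (\<forall>n. differentiable_upto n f)"
  by (auto simp: smooth_def differentiable_upto_def)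

lemma differentiable_upto_0: "differentiable_upto 0 f \<longleftrightarrow> (\<forall>x. f differentiable (at x))"
  by (simp add: differentiable_upto_def)

lemma differentiable_upto_Suc:
  "differentiable_upto (Suc n) f \<longleftrightarrow> (\<forall>x. f differentiable (at x)) \<and> differentiable_upto n (deriv f)"
proof -
  have "(\<forall>i\<le>Suc n. P i) \<longleftrightarrow> P 0 \<and> (\<forall>i\<le>n. P (Suc i))" for P
    by (metis Suc_le_mono not0_implies_Suc zero_le)
  then show ?thesis
    unfolding differentiable_upto_def by (simp add: funpow_swap1)
qed

lemma differentiable_upto_mono: "differentiable_upto n f \<Longrightarrow> m \<le> n \<Longrightarrow> differentiable_upto m f"
  by (auto simp: differentiable_upto_def)

lemma differentiable_DERIV_deriv: "f differentiable (at x) \<Longrightarrow> (f has_real_derivative deriv f x) (at x)"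
  for f :: "real \<Rightarrow> real"
  by (simp add: DERIV_deriv_iff_real_differentiable)

lemma differentiable_upto_add:
  "differentiable_upto n f \<Longrightarrow> differentiable_upto n g \<Longrightarrow> differentiable_upto n (\<lambda>x. f x + g x)"
proof (induction n arbitrary: f g)
  case 0 then show ?case by (auto simp: differentiable_upto_0 intro: differentiable_add)
next
  case (Suc n)
  have "deriv (\<lambda>x. f x + g x) = (\<lambda>x. deriv f x + deriv g x)"
    using Suc.prems by (auto intro!: DERIV_imp_deriv DERIV_add differentiable_DERIV_deriv
        simp: differentiable_upto_Suc)
  then show ?case using Suc by (auto simp: differentiable_upto_Suc intro: differentiable_add)
qed

lemma differentiable_upto_mult:
  "differentiable_upto n f \<Longrightarrow> differentiable_upto n g \<Longrightarrow> differentiable_upto n (\<lambda>x. f x * g x)"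
proof (induction n arbitrary: f g)
  case 0 then show ?case by (auto simp: differentiable_upto_0 intro: differentiable_mult)
next
  case (Suc n)
  have "deriv (\<lambda>x. f x * g x) = (\<lambda>x. deriv f x * g x + f x * deriv g x)"
    using Suc.prems
    by (auto intro!: DERIV_imp_deriv ext DERIV_mult'[THEN DERIV_cong] differentiable_DERIV_deriv
        simp: differentiable_upto_Suc)
  moreover have "differentiable_upto n f" "differentiable_upto n g"
    using Suc.prems differentiable_upto_mono[of "Suc n" _ n] by auto
  ultimately show ?case
    using Suc by (auto simp: differentiable_upto_Suc intro: differentiable_mult intro!: differentiable_upto_add)
qed

lemma smooth_mult: "smooth f \<Longrightarrow> smooth g \<Longrightarrow> smooth (\<lambda>x. f x * g x)"
  by (simp add: smooth_iff_upto differentiable_upto_mult)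

lemma smooth_DERIV:
  "smooth f \<Longrightarrow> ((deriv ^^ n) f has_real_derivative (deriv ^^ Suc n) f x) (at x)"
  by (simp add: smooth_def differentiable_DERIV_deriv)

lemma smooth_deriv: "smooth f \<Longrightarrow> smooth ((deriv ^^ k) f)"
  by (simp add: smooth_def flip: funpow_add comp_apply[of "deriv ^^ _" "deriv ^^ _"])

lemma smooth_continuous: "smooth f \<Longrightarrow> continuous_on S ((deriv ^^ n) f)"
  by (rule continuous_at_imp_continuous_on) (use smooth_DERIV DERIV_isCont in blast)

lemma DERIV_affine:
  fixes g :: "real \<Rightarrow> real"
  assumes "(g has_real_derivative D) (at (a + b * x))"
  shows "((\<lambda>x. g (a + b * x)) has_real_derivative b * D) (at x)"
proof -
  have "((\<lambda>x. a + b * x) has_real_derivative b) (at x)" by (auto intro!: derivative_eq_intros)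
  from DERIV_chain2[where f=g and g="\<lambda>x. a + b * x", OF assms this] show ?thesis
    by (simp add: mult.commute)
qed

lemma smooth_funpow_deriv_affine:
  assumes "smooth f"
  shows "(deriv ^^ n) (\<lambda>x. f (a + b * x)) = (\<lambda>x. b ^ n * (deriv ^^ n) f (a + b * x))"
proof (induction n)
  case (Suc n)
  have "((\<lambda>x. b ^ n * (deriv ^^ n) f (a + b * x)) has_real_derivative
      b ^ Suc n * (deriv ^^ Suc n) f (a + b * x)) (at x)" for x
    using DERIV_cmult[OF DERIV_affine[OF smooth_DERIV[OF assms, of n "a + b * x"]], of "b ^ n"]
    by (simp add: mult_ac)
  then have "deriv (\<lambda>x. b ^ n * (deriv ^^ n) f (a + b * x))
      = (\<lambda>x. b ^ Suc n * (deriv ^^ Suc n) f (a + b * x))"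
    by (auto intro!: DERIV_imp_deriv)
  then show ?case using Suc by simp
qed simp

lemma smooth_affine:
  assumes "smooth f" shows "smooth (\<lambda>x. f (a + b * x))"
  unfolding smooth_def
proof (intro allI)
  fix n x
  have "((\<lambda>x. b ^ n * (deriv ^^ n) f (a + b * x)) has_real_derivative
      b ^ n * (b * (deriv ^^ Suc n) f (a + b * x))) (at x)"
    by (rule DERIV_cmult[OF DERIV_affine[OF smooth_DERIV[OF assms]]])
  then show "(deriv ^^ n) (\<lambda>x. f (a + b * x)) differentiable at x"
    unfolding smooth_funpow_deriv_affine[OF assms] using real_differentiable_def by blast
qed

lemma smooth_const: "smooth (\<lambda>x. c)"
proof -
  have "differentiable_upto n (\<lambda>x. c)" for n
    by (induction n arbitrary: c) (auto simp: differentiable_upto_0 differentiable_upto_Suc)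
  then show ?thesis by (simp add: smooth_iff_upto)
qed

lemma smooth_cmult: "smooth f \<Longrightarrow> smooth (\<lambda>x. c * f x)"
  by (rule smooth_mult[OF smooth_const])

lemma funpow_deriv_cmult:
  assumes "smooth f" shows "(deriv ^^ n) (\<lambda>x. c * f x) = (\<lambda>x. c * (deriv ^^ n) f x)"
proof (induction n)
  case (Suc n)
  have "deriv (\<lambda>x. c * (deriv ^^ n) f x) = (\<lambda>x. c * (deriv ^^ Suc n) f x)"
    by (intro ext DERIV_imp_deriv DERIV_cmult smooth_DERIV assms)
  then show ?case using Suc by simp
qed simp

lemma test_function_iff: "test_function \<phi> \<longleftrightarrow> smooth \<phi> \<and> (\<exists>R. \<forall>x. \<bar>x\<bar> > R \<longrightarrow> \<phi> x = 0)"
  by (simp add: test_function_def smooth_def)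

lemma test_function_smooth: "test_function \<phi> \<Longrightarrow> smooth \<phi>"
  by (simp add: test_function_iff)

lemma funpow_deriv_vanishes:
  assumes "\<forall>x. \<bar>x\<bar> > R \<longrightarrow> \<phi> x = 0" shows "\<forall>x. \<bar>x\<bar> > R \<longrightarrow> (deriv ^^ n) \<phi> x = (0::real)"
proof (induction n)
  case (Suc n)
  have "deriv ((deriv ^^ n) \<phi>) x = 0" if "\<bar>x\<bar> > R" for x
  proof (rule DERIV_imp_deriv)
    have "open {x::real. R < \<bar>x\<bar>}" by (intro open_Collect_less continuous_intros)
    then have "\<forall>\<^sub>F y in nhds x. y \<in> {x. R < \<bar>x\<bar>}" using that by (intro eventually_nhds_in_open) auto
    then have "\<forall>\<^sub>F y in nhds x. (deriv ^^ n) \<phi> y = 0"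
      by eventually_elim (use Suc in auto)
    then have "((deriv ^^ n) \<phi> has_real_derivative 0) (at x) \<longleftrightarrow> ((\<lambda>x. 0) has_real_derivative 0) (at x)"
      by (intro DERIV_cong_ev) auto
    then show "((deriv ^^ n) \<phi> has_real_derivative 0) (at x)" by simp
  qed
  then show ?case by simp
qed (use assms in simp)

lemma test_function_deriv: "test_function \<phi> \<Longrightarrow> test_function ((deriv ^^ n) \<phi>)"
  unfolding test_function_iff using funpow_deriv_vanishes smooth_deriv by blast

lemma test_function_cmult: "test_function \<phi> \<Longrightarrow> test_function (\<lambda>x. c * \<phi> x)"
  unfolding test_function_iff using smooth_cmult by fastforce

lemma test_function_mult_smooth: "test_function \<phi> \<Longrightarrow> smooth f \<Longrightarrow> test_function (\<lambda>x. f x * \<phi> x)"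
  unfolding test_function_iff using smooth_mult by fastforce

lemma test_function_reflect_shift:
  assumes "test_function \<phi>" shows "test_function (\<lambda>y. \<phi> (x - y))"
proof -
  obtain R where R: "\<forall>x. \<bar>x\<bar> > R \<longrightarrow> \<phi> x = 0" using assms by (auto simp: test_function_iff)
  have "\<bar>y\<bar> > R + \<bar>x\<bar> \<longrightarrow> \<phi> (x - y) = 0" for y
    using R[rule_format, of "x - y"] by linarith
  moreover have "smooth (\<lambda>y. \<phi> (x - y))"
    using smooth_affine[of \<phi> x "-1"] assms by (simp add: test_function_iff)
  ultimately show ?thesis unfolding test_function_iff by blast
qed

lemma test_function_bounded:
  assumes "test_function \<phi>"
  obtains R B where "0 < R" "0 \<le> B" "\<And>x. \<bar>x\<bar> > R \<Longrightarrow> \<phi> x = 0" "\<And>x. \<bar>\<phi> x\<bar> \<le> B"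
    "\<And>x. \<bar>\<phi> x\<bar> \<le> B * indicator {-R..R} x"
proof -
  obtain R0 where R0: "\<forall>x. \<bar>x\<bar> > R0 \<longrightarrow> \<phi> x = 0" using assms by (auto simp: test_function_iff)
  define R where "R = max R0 1"
  have R: "\<phi> x = 0" if "\<bar>x\<bar> > R" for x using R0 that by (simp add: R_def)
  have "continuous_on {-R..R} \<phi>" using smooth_continuous[of \<phi> "{-R..R}" 0] assms
    by (simp add: test_function_iff)
  then have "bounded (\<phi> ` {-R..R})" by (intro compact_imp_bounded compact_continuous_image) auto
  then obtain B where B: "0 < B" "\<And>x. x \<in> {-R..R} \<Longrightarrow> \<bar>\<phi> x\<bar> \<le> B"
    by (auto simp: bounded_pos)
  have B': "\<bar>\<phi> x\<bar> \<le> B * indicator {-R..R} x" for x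
    using B(2)[of x] R[of x] by (auto simp: indicator_def)
  have "\<bar>\<phi> x\<bar> \<le> B" for x using B'[of x] B(1) by (cases "x \<in> {-R..R}") auto
  with B(1) R B' show thesis by (intro that[of R B]) (auto simp: R_def)
qed

lemma test_function_measurable: "test_function \<phi> \<Longrightarrow> \<phi> \<in> borel_measurable borel"
  using smooth_continuous[of \<phi> UNIV 0] by (simp add: test_function_iff borel_measurable_continuous_onI)

lemma test_function_integrable:
  assumes "test_function \<phi>" shows "integrable lborel \<phi>"
proof -
  obtain R B where B: "\<And>x. \<bar>\<phi> x\<bar> \<le> B * indicator {-R..R} x"
    using test_function_bounded[OF assms] by metis
  have "integrable lborel (\<lambda>x. B * indicator {-R..R} x)"
    by (simp add: integrable_indicator_iff emeasure_lborel_Icc_eq)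
  then show ?thesis
    by (rule Bochner_Integration.integrable_bound)
       (use order_trans[OF B abs_ge_self] test_function_measurable[OF assms] in auto)
qed

lemma test_function_L2:
  assumes "test_function \<phi>" shows "\<phi> \<in> L2"
proof -
  obtain R B where B: "\<And>x. \<bar>\<phi> x\<bar> \<le> B * indicator {-R..R} x"
    using test_function_bounded[OF assms] by metis
  show ?thesis
    by (rule L2_bound[where g="indicator {-R..R}" and C=B, OF indicator_in_L2])
       (use B test_function_measurable[OF assms] in \<open>auto simp: emeasure_lborel_Icc_eq\<close>)
qed

text \<open>
  The functions \<open>p(1/x) exp(-1/x)\<close> on the positive half-line, extended by \<open>0\<close>, are closed under
  differentiation, and all of them are differentiable at \<open>0\<close> because the exponential beats every
  polynomial. So each of them is smooth.
\<close>

definition flat_exp :: "real poly \<Rightarrow> real \<Rightarrow> real" where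
  "flat_exp p x = (if x > 0 then poly p (inverse x) * exp (- inverse x) else 0)"

lemma poly_div_exp_tendsto_0: "((\<lambda>y. poly p y / exp y) \<longlongrightarrow> 0) at_top" for p :: "real poly"
proof (induction p)
  case (pCons a p)
  have "((\<lambda>y::real. a / exp y) \<longlongrightarrow> 0) at_top"
    using tendsto_mult_right_zero[OF tendsto_power_div_exp_0[of 0], of a] by simp
  moreover have "((\<lambda>y. y * poly p y / exp y) \<longlongrightarrow> 0) at_top"
  proof -
    have *: "y * poly p y = (\<Sum>i\<le>degree p. coeff p i * y ^ Suc i)" for y
      by (simp add: poly_altdef sum_distrib_left mult_ac)
    have "((\<lambda>y. \<Sum>i\<le>degree p. coeff p i * (y ^ Suc i / exp y)) \<longlongrightarrow> (\<Sum>i\<le>degree p. coeff p i * 0)) at_top"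
      by (intro tendsto_sum tendsto_mult tendsto_const tendsto_power_div_exp_0)
    then show ?thesis by (simp add: * sum_divide_distrib)
  qed
  ultimately show ?case using tendsto_add[of "\<lambda>y. a / exp y" 0] by (fastforce simp: add_divide_distrib)
qed simp

lemma flat_exp_DERIV:
  "(flat_exp p has_real_derivative flat_exp ([:0, 0, 1:] * (p - pderiv p)) x) (at x)"
proof -
  consider "x > 0" | "x < 0" | "x = 0" by linarith
  then show ?thesis
  proof cases
    case 1
    have "((\<lambda>x. poly p (inverse x) * exp (- inverse x)) has_real_derivative
        flat_exp ([:0, 0, 1:] * (p - pderiv p)) x) (at x)"
      using 1
      by (auto intro!: derivative_eq_intros DERIV_chain2[OF poly_DERIV] simp: flat_exp_def)
         (simp add: field_simps power2_eq_square)
    moreover have "\<forall>\<^sub>F y in nhds x. flat_exp p y = poly p (inverse y) * exp (- inverse y)"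
    proof -
      have "\<forall>\<^sub>F y in nhds x. y \<in> {0<..}" using 1 by (intro eventually_nhds_in_open) auto
      then show ?thesis by eventually_elim (auto simp: flat_exp_def)
    qed
    ultimately show ?thesis by (subst DERIV_cong_ev[OF refl _ refl])
  next
    case 2
    have "\<forall>\<^sub>F y in nhds x. flat_exp p y = 0"
    proof -
      have "\<forall>\<^sub>F y in nhds x. y \<in> {..<0}" using 2 by (intro eventually_nhds_in_open) auto
      then show ?thesis by eventually_elim (auto simp: flat_exp_def)
    qed
    then show ?thesis using 2 by (subst DERIV_cong_ev[OF refl _ refl]) (auto simp: flat_exp_def)
  next
    case 3
    have "((\<lambda>h. flat_exp p h / h) \<longlongrightarrow> 0) (at 0)"
    proof (rule filterlim_split_at)
      have "\<forall>\<^sub>F h::real in at_left 0. flat_exp p h / h = 0"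
        by (auto simp: eventually_at_filter flat_exp_def)
      then show "((\<lambda>h. flat_exp p h / h) \<longlongrightarrow> 0) (at_left 0)" by (rule tendsto_eventually)
      have "((\<lambda>h::real. poly (pCons 0 p) (inverse h) / exp (inverse h)) \<longlongrightarrow> 0) (at_right 0)"
        by (rule filterlim_compose[OF poly_div_exp_tendsto_0 filterlim_inverse_at_top_right])
      moreover have "\<forall>\<^sub>F h::real in at_right 0. poly (pCons 0 p) (inverse h) / exp (inverse h) = flat_exp p h / h"
        by (auto simp: eventually_at_filter flat_exp_def exp_minus field_simps)
      ultimately show "((\<lambda>h. flat_exp p h / h) \<longlongrightarrow> 0) (at_right 0)"
        by (rule Lim_transform_eventually)
    qed
    then show ?thesis using 3 by (simp add: DERIV_def flat_exp_def)
  qed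
qed

lemma smooth_flat_exp: "smooth (flat_exp p)"
proof -
  have "differentiable_upto n (flat_exp p)" for n
  proof (induction n arbitrary: p)
    case 0
    show ?case using flat_exp_DERIV by (auto simp: differentiable_upto_0 real_differentiable_def)
  next
    case (Suc n)
    have "deriv (flat_exp p) = flat_exp ([:0, 0, 1:] * (p - pderiv p))"
      by (intro ext DERIV_imp_deriv flat_exp_DERIV)
    then show ?case
      using flat_exp_DERIV Suc by (auto simp: differentiable_upto_Suc real_differentiable_def)
  qed
  then show ?thesis by (simp add: smooth_iff_upto)
qed

text \<open>
  The product of the flat functions of \<open>1 + x\<close> and \<open>1 - x\<close> is even and lives on \<open>[-1, 1]\<close>.
\<close>

lemma ex_mollifier:
  "\<exists>\<rho>. test_function \<rho> \<and> (\<forall>x. 0 \<le> \<rho> x) \<and> (\<forall>x. \<rho> (- x) = \<rho> x) \<and> (LINT x|lborel. \<rho> x) = 1"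
proof -
  define b where "b x = flat_exp 1 (1 + x) * flat_exp 1 (1 - x)" for x
  have b_pos: "b x > 0" if "\<bar>x\<bar> < 1" for x
    using that by (auto simp: b_def flat_exp_def intro!: mult_pos_pos)
  have b_nonneg: "b x \<ge> 0" for x by (auto simp: b_def flat_exp_def)
  have "smooth b" unfolding b_def
    using smooth_mult[OF smooth_affine[OF smooth_flat_exp, of 1 1 1] smooth_affine[OF smooth_flat_exp, of 1 1 "-1"]]
    by simp
  moreover have "\<forall>x. \<bar>x\<bar> > 1 \<longrightarrow> b x = 0" by (auto simp: b_def flat_exp_def)
  ultimately have b: "test_function b" unfolding test_function_iff by blast
  have even: "b (- x) = b x" for x by (simp add: b_def)
  have "(LINT x|lborel. b x) \<noteq> 0"
  proof
    assume "(LINT x|lborel. b x) = 0"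
    then have "AE x in lborel. b x = 0"
      using integral_nonneg_eq_0_iff_AE[OF test_function_integrable[OF b]] b_nonneg by auto
    then have "AE x in lborel. x \<notin> {-1<..<1::real}"
    proof eventually_elim
      case (elim x) then show ?case using b_pos[of x] by (auto simp: abs_less_iff)
    qed
    moreover have "(AE x in lborel. x \<notin> {-1<..<1::real}) \<longleftrightarrow> emeasure lborel {-1<..<1::real} = 0"
      by (rule AE_iff_measurable) auto
    ultimately have "emeasure lborel {-1<..<1::real} = 0" by blast
    moreover have "emeasure lborel {-1<..<1::real} = ennreal 2"
      by (subst emeasure_lborel_Ioo) auto
    ultimately have "ennreal 2 = 0" by metis
    then show False by simp
  qed
  moreover have "(LINT x|lborel. b x) \<ge> 0" by (intro integral_nonneg_AE) (use b_nonneg in auto)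
  ultimately have I: "(LINT x|lborel. b x) > 0" by simp
  let ?c = "inverse (LINT x|lborel. b x)"
  show ?thesis
    using I b_nonneg even test_function_cmult[OF b, of ?c]
    by (intro exI[of _ "\<lambda>x. ?c * b x"]) auto
qed

definition mollifier :: "real \<Rightarrow> real" where
  "mollifier = (SOME \<rho>. test_function \<rho> \<and> (\<forall>x. 0 \<le> \<rho> x) \<and> (\<forall>x. \<rho> (- x) = \<rho> x) \<and> (LINT x|lborel. \<rho> x) = 1)"

lemma mollifier:
  "test_function mollifier" "0 \<le> mollifier x" "mollifier (- x) = mollifier x"
  "(LINT x|lborel. mollifier x) = 1"
  using someI_ex[OF ex_mollifier] by (auto simp: mollifier_def)

text \<open>The scale is \<open>1 / Suc n\<close>, so that it is meaningful for every \<open>n\<close>.\<close>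

definition mollifier_seq :: "nat \<Rightarrow> real \<Rightarrow> real" where
  "mollifier_seq n x = real (Suc n) * mollifier (real (Suc n) * x)"

lemma mollifier_seq_even: "mollifier_seq n (- x) = mollifier_seq n x"
  using mollifier(3) by (simp add: mollifier_seq_def)

lemma mollifier_seq_nonneg: "0 \<le> mollifier_seq n x"
  using mollifier(2) by (simp add: mollifier_seq_def)

lemma integral_scale: "(LINT x|lborel. real (Suc n) * f (real (Suc n) * x)) = (LINT x|lborel. f x :: real)"
  using lborel_integral_real_affine[of "real (Suc n)" f 0] by simp

lemma mollifier_seq_integral: "(LINT x|lborel. mollifier_seq n x) = 1"
  unfolding mollifier_seq_def by (subst integral_scale) (rule mollifier(4))

lemma test_function_mollifier_seq: "test_function (mollifier_seq n)"
proof -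
  obtain R where R: "\<forall>x. \<bar>x\<bar> > R \<longrightarrow> mollifier x = 0"
    using mollifier(1) by (auto simp: test_function_iff)
  have "mollifier (real (Suc n) * x) = 0" if "\<bar>x\<bar> > \<bar>R\<bar>" for x
  proof -
    have "1 * \<bar>x\<bar> \<le> real (Suc n) * \<bar>x\<bar>" by (rule mult_right_mono) auto
    then show ?thesis using that R by (simp add: abs_mult)
  qed
  moreover have "smooth (\<lambda>x. mollifier (real (Suc n) * x))"
    using smooth_affine[OF test_function_smooth[OF mollifier(1)], of 0 "real (Suc n)"] by simp
  ultimately have "test_function (\<lambda>x. mollifier (real (Suc n) * x))"
    unfolding test_function_iff by blast
  then show ?thesis unfolding mollifier_seq_def by (rule test_function_cmult)
qed

definition mollifier_moment :: real where
  "mollifier_moment = (LINT x|lborel. \<bar>x * deriv mollifier x\<bar>)"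

text \<open>This moment is invariant under scaling, which is what makes the commutator estimate uniform.\<close>

lemma mollifier_seq_moment:
  "(LINT x|lborel. \<bar>x * deriv (mollifier_seq n) x\<bar>) = mollifier_moment"
proof -
  have s: "smooth mollifier" by (rule test_function_smooth[OF mollifier(1)])
  have "deriv (mollifier_seq n) = (\<lambda>x. real (Suc n) * (real (Suc n) * deriv mollifier (real (Suc n) * x)))"
    using funpow_deriv_cmult[OF smooth_affine[OF s, of 0 "real (Suc n)"], of 1 "real (Suc n)"]
      smooth_funpow_deriv_affine[OF s, of 1 0 "real (Suc n)"]
    by (simp add: mollifier_seq_def[abs_def])
  then have "(LINT x|lborel. \<bar>x * deriv (mollifier_seq n) x\<bar>)
      = (LINT x|lborel. real (Suc n) * \<bar>(real (Suc n) * x) * deriv mollifier (real (Suc n) * x)\<bar>)"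
    by (simp add: abs_mult mult_ac)
  also have "\<dots> = mollifier_moment"
    using integral_scale[of n "\<lambda>x. \<bar>x * deriv mollifier x\<bar>"] by (simp add: mollifier_moment_def)
  finally show ?thesis .
qed


section \<open>Convolution with a test function\<close>

definition conv :: "(real \<Rightarrow> real) \<Rightarrow> (real \<Rightarrow> real) \<Rightarrow> real \<Rightarrow> real" where
  "conv \<psi> f x = (LINT y|lborel. \<psi> (x - y) * f y)"

lemma integral_reflect_shift: "(LINT y|lborel. h (x - y)) = (LINT z|lborel. h z :: real)" for x :: real
  using lborel_integral_real_affine[of "-1" h x] by simp

lemma integrable_reflect_shift_iff:
  "integrable lborel (\<lambda>y. h (x - y)) \<longleftrightarrow> integrable lborel (h :: real \<Rightarrow> real)" for x :: real
  using lborel_integrable_real_affine_iff[of "-1" h x] by simp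

lemma conv_eq: "conv \<psi> f x = (LINT z|lborel. \<psi> z * f (x - z))"
  unfolding conv_def using integral_reflect_shift[of "\<lambda>y. \<psi> y * f (x - y)" x] by simp

lemma L2_norm_reflect_shift: "L2_norm (\<lambda>y. f (x - y)) = L2_norm f"
  unfolding L2_norm_def using integral_reflect_shift[of "\<lambda>z. (f z)\<^sup>2" x] by simp

lemma L2_reflect_shift:
  assumes "f \<in> L2" shows "(\<lambda>y. f (x - y)) \<in> L2"
proof (rule L2I)
  note [measurable] = L2_measurable[OF assms]
  show "(\<lambda>y. f (x - y)) \<in> borel_measurable borel" by measurable
  show "integrable lborel (\<lambda>y. (f (x - y))\<^sup>2)"
    using L2_integrable_square[OF assms] integrable_reflect_shift_iff[of "\<lambda>z. (f z)\<^sup>2" x] by simp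
qed

lemma conv_integrable:
  "test_function \<psi> \<Longrightarrow> f \<in> L2 \<Longrightarrow> integrable lborel (\<lambda>y. \<psi> (x - y) * f y)"
  by (rule integrable_L2_mult[OF test_function_L2[OF test_function_reflect_shift]])

lemma conv_diff:
  assumes "test_function \<psi>" "f \<in> L2" "g \<in> L2"
  shows "conv \<psi> (\<lambda>x. f x - g x) x = conv \<psi> f x - conv \<psi> g x"
  unfolding conv_def using conv_integrable[OF assms(1)] assms(2,3) by (simp add: right_diff_distrib)

lemma conv_cmult_kernel: "conv (\<lambda>x. c * \<psi> x) f x = c * conv \<psi> f x"
  unfolding conv_def by (simp add: mult.assoc)

lemma conv_abs_le:
  assumes "test_function \<psi>" "f \<in> L2"
  shows "\<bar>conv \<psi> f x\<bar> \<le> L2_norm \<psi> * L2_norm f"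
  using L2_Cauchy_Schwarz[OF test_function_L2[OF test_function_reflect_shift[OF assms(1)]] assms(2), of x]
  by (simp add: conv_def L2_inner_def L2_norm_reflect_shift)

lemma smooth_taylor:
  fixes x h :: real
  assumes "smooth \<psi>" "\<And>x. \<bar>(deriv ^^ 2) \<psi> x\<bar> \<le> B"
  shows "\<bar>\<psi> (x + h) - \<psi> x - h * deriv \<psi> x\<bar> \<le> B * h\<^sup>2"
proof -
  have d1: "(\<psi> has_real_derivative deriv \<psi> y) (at y)" for y
    using smooth_DERIV[OF assms(1), of 0] by simp
  have d2: "(deriv \<psi> has_real_derivative (deriv ^^ 2) \<psi> y) (at y)" for y
    using smooth_DERIV[OF assms(1), of 1] by (simp add: numeral_2_eq_2)
  have B: "0 \<le> B" using assms(2)[of 0] by linarith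
  have lip: "\<bar>deriv \<psi> y - deriv \<psi> x\<bar> \<le> B * \<bar>y - x\<bar>" for y
    using field_differentiable_bound[of UNIV "deriv \<psi>" "(deriv ^^ 2) \<psi>" B y x] d2 assms(2) by auto
  have "norm ((\<psi> (x + h) - (x + h) * deriv \<psi> x) - (\<psi> x - x * deriv \<psi> x)) \<le> (B * \<bar>h\<bar>) * norm ((x + h) - x)"
  proof (rule field_differentiable_bound[where S="cball x \<bar>h\<bar>" and f="\<lambda>y. \<psi> y - y * deriv \<psi> x"])
    show "((\<lambda>y. \<psi> y - y * deriv \<psi> x) has_field_derivative deriv \<psi> y - deriv \<psi> x) (at y within cball x \<bar>h\<bar>)" for y
      by (auto intro!: derivative_eq_intros has_field_derivative_at_within[OF d1])
    show "norm (deriv \<psi> y - deriv \<psi> x) \<le> B * \<bar>h\<bar>" if "y \<in> cball x \<bar>h\<bar>" for y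
      using lip[of y] mult_left_mono[OF _ B, of "\<bar>y - x\<bar>" "\<bar>h\<bar>"] that
      by (auto simp: dist_real_def abs_minus_commute)
  qed (auto simp: dist_real_def)
  then show ?thesis by (simp add: algebra_simps power2_eq_square abs_mult_self_eq)
qed

lemma L2_integrable_on_interval:
  assumes "f \<in> L2" shows "integrable lborel (\<lambda>y. indicator {-R..R} (x - y) * f y)"
  by (intro integrable_L2_mult L2_reflect_shift indicator_in_L2 assms)
     (auto simp: emeasure_lborel_Icc_eq)

text \<open>
  The Taylor remainder of \<open>\<psi>\<close> is \<open>O(h\<^sup>2)\<close> and, for \<open>\<bar>h\<bar> \<le> 1\<close>, supported in a fixed interval, on which
  a square-integrable function is integrable.
\<close>

lemma conv_DERIV:
  assumes \<psi>: "test_function \<psi>" and f: "f \<in> L2"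
  shows "(conv \<psi> f has_real_derivative conv (deriv \<psi>) f x) (at x)"
proof -
  have \<psi>1: "test_function (deriv \<psi>)" and \<psi>2: "test_function ((deriv ^^ 2) \<psi>)"
    using test_function_deriv[OF \<psi>, of 1] test_function_deriv[OF \<psi>, of 2] by auto
  obtain B where B: "0 \<le> B" "\<And>x. \<bar>(deriv ^^ 2) \<psi> x\<bar> \<le> B"
    using test_function_bounded[OF \<psi>2] by metis
  obtain R where R: "0 < R" "\<And>x. \<bar>x\<bar> > R \<Longrightarrow> \<psi> x = 0"
    using test_function_bounded[OF \<psi>] by metis
  have R': "deriv \<psi> x = 0" if "\<bar>x\<bar> > R" for x
    using funpow_deriv_vanishes[of R \<psi> 1] R(2) that by auto
  let ?i = "\<lambda>y. indicator {-(R+1)..R+1} (x - y) :: real"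
  define M where "M = (LINT y|lborel. \<bar>?i y * f y\<bar>)"
  have bound: "\<bar>conv \<psi> f (x + h) - conv \<psi> f x - h * conv (deriv \<psi>) f x\<bar> \<le> B * h\<^sup>2 * M" if "\<bar>h\<bar> \<le> 1" for h
  proof -
    have pt: "\<bar>\<psi> (z + h) - \<psi> z - h * deriv \<psi> z\<bar> \<le> B * h\<^sup>2 * indicator {-(R+1)..R+1} z" for z
    proof (cases "z \<in> {-(R+1)..R+1}")
      case True
      then show ?thesis using smooth_taylor[OF test_function_smooth[OF \<psi>] B(2)] by simp
    next
      case False
      then have "\<bar>z\<bar> > R + 1" by (auto simp: abs_if)
      then have "\<psi> (z + h) = 0" "\<psi> z = 0" "deriv \<psi> z = 0"
        using that by (auto intro!: R(2) R')
      then show ?thesis using False by simp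
    qed
    have "conv \<psi> f (x + h) - conv \<psi> f x - h * conv (deriv \<psi>) f x
        = (LINT y|lborel. (\<psi> (x + h - y) * f y - \<psi> (x - y) * f y) - h * (deriv \<psi> (x - y) * f y))"
      unfolding conv_def
      using conv_integrable[OF \<psi> f] conv_integrable[OF \<psi>1 f] by simp
    also have "\<dots> = (LINT y|lborel. (\<psi> ((x - y) + h) - \<psi> (x - y) - h * deriv \<psi> (x - y)) * f y)"
      by (rule Bochner_Integration.integral_cong) (auto simp: algebra_simps)
    finally have eq: "conv \<psi> f (x + h) - conv \<psi> f x - h * conv (deriv \<psi>) f x
        = (LINT y|lborel. (\<psi> ((x - y) + h) - \<psi> (x - y) - h * deriv \<psi> (x - y)) * f y)" .
    have "norm (LINT y|lborel. (\<psi> ((x - y) + h) - \<psi> (x - y) - h * deriv \<psi> (x - y)) * f y)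
        \<le> (LINT y|lborel. B * h\<^sup>2 * \<bar>?i y * f y\<bar>)"
    proof (rule Bochner_Integration.integral_norm_bound_integral)
      have "integrable lborel (\<lambda>y. (\<psi> (x + h - y) * f y - \<psi> (x - y) * f y) - h * (deriv \<psi> (x - y) * f y))"
        using conv_integrable[OF \<psi> f] conv_integrable[OF \<psi>1 f] by simp
      then show "integrable lborel (\<lambda>y. (\<psi> ((x - y) + h) - \<psi> (x - y) - h * deriv \<psi> (x - y)) * f y)"
        by (simp add: algebra_simps)
      show "integrable lborel (\<lambda>y. B * h\<^sup>2 * \<bar>?i y * f y\<bar>)"
        by (intro integrable_mult_right integrable_abs L2_integrable_on_interval f)
      show "norm ((\<psi> ((x - y) + h) - \<psi> (x - y) - h * deriv \<psi> (x - y)) * f y) \<le> B * h\<^sup>2 * \<bar>?i y * f y\<bar>" for y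
        using mult_right_mono[OF pt[of "x - y"], of "\<bar>f y\<bar>"] by (simp add: abs_mult)
    qed
    then show ?thesis by (simp add: eq M_def)
  qed
  have "((\<lambda>h. (conv \<psi> f (x + h) - conv \<psi> f x) / h - conv (deriv \<psi>) f x) \<longlongrightarrow> 0) (at 0)"
  proof (rule Lim_null_comparison)
    have "\<forall>\<^sub>F h::real in at 0. \<bar>h\<bar> \<le> 1 \<and> h \<noteq> 0"
      by (auto simp: eventually_at dist_real_def intro!: exI[of _ 1])
    then show "\<forall>\<^sub>F h in at 0. norm ((conv \<psi> f (x + h) - conv \<psi> f x) / h - conv (deriv \<psi>) f x) \<le> B * \<bar>h\<bar> * M"
    proof eventually_elim
      case (elim h)
      have eq: "(conv \<psi> f (x + h) - conv \<psi> f x) / h - conv (deriv \<psi>) f x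
          = (conv \<psi> f (x + h) - conv \<psi> f x - h * conv (deriv \<psi>) f x) / h"
        using elim by (simp add: field_simps)
      have "norm ((conv \<psi> f (x + h) - conv \<psi> f x) / h - conv (deriv \<psi>) f x) \<le> B * h\<^sup>2 * M / \<bar>h\<bar>"
        using bound[of h] elim by (simp add: eq divide_right_mono)
      also have "\<dots> = B * \<bar>h\<bar> * M"
        using elim by (simp add: field_simps power2_eq_square abs_mult_self_eq)
      finally show ?case .
    qed
    have "((\<lambda>h. B * \<bar>h\<bar> * M) \<longlongrightarrow> B * \<bar>0\<bar> * M) (at (0::real))" by (intro tendsto_intros)
    then show "((\<lambda>h. B * \<bar>h\<bar> * M) \<longlongrightarrow> 0) (at (0::real))" by simp
  qed
  then show ?thesis unfolding DERIV_def by (rule LIM_zero_cancel)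
qed

lemma conv_funpow_deriv:
  assumes "test_function \<psi>" "f \<in> L2"
  shows "(deriv ^^ n) (conv \<psi> f) = conv ((deriv ^^ n) \<psi>) f"
proof (induction n)
  case (Suc n)
  have "deriv (conv ((deriv ^^ n) \<psi>) f) = conv (deriv ((deriv ^^ n) \<psi>)) f"
    by (intro ext DERIV_imp_deriv conv_DERIV test_function_deriv assms)
  then show ?case using Suc by simp
qed simp

lemma conv_smooth:
  assumes "test_function \<psi>" "f \<in> L2" shows "smooth (conv \<psi> f)"
  unfolding smooth_def conv_funpow_deriv[OF assms]
  using conv_DERIV[OF test_function_deriv[OF assms(1)] assms(2)] real_differentiable_def by blast

lemma conv_measurable:
  assumes "test_function \<psi>" "f \<in> L2" shows "conv \<psi> f \<in> borel_measurable borel"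
  using smooth_continuous[OF conv_smooth[OF assms], of UNIV 0]
  by (simp add: borel_measurable_continuous_onI)

lemma conv_compact_support_test_function:
  assumes \<psi>: "test_function \<psi>" and f: "f \<in> L2" and n: "\<And>x. \<bar>x\<bar> > r \<Longrightarrow> f x = 0"
  shows "test_function (conv \<psi> f)"
proof -
  obtain R where R: "0 < R" "\<And>x. \<bar>x\<bar> > R \<Longrightarrow> \<psi> x = 0"
    using test_function_bounded[OF \<psi>] by metis
  have "conv \<psi> f x = 0" if "\<bar>x\<bar> > R + r" for x
  proof -
    have "\<psi> (x - y) * f y = 0" for y
    proof (cases "\<bar>y\<bar> > r")
      case False
      then have "\<bar>x - y\<bar> > R" using that by linarith
      then show ?thesis using R by simp
    qed (simp add: n)
    then have "(\<lambda>y. \<psi> (x - y) * f y) = (\<lambda>y. 0)" by (rule ext)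
    then show ?thesis by (simp add: conv_def)
  qed
  then show ?thesis unfolding test_function_iff using conv_smooth[OF \<psi> f] by blast
qed

lemma measurable_correlation [measurable]:
  fixes f g :: "real \<Rightarrow> real"
  assumes [measurable]: "f \<in> borel_measurable borel" "g \<in> borel_measurable borel"
  shows "(\<lambda>z. LINT x|lborel. f x * g (x - z)) \<in> borel_measurable borel"
  by measurable

lemma correlation_abs_le:
  assumes "f \<in> L2" "g \<in> L2"
  shows "(LINT x|lborel. \<bar>f x * g (x - z)\<bar>) \<le> L2_norm f * L2_norm g"
  using L2_abs_mult_le[OF assms(1) L2_shift[OF assms(2), of "-z"]] L2_norm_shift[of g "-z"] by simp

lemma correlation_integrable:
  assumes "f \<in> L2" "g \<in> L2" shows "integrable lborel (\<lambda>x. f x * g (x - z))"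
  using integrable_L2_mult[OF assms(1) L2_shift[OF assms(2), of "-z"]] by simp

lemma kernel_integrable:
  assumes K: "integrable lborel K" and f: "f \<in> L2" and g: "g \<in> L2"
  shows "integrable (lborel \<Otimes>\<^sub>M lborel) (\<lambda>(z, x). K z * (f x * g (x - z)))"
proof (rule lborel_pair.Fubini_integrable)
  note [measurable] = L2_measurable[OF f] L2_measurable[OF g] borel_measurable_integrable[OF K]
  show "(\<lambda>(z, x). K z * (f x * g (x - z))) \<in> borel_measurable (lborel \<Otimes>\<^sub>M lborel)" by measurable
  have "integrable lborel (\<lambda>z. K z * (LINT x|lborel. \<bar>f x * g (x - z)\<bar>))"
  proof (rule Bochner_Integration.integrable_bound)
    show "integrable lborel (\<lambda>z. K z * (L2_norm f * L2_norm g))" using K by simp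
    show "AE z in lborel. norm (K z * (LINT x|lborel. \<bar>f x * g (x - z)\<bar>)) \<le> norm (K z * (L2_norm f * L2_norm g))"
      using correlation_abs_le[OF f g] by (auto simp: abs_mult intro!: mult_left_mono)
  qed measurable
  then have "integrable lborel (\<lambda>z. \<bar>K z * (LINT x|lborel. \<bar>f x * g (x - z)\<bar>)\<bar>)" by (rule integrable_abs)
  then show "integrable lborel (\<lambda>z. LINT x|lborel. norm (case (z, x) of (z, x) \<Rightarrow> K z * (f x * g (x - z))))"
    by (simp add: abs_mult)
  show "AE z in lborel. integrable lborel (\<lambda>x. case (z, x) of (z, x) \<Rightarrow> K z * (f x * g (x - z)))"
    using correlation_integrable[OF f g] by simp
qed

lemma kernel_integral_abs_le:
  assumes K: "integrable lborel K" and f: "f \<in> L2" and g: "g \<in> L2"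
  shows "(LINT z|lborel. LINT x|lborel. \<bar>K z * (f x * g (x - z))\<bar>)
    \<le> L1_norm K * (L2_norm f * L2_norm g)"
proof -
  have "(LINT z|lborel. LINT x|lborel. \<bar>K z * (f x * g (x - z))\<bar>)
      \<le> (LINT z|lborel. \<bar>K z\<bar> * (L2_norm f * L2_norm g))"
  proof (rule integral_mono)
    show "integrable lborel (\<lambda>z. LINT x|lborel. \<bar>K z * (f x * g (x - z))\<bar>)"
      using lborel_pair.integrable_fst'[OF integrable_abs[OF kernel_integrable[OF K f g]]]
      by (simp add: case_prod_unfold)
    show "integrable lborel (\<lambda>z. \<bar>K z\<bar> * (L2_norm f * L2_norm g))" using K by simp
    show "(LINT x|lborel. \<bar>K z * (f x * g (x - z))\<bar>) \<le> \<bar>K z\<bar> * (L2_norm f * L2_norm g)" for z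
      using mult_left_mono[OF correlation_abs_le[OF f g, of z], of "\<bar>K z\<bar>"] by (simp add: abs_mult)
  qed
  then show ?thesis by simp
qed

text \<open>
  In the coordinates \<open>(z, x)\<close>, with \<open>z\<close> the argument of the kernel, a bilinear form given by a kernel
  is an average of the correlations of \<open>f\<close> with the translates of \<open>g\<close>. Young's inequality, the
  adjoint and the convergence of mollifiers all follow from this form.
\<close>

lemma L2_inner_conv:
  assumes \<psi>: "test_function \<psi>" and f: "f \<in> L2" and g: "g \<in> L2"
  shows "L2_inner f (conv \<psi> g) = (LINT z|lborel. \<psi> z * (LINT x|lborel. f x * g (x - z)))"
proof -
  have "L2_inner f (conv \<psi> g) = (LINT x|lborel. LINT z|lborel. \<psi> z * (f x * g (x - z)))"
    by (simp add: L2_inner_def conv_eq mult.left_commute flip: integral_mult_right_zero)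
  also have "\<dots> = (LINT z|lborel. LINT x|lborel. \<psi> z * (f x * g (x - z)))"
    by (rule lborel_pair.Fubini_integral[OF kernel_integrable[OF test_function_integrable[OF \<psi>] f g]])
  finally show ?thesis by simp
qed

text \<open>
  Cauchy-Schwarz with \<open>\<bar>\<psi>\<bar>\<close> split into two square roots bounds the square of the convolution by the
  convolution of \<open>\<bar>\<psi>\<bar>\<close> with \<open>g\<^sup>2\<close>, which is integrable by Tonelli.
\<close>

lemma conv_L2:
  assumes \<psi>: "test_function \<psi>" and g: "g \<in> L2"
  shows "conv \<psi> g \<in> L2"
proof (rule L2I[OF conv_measurable[OF assms]])
  note [measurable] = L2_measurable[OF g] test_function_measurable[OF \<psi>]
  obtain B where B: "\<And>x. \<bar>\<psi> x\<bar> \<le> B" using test_function_bounded[OF \<psi>] by metis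
  have i\<psi>: "integrable lborel (\<lambda>z. \<bar>\<psi> z\<bar>)" using test_function_integrable[OF \<psi>] by (rule integrable_abs)
  have sq: "(\<lambda>z. sqrt \<bar>\<psi> z\<bar>) \<in> L2" using i\<psi> by (intro L2I) auto
  have sq_norm: "(L2_norm (\<lambda>z. sqrt \<bar>\<psi> z\<bar>))\<^sup>2 = L1_norm \<psi>" by (simp add: L2_norm_square)
  have sqg: "(\<lambda>z. sqrt \<bar>\<psi> z\<bar> * g (x - z)) \<in> L2" for x
    by (rule L2_bound[where g="\<lambda>z. g (x - z)" and C="sqrt B", OF L2_reflect_shift[OF g]])
       (use B in \<open>auto simp: abs_mult intro!: mult_right_mono\<close>)
  have sqg_norm: "(L2_norm (\<lambda>z. sqrt \<bar>\<psi> z\<bar> * g (x - z)))\<^sup>2 = (LINT z|lborel. \<bar>\<psi> z\<bar> * (g (x - z))\<^sup>2)" for x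
    by (simp add: L2_norm_square power_mult_distrib)
  have le: "(conv \<psi> g x)\<^sup>2 \<le> L1_norm \<psi> * (LINT z|lborel. \<bar>\<psi> z\<bar> * (g (x - z))\<^sup>2)" for x
  proof -
    have "\<bar>conv \<psi> g x\<bar> \<le> (LINT z|lborel. \<bar>\<psi> z * g (x - z)\<bar>)"
      unfolding conv_eq by (rule integral_abs_bound)
    also have "\<dots> = (LINT z|lborel. \<bar>sqrt \<bar>\<psi> z\<bar> * (sqrt \<bar>\<psi> z\<bar> * g (x - z))\<bar>)"
      by (simp add: abs_mult flip: mult.assoc)
    also have "\<dots> \<le> L2_norm (\<lambda>z. sqrt \<bar>\<psi> z\<bar>) * L2_norm (\<lambda>z. sqrt \<bar>\<psi> z\<bar> * g (x - z))"
      by (rule L2_abs_mult_le[OF sq sqg])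
    finally have "\<bar>conv \<psi> g x\<bar>\<^sup>2 \<le> (L2_norm (\<lambda>z. sqrt \<bar>\<psi> z\<bar>) * L2_norm (\<lambda>z. sqrt \<bar>\<psi> z\<bar> * g (x - z)))\<^sup>2"
      by (rule power_mono) simp
    then show ?thesis unfolding power_mult_distrib sq_norm sqg_norm by simp
  qed
  have "integrable (lborel \<Otimes>\<^sub>M lborel) (\<lambda>(z, x). \<bar>\<psi> z\<bar> * (g (x - z))\<^sup>2)"
  proof (rule lborel_pair.Fubini_integrable)
    have sh: "(LINT x|lborel. (g (x - z))\<^sup>2) = (LINT x|lborel. (g x)\<^sup>2)" for z
      using integral_shift[of "\<lambda>x. (g x)\<^sup>2" "-z"] by simp
    show "integrable lborel (\<lambda>z. LINT x|lborel. norm (case (z, x) of (z, x) \<Rightarrow> \<bar>\<psi> z\<bar> * (g (x - z))\<^sup>2))"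
      using i\<psi> by (simp add: abs_mult sh)
    show "AE z in lborel. integrable lborel (\<lambda>x. case (z, x) of (z, x) \<Rightarrow> \<bar>\<psi> z\<bar> * (g (x - z))\<^sup>2)"
      using integrable_shift_iff[of "\<lambda>x. (g x)\<^sup>2" "-z" for z] L2_integrable_square[OF g] by simp
  qed measurable
  then have "integrable lborel (\<lambda>x. LINT z|lborel. \<bar>\<psi> z\<bar> * (g (x - z))\<^sup>2)"
    using lborel_pair.integrable_snd[of "\<lambda>z x. \<bar>\<psi> z\<bar> * (g (x - z))\<^sup>2"] by simp
  then have "integrable lborel (\<lambda>x. L1_norm \<psi> * (LINT z|lborel. \<bar>\<psi> z\<bar> * (g (x - z))\<^sup>2))"
    by simp
  then show "integrable lborel (\<lambda>x. (conv \<psi> g x)\<^sup>2)"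
    by (rule Bochner_Integration.integrable_bound)
       (use conv_measurable[OF assms] order_trans[OF le abs_ge_self] in auto)
qed

lemma L2_inner_conv_le:
  assumes \<psi>: "test_function \<psi>" and f: "f \<in> L2" and g: "g \<in> L2"
  shows "\<bar>L2_inner f (conv \<psi> g)\<bar> \<le> L1_norm \<psi> * (L2_norm f * L2_norm g)"
proof -
  note i = test_function_integrable[OF \<psi>]
  have "\<bar>L2_inner f (conv \<psi> g)\<bar> = \<bar>LINT z|lborel. LINT x|lborel. \<psi> z * (f x * g (x - z))\<bar>"
    using L2_inner_conv[OF assms] by simp
  also have "\<dots> \<le> (LINT z|lborel. \<bar>LINT x|lborel. \<psi> z * (f x * g (x - z))\<bar>)"
    by (rule integral_abs_bound)
  also have "\<dots> \<le> (LINT z|lborel. LINT x|lborel. \<bar>\<psi> z * (f x * g (x - z))\<bar>)"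
  proof (rule integral_mono)
    show "integrable lborel (\<lambda>z. LINT x|lborel. \<bar>\<psi> z * (f x * g (x - z))\<bar>)"
      using lborel_pair.integrable_fst'[OF integrable_abs[OF kernel_integrable[OF i f g]]]
      by (simp add: case_prod_unfold)
    show "integrable lborel (\<lambda>z. \<bar>LINT x|lborel. \<psi> z * (f x * g (x - z))\<bar>)"
      using integrable_abs[OF lborel_pair.integrable_fst'[OF kernel_integrable[OF i f g]]]
      by (simp add: case_prod_unfold)
  qed (rule integral_abs_bound)
  also have "\<dots> \<le> L1_norm \<psi> * (L2_norm f * L2_norm g)"
    by (rule kernel_integral_abs_le[OF i f g])
  finally show ?thesis .
qed

text \<open>
  Young's inequality: the bilinear bound is tested with the convolution itself.
\<close>

lemma conv_L2_norm_le:
  assumes \<psi>: "test_function \<psi>" and g: "g \<in> L2"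
  shows "L2_norm (conv \<psi> g) \<le> L1_norm \<psi> * L2_norm g"
proof (cases "L2_norm (conv \<psi> g) = 0")
  case False
  then have pos: "0 < L2_norm (conv \<psi> g)" using L2_norm_nonneg[of "conv \<psi> g"] by linarith
  have "(L2_norm (conv \<psi> g))\<^sup>2 \<le> L1_norm \<psi> * (L2_norm (conv \<psi> g) * L2_norm g)"
    using L2_inner_conv_le[OF \<psi> conv_L2[OF assms] g] unfolding L2_norm_square_inner by linarith
  then have "L2_norm (conv \<psi> g) * L2_norm (conv \<psi> g)
      \<le> L2_norm (conv \<psi> g) * (L1_norm \<psi> * L2_norm g)"
    by (simp add: power2_eq_square mult_ac)
  then show ?thesis using pos by simp
qed (simp add: integral_nonneg_AE)

lemma conv_adjoint:
  assumes \<psi>: "test_function \<psi>" and f: "f \<in> L2" and g: "g \<in> L2"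
  shows "L2_inner f (conv \<psi> g) = L2_inner (conv (\<lambda>z. \<psi> (- z)) f) g"
proof -
  have r: "test_function (\<lambda>z. \<psi> (- z))" using test_function_reflect_shift[OF \<psi>, of 0] by simp
  have "(LINT x|lborel. g x * f (x + z)) = (LINT x|lborel. f x * g (x - z))" for z
    using integral_shift[of "\<lambda>x. g (x - z) * f x" z] by (simp add: mult.commute)
  then have "L2_inner g (conv (\<lambda>z. \<psi> (- z)) f) = (LINT z|lborel. \<psi> z * (LINT x|lborel. f x * g (x - z)))"
    using integral_reflect_shift[of "\<lambda>z. \<psi> (- z) * (LINT x|lborel. g x * f (x - z))" 0]
    by (simp add: L2_inner_conv[OF r g f])
  then show ?thesis by (simp add: L2_inner_conv[OF \<psi> f g] L2_inner_commute)
qed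

lemma correlation_tendsto:
  assumes f: "f \<in> L2" and g: "g \<in> L2" and Z: "Z \<longlonglongrightarrow> 0"
  shows "(\<lambda>n. LINT x|lborel. f x * g (x - Z n)) \<longlonglongrightarrow> L2_inner f g"
proof -
  have sh: "(\<lambda>x. g (x - Z n)) \<in> L2" for n using L2_shift[OF g, of "- Z n"] by simp
  have "(\<lambda>n. - Z n) \<longlonglongrightarrow> 0" using tendsto_minus[OF Z] by simp
  then have "(\<lambda>n. L2_norm (\<lambda>x. g (x + - Z n) - g x)) \<longlonglongrightarrow> 0"
    using translation_continuous_L2[OF g] unfolding translation_continuous_def by blast
  then have lim: "(\<lambda>n. L2_norm f * L2_norm (\<lambda>x. g (x - Z n) - g x)) \<longlonglongrightarrow> 0"
    using tendsto_mult_left[of _ 0 sequentially "L2_norm f"] by simp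
  have "(\<lambda>n. L2_inner f (\<lambda>x. g (x - Z n)) - L2_inner f g) \<longlonglongrightarrow> 0"
    using L2_Cauchy_Schwarz[OF f L2_diff[OF sh g]]
    by (intro Lim_null_comparison[OF always_eventually lim])
       (simp add: L2_inner_diff_right[OF sh g f])
  then have "(\<lambda>n. L2_inner f (\<lambda>x. g (x - Z n))) \<longlonglongrightarrow> L2_inner f g" by (rule LIM_zero_cancel)
  then show ?thesis by (simp add: L2_inner_def)
qed

text \<open>
  The bilinear form is the average of the correlation over a shrinking interval, and the correlation
  is continuous at \<open>0\<close>. Weak convergence suffices below, because every expression in which a mollification
  is removed contains the mollified function only once.
\<close>

lemma mollifier_tendsto:
  assumes f: "f \<in> L2" and g: "g \<in> L2"
  shows "(\<lambda>n. L2_inner f (conv (mollifier_seq n) g)) \<longlonglongrightarrow> L2_inner f g"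
proof -
  note [measurable] = L2_measurable[OF f] L2_measurable[OF g] test_function_measurable[OF mollifier(1)]
  define c where "c z = (LINT x|lborel. f x * g (x - z))" for z
  have [measurable]: "c \<in> borel_measurable borel" unfolding c_def by measurable
  have c_le: "\<bar>c z\<bar> \<le> L2_norm f * L2_norm g" for z
    unfolding c_def using integral_abs_bound correlation_abs_le[OF f g] by (rule order_trans)
  have eq: "L2_inner f (conv (mollifier_seq n) g) = (LINT w|lborel. mollifier w * c (w / real (Suc n)))" for n
  proof -
    have "L2_inner f (conv (mollifier_seq n) g) = (LINT z|lborel. mollifier_seq n z * c z)"
      by (simp add: L2_inner_conv[OF test_function_mollifier_seq f g] c_def)
    also have "\<dots> = (LINT z|lborel. real (Suc n) * (mollifier (real (Suc n) * z) * c (real (Suc n) * z / real (Suc n))))"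
      by (rule Bochner_Integration.integral_cong) (auto simp: mollifier_seq_def)
    also have "\<dots> = (LINT w|lborel. mollifier w * c (w / real (Suc n)))"
      by (rule integral_scale)
    finally show ?thesis .
  qed
  have "(\<lambda>n. LINT w|lborel. mollifier w * c (w / real (Suc n))) \<longlonglongrightarrow> (LINT w|lborel. mollifier w * L2_inner f g)"
  proof (rule integral_dominated_convergence[where w="\<lambda>w. mollifier w * (L2_norm f * L2_norm g)"])
    show "integrable lborel (\<lambda>w. mollifier w * (L2_norm f * L2_norm g))"
      using test_function_integrable[OF mollifier(1)] by simp
    show "AE w in lborel. (\<lambda>n. mollifier w * c (w / real (Suc n))) \<longlonglongrightarrow> mollifier w * L2_inner f g"
    proof (rule AE_I2)
      fix w :: real
      have "(\<lambda>n. w * inverse (real (Suc n))) \<longlonglongrightarrow> w * 0"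
        by (intro tendsto_mult_left LIMSEQ_inverse_real_of_nat)
      then have "(\<lambda>n. w / real (Suc n)) \<longlonglongrightarrow> 0" by (simp add: divide_inverse)
      then show "(\<lambda>n. mollifier w * c (w / real (Suc n))) \<longlonglongrightarrow> mollifier w * L2_inner f g"
        unfolding c_def by (intro tendsto_mult_left correlation_tendsto f g)
    qed
    show "AE w in lborel. norm (mollifier w * c (w / real (Suc n))) \<le> mollifier w * (L2_norm f * L2_norm g)" for n
      using c_le mollifier(2) by (auto simp: abs_mult intro!: mult_left_mono)
  qed measurable
  then show ?thesis by (simp add: eq mollifier(4))
qed

lemma mollifier_seq_conv_le:
  assumes "g \<in> L2" shows "L2_norm (conv (mollifier_seq n) g) \<le> L2_norm g"
  using conv_L2_norm_le[OF test_function_mollifier_seq assms, of n] mollifier_seq_nonneg mollifier_seq_integral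
  by simp


section \<open>Weak derivatives\<close>

lemma has_weak_deriv_inner:
  "has_weak_deriv j f g \<longleftrightarrow> g \<in> L2 \<and>
     (\<forall>\<phi>. test_function \<phi> \<longrightarrow> L2_inner f ((deriv ^^ j) \<phi>) = (-1) ^ j * L2_inner g \<phi>)"
  by (simp add: has_weak_deriv_def L2_inner_def)

lemma has_weak_deriv_L2: "has_weak_deriv j f g \<Longrightarrow> g \<in> L2"
  by (simp add: has_weak_deriv_def)

lemma minus_one_power_mult_self: "(-1) ^ j * ((-1) ^ j * x) = (x :: real)"
  by (simp flip: mult.assoc power_add add: mult_2[symmetric])

text \<open>
  Derivatives of the kernel can be moved to either factor of \<open>\<langle>f, \<psi> \<star> g\<rangle>\<close>. For \<open>g\<close> this is the definition of
  the weak derivative, as \<open>\<psi> (x - y)\<close> is a test function of \<open>y\<close>; for \<open>f\<close> it follows by passing to the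
  adjoint.
\<close>

lemma conv_weak_deriv:
  assumes \<psi>: "test_function \<psi>" and fg: "has_weak_deriv j f g"
  shows "conv ((deriv ^^ j) \<psi>) f = conv \<psi> g"
proof
  fix x
  have "(deriv ^^ j) (\<lambda>y. \<psi> (x - y)) = (\<lambda>y. (-1) ^ j * (deriv ^^ j) \<psi> (x - y))"
    using smooth_funpow_deriv_affine[OF test_function_smooth[OF \<psi>], of j x "-1"] by simp
  then have "L2_inner f (\<lambda>y. (-1) ^ j * (deriv ^^ j) \<psi> (x - y)) = (-1) ^ j * L2_inner g (\<lambda>y. \<psi> (x - y))"
    using fg test_function_reflect_shift[OF \<psi>, of x] unfolding has_weak_deriv_inner by metis
  then have "L2_inner f (\<lambda>y. (deriv ^^ j) \<psi> (x - y)) = L2_inner g (\<lambda>y. \<psi> (x - y))"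
    unfolding L2_inner_cmult_right by simp
  then show "conv ((deriv ^^ j) \<psi>) f x = conv \<psi> g x"
    unfolding conv_def L2_inner_def by (simp add: mult.commute)
qed

lemma L2_inner_conv_weak_deriv:
  assumes \<psi>: "test_function \<psi>" and f: "f \<in> L2" and g: "g \<in> L2" and F: "has_weak_deriv j f F"
  shows "L2_inner f (conv ((deriv ^^ j) \<psi>) g) = (-1) ^ j * L2_inner F (conv \<psi> g)"
proof -
  let ?\<psi> = "\<lambda>z. \<psi> (- z)"
  have r: "test_function ?\<psi>" using test_function_reflect_shift[OF \<psi>, of 0] by simp
  have "(deriv ^^ j) ?\<psi> = (\<lambda>x. (-1) ^ j * (deriv ^^ j) \<psi> (- x))"
    using smooth_funpow_deriv_affine[OF test_function_smooth[OF \<psi>], of j 0 "-1"] by simp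
  then have eq: "(\<lambda>z. (deriv ^^ j) \<psi> (- z)) = (\<lambda>z. (-1) ^ j * (deriv ^^ j) ?\<psi> z)"
    by (simp add: minus_one_power_mult_self)
  have "L2_inner f (conv ((deriv ^^ j) \<psi>) g) = L2_inner (conv (\<lambda>z. (deriv ^^ j) \<psi> (- z)) f) g"
    by (rule conv_adjoint[OF test_function_deriv[OF \<psi>] f g])
  also have "\<dots> = (-1) ^ j * L2_inner (conv ((deriv ^^ j) ?\<psi>) f) g"
    unfolding eq conv_cmult_kernel[abs_def] by (rule L2_inner_cmult_left)
  also have "conv ((deriv ^^ j) ?\<psi>) f = conv ?\<psi> F" by (rule conv_weak_deriv[OF r F])
  also have "L2_inner (conv ?\<psi> F) g = L2_inner F (conv \<psi> g)"
    by (rule conv_adjoint[OF \<psi> has_weak_deriv_L2[OF F] g, symmetric])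
  finally show ?thesis .
qed

text \<open>
  The mollifications of \<open>f\<close> are values of \<open>f\<close> on test functions, so they all vanish, and they converge
  to \<open>f\<close>.
\<close>

lemma AE_zero_if_orthogonal_to_test_functions:
  assumes f: "f \<in> L2" and 0: "\<And>\<phi>. test_function \<phi> \<Longrightarrow> L2_inner f \<phi> = 0"
  shows "AE x in lborel. f x = 0"
proof (rule L2_norm_eq_0_imp_AE[OF f])
  have "conv (mollifier_seq n) f x = L2_inner f (\<lambda>y. mollifier_seq n (x - y))" for n x
    by (simp add: conv_def L2_inner_def mult.commute)
  then have "conv (mollifier_seq n) f = (\<lambda>x. 0)" for n
    using 0 test_function_reflect_shift[OF test_function_mollifier_seq] by auto
  then have "(\<lambda>n. L2_inner f (\<lambda>x. 0)) \<longlonglongrightarrow> L2_inner f f" using mollifier_tendsto[OF f f] by simp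
  then have "L2_inner f f = 0" by (simp add: L2_inner_def LIMSEQ_const_iff)
  then show "L2_norm f = 0" using L2_norm_square_inner[of f] by simp
qed

lemma has_weak_deriv_unique:
  assumes g: "has_weak_deriv j f g" and h: "has_weak_deriv j f h"
  shows "AE x in lborel. g x = h x"
proof -
  note gh = has_weak_deriv_L2[OF g] has_weak_deriv_L2[OF h]
  have "AE x in lborel. g x - h x = 0"
  proof (rule AE_zero_if_orthogonal_to_test_functions[OF L2_diff[OF gh]])
    fix \<phi> assume \<phi>: "test_function \<phi>"
    have "(-1) ^ j * L2_inner g \<phi> = (-1) ^ j * L2_inner h \<phi>"
      using g h \<phi> unfolding has_weak_deriv_inner by metis
    then show "L2_inner (\<lambda>x. g x - h x) \<phi> = 0"
      by (simp add: L2_inner_diff_left[OF gh test_function_L2[OF \<phi>]])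
  qed
  then show ?thesis by simp
qed

lemma has_weak_deriv_0: "f \<in> L2 \<Longrightarrow> has_weak_deriv 0 f f"
  by (simp add: has_weak_deriv_def)

lemma has_weak_deriv_add:
  assumes "has_weak_deriv j f f'" "has_weak_deriv j g g'" "f \<in> L2" "g \<in> L2"
  shows "has_weak_deriv j (\<lambda>x. f x + g x) (\<lambda>x. f' x + g' x)"
  unfolding has_weak_deriv_inner
proof (intro conjI allI impI)
  show "(\<lambda>x. f' x + g' x) \<in> L2" using assms has_weak_deriv_L2 by blast
  fix \<phi> assume \<phi>: "test_function \<phi>"
  show "L2_inner (\<lambda>x. f x + g x) ((deriv ^^ j) \<phi>) = (-1) ^ j * L2_inner (\<lambda>x. f' x + g' x) \<phi>"
    using assms(1,2) \<phi> test_function_L2[OF \<phi>] test_function_L2[OF test_function_deriv[OF \<phi>]] assms(3,4)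
    by (simp add: has_weak_deriv_inner L2_inner_add_left distrib_left)
qed

lemma has_weak_deriv_cmult:
  assumes "has_weak_deriv j f f'"
  shows "has_weak_deriv j (\<lambda>x. c * f x) (\<lambda>x. c * f' x)"
  using assms by (auto simp: has_weak_deriv_inner L2_inner_cmult_left)

lemma has_weak_deriv_trans:
  assumes "has_weak_deriv i f g" "has_weak_deriv j g h" shows "has_weak_deriv (i + j) f h"
  using assms test_function_deriv unfolding has_weak_deriv_inner
  by (simp add: funpow_add power_add)

lemma has_weak_deriv_cancel:
  assumes fg: "has_weak_deriv i f g" and fh: "has_weak_deriv (i + j) f h"
  shows "has_weak_deriv j g h"
  unfolding has_weak_deriv_inner
proof (intro conjI allI impI)
  show "h \<in> L2" by (rule has_weak_deriv_L2[OF fh])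
  fix \<phi> assume \<phi>: "test_function \<phi>"
  have "L2_inner f ((deriv ^^ i) ((deriv ^^ j) \<phi>)) = (-1) ^ i * L2_inner g ((deriv ^^ j) \<phi>)"
    using fg test_function_deriv[OF \<phi>, of j] by (simp add: has_weak_deriv_inner)
  moreover have "L2_inner f ((deriv ^^ i) ((deriv ^^ j) \<phi>)) = (-1) ^ (i + j) * L2_inner h \<phi>"
    using fh \<phi> by (simp add: has_weak_deriv_inner funpow_add)
  ultimately have "(-1) ^ i * L2_inner g ((deriv ^^ j) \<phi>) = (-1) ^ (i + j) * L2_inner h \<phi>" by simp
  then show "L2_inner g ((deriv ^^ j) \<phi>) = (-1) ^ j * L2_inner h \<phi>"
    by (simp add: power_add)
qed

section \<open>Sobolev spaces\<close>

lemma sobolev_L2: "f \<in> sobolev n \<Longrightarrow> f \<in> L2"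
  by (simp add: sobolev_def)

lemma has_weak_deriv_weak_deriv: "has_weak_deriv j f g \<Longrightarrow> has_weak_deriv j f (weak_deriv j f)"
  unfolding weak_deriv_def by (rule someI[of "has_weak_deriv j f"])

lemma sobolev_weak_deriv: "f \<in> sobolev n \<Longrightarrow> j \<le> n \<Longrightarrow> has_weak_deriv j f (weak_deriv j f)"
  using has_weak_deriv_weak_deriv unfolding sobolev_def by blast

lemma sobolev_weak_deriv_L2: "f \<in> sobolev n \<Longrightarrow> j \<le> n \<Longrightarrow> weak_deriv j f \<in> L2"
  using sobolev_weak_deriv has_weak_deriv_L2 by blast

lemma weak_deriv_AE: "has_weak_deriv j f g \<Longrightarrow> AE x in lborel. weak_deriv j f x = g x"
  by (rule has_weak_deriv_unique[OF has_weak_deriv_weak_deriv])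

lemma L2_norm_weak_deriv: "has_weak_deriv j f g \<Longrightarrow> L2_norm (weak_deriv j f) = L2_norm g"
  by (rule L2_norm_cong_AE[OF weak_deriv_AE])
     (auto dest: has_weak_deriv_weak_deriv has_weak_deriv_L2 intro: L2_measurable)

lemma has_weak_deriv_cong_AE:
  assumes ae: "AE x in lborel. f x = g x" and f: "f \<in> L2" and g: "g \<in> L2"
  shows "has_weak_deriv j f = has_weak_deriv j g"
proof
  fix h
  have "(LINT x|lborel. f x * \<phi> x) = (LINT x|lborel. g x * \<phi> x)" if \<phi>: "\<phi> \<in> borel_measurable borel" for \<phi>
  proof (rule integral_cong_AE)
    show "AE x in lborel. f x * \<phi> x = g x * \<phi> x" using ae by eventually_elim simp
  qed (use \<phi> f g in \<open>auto dest: L2_measurable\<close>)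
  then have "(LINT x|lborel. f x * (deriv ^^ j) \<phi> x) = (LINT x|lborel. g x * (deriv ^^ j) \<phi> x)"
    if "test_function \<phi>" for \<phi>
    using test_function_measurable[OF test_function_deriv[OF that]] by blast
  then show "has_weak_deriv j f h = has_weak_deriv j g h"
    unfolding has_weak_deriv_def by simp
qed

lemma sobolev_norm_cong_AE:
  assumes "AE x in lborel. f x = g x" "f \<in> L2" "g \<in> L2"
  shows "sobolev_norm n f = sobolev_norm n g"
  unfolding sobolev_norm_def weak_deriv_def has_weak_deriv_cong_AE[OF assms] by (rule refl)

lemma sobolev_norm_nonneg [simp]: "0 \<le> sobolev_norm n f"
  by (simp add: sobolev_norm_def sum_nonneg)

lemma sobolev_norm_square: "(sobolev_norm n f)\<^sup>2 = (\<Sum>j\<le>n. (L2_norm (weak_deriv j f))\<^sup>2)"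
  by (simp add: sobolev_norm_def sum_nonneg)

lemma sobolev_norm_L2_set: "sobolev_norm n f = L2_set (\<lambda>j. L2_norm (weak_deriv j f)) {..n}"
  by (simp add: sobolev_norm_def L2_set_def)

lemma sobolev_mono: "f \<in> sobolev n \<Longrightarrow> m \<le> n \<Longrightarrow> f \<in> sobolev m"
  by (auto simp: sobolev_def)

lemma sobolev_norm_mono: "m \<le> n \<Longrightarrow> sobolev_norm m f \<le> sobolev_norm n f"
  unfolding sobolev_norm_def by (intro real_sqrt_le_mono sum_mono2) auto

lemma sobolev_0: "sobolev 0 = L2"
  using has_weak_deriv_0 by (auto simp: sobolev_def)

lemma sobolev_norm_0: "f \<in> L2 \<Longrightarrow> sobolev_norm 0 f = L2_norm f"
  using L2_norm_weak_deriv[OF has_weak_deriv_0] by (simp add: sobolev_norm_def)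

lemma L2_norm_weak_deriv_le: "j \<le> n \<Longrightarrow> L2_norm (weak_deriv j f) \<le> sobolev_norm n f"
  unfolding sobolev_norm_L2_set by (rule member_le_L2_set) auto

lemma L2_norm_le_sobolev_norm: "f \<in> L2 \<Longrightarrow> L2_norm f \<le> sobolev_norm n f"
  using sobolev_norm_mono[of 0 n f] sobolev_norm_0 by simp

lemma sobolev_has_weak_deriv:
  assumes f: "f \<in> sobolev (i + n)" and fg: "has_weak_deriv i f g"
  shows "g \<in> sobolev n" and "sobolev_norm n g \<le> sobolev_norm (i + n) f"
proof -
  have d: "has_weak_deriv j g (weak_deriv (i + j) f)" if "j \<le> n" for j
    by (rule has_weak_deriv_cancel[OF fg sobolev_weak_deriv[OF f]]) (use that in simp)
  show "g \<in> sobolev n" using d has_weak_deriv_L2[OF fg] unfolding sobolev_def by blast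
  have "(\<Sum>j\<le>n. (L2_norm (weak_deriv j g))\<^sup>2) = (\<Sum>j\<le>n. (L2_norm (weak_deriv (i + j) f))\<^sup>2)"
    by (rule sum.cong) (use L2_norm_weak_deriv[OF d] in auto)
  also have "\<dots> = (\<Sum>j\<in>(+) i ` {..n}. (L2_norm (weak_deriv j f))\<^sup>2)"
    by (simp add: sum.reindex)
  also have "\<dots> \<le> (\<Sum>j\<le>i + n. (L2_norm (weak_deriv j f))\<^sup>2)"
    by (rule sum_mono2) auto
  finally show "sobolev_norm n g \<le> sobolev_norm (i + n) f"
    unfolding sobolev_norm_def by (rule real_sqrt_le_mono)
qed

lemma sobolev_weak_deriv_sobolev:
  assumes "f \<in> sobolev m" "i + n \<le> m"
  shows "weak_deriv i f \<in> sobolev n" and "sobolev_norm n (weak_deriv i f) \<le> sobolev_norm m f"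
proof -
  have "has_weak_deriv i f (weak_deriv i f)" by (rule sobolev_weak_deriv[OF assms(1)]) (use assms(2) in simp)
  note * = sobolev_has_weak_deriv[OF sobolev_mono[OF assms] this]
  show "weak_deriv i f \<in> sobolev n" by (rule *(1))
  show "sobolev_norm n (weak_deriv i f) \<le> sobolev_norm m f"
    using *(2) sobolev_norm_mono[OF assms(2), of f] by (rule order_trans)
qed

lemma sobolev_Suc:
  assumes f: "f \<in> L2" and fg: "has_weak_deriv 1 f g" and g: "g \<in> sobolev n"
  shows "f \<in> sobolev (Suc n)" and "sobolev_norm (Suc n) f \<le> L2_norm f + sobolev_norm n g"
proof -
  have d: "has_weak_deriv (Suc j) f (weak_deriv j g)" if "j \<le> n" for j
    using has_weak_deriv_trans[OF fg sobolev_weak_deriv[OF g that]] by simp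
  have "\<exists>h. has_weak_deriv j f h" if "j \<le> Suc n" for j
    using that d[of "j - 1"] has_weak_deriv_0[OF f] by (cases j) auto
  then show "f \<in> sobolev (Suc n)" using f by (simp add: sobolev_def)
  have "(sobolev_norm (Suc n) f)\<^sup>2 = (L2_norm f)\<^sup>2 + (sobolev_norm n g)\<^sup>2"
    unfolding sobolev_norm_square sum.atMost_Suc_shift
    using L2_norm_weak_deriv[OF d] L2_norm_weak_deriv[OF has_weak_deriv_0[OF f]] by simp
  also have "\<dots> \<le> (L2_norm f + sobolev_norm n g)\<^sup>2" by (simp add: power2_sum)
  finally show "sobolev_norm (Suc n) f \<le> L2_norm f + sobolev_norm n g"
    by (rule power2_le_imp_le) simp
qed

lemma sobolev_add:
  assumes f: "f \<in> sobolev n" and g: "g \<in> sobolev n"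
  shows "(\<lambda>x. f x + g x) \<in> sobolev n"
    and "sobolev_norm n (\<lambda>x. f x + g x) \<le> sobolev_norm n f + sobolev_norm n g"
proof -
  have d: "has_weak_deriv j (\<lambda>x. f x + g x) (\<lambda>x. weak_deriv j f x + weak_deriv j g x)" if "j \<le> n" for j
    using that f g by (intro has_weak_deriv_add sobolev_weak_deriv sobolev_L2)
  show "(\<lambda>x. f x + g x) \<in> sobolev n"
    using d L2_add[OF sobolev_L2[OF f] sobolev_L2[OF g]] unfolding sobolev_def by blast
  have "sobolev_norm n (\<lambda>x. f x + g x) \<le> L2_set (\<lambda>j. L2_norm (weak_deriv j f) + L2_norm (weak_deriv j g)) {..n}"
    unfolding sobolev_norm_L2_set
  proof (rule L2_set_mono)
    fix j assume "j \<in> {..n}"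
    then show "L2_norm (weak_deriv j (\<lambda>x. f x + g x)) \<le> L2_norm (weak_deriv j f) + L2_norm (weak_deriv j g)"
      using L2_norm_weak_deriv[OF d, of j]
        L2_norm_triangle[OF sobolev_weak_deriv_L2[OF f] sobolev_weak_deriv_L2[OF g], of j j] by simp
  qed simp
  also have "\<dots> \<le> sobolev_norm n f + sobolev_norm n g"
    unfolding sobolev_norm_L2_set by (rule L2_set_triangle_ineq)
  finally show "sobolev_norm n (\<lambda>x. f x + g x) \<le> sobolev_norm n f + sobolev_norm n g" .
qed

lemma sobolev_cmult:
  assumes f: "f \<in> sobolev n"
  shows "(\<lambda>x. c * f x) \<in> sobolev n" and "sobolev_norm n (\<lambda>x. c * f x) = \<bar>c\<bar> * sobolev_norm n f"
proof -
  have d: "has_weak_deriv j (\<lambda>x. c * f x) (\<lambda>x. c * weak_deriv j f x)" if "j \<le> n" for j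
    using that f by (intro has_weak_deriv_cmult sobolev_weak_deriv)
  show "(\<lambda>x. c * f x) \<in> sobolev n"
    using d L2_cmult[OF sobolev_L2[OF f]] unfolding sobolev_def by blast
  have "sobolev_norm n (\<lambda>x. c * f x) = L2_set (\<lambda>j. \<bar>c\<bar> * L2_norm (weak_deriv j f)) {..n}"
    unfolding sobolev_norm_L2_set using L2_norm_weak_deriv[OF d]
    by (intro L2_set_cong) (auto simp: L2_norm_cmult)
  then show "sobolev_norm n (\<lambda>x. c * f x) = \<bar>c\<bar> * sobolev_norm n f"
    unfolding sobolev_norm_L2_set by (simp add: L2_set_right_distrib)
qed

lemma sobolev_diff:
  assumes f: "f \<in> sobolev n" and g: "g \<in> sobolev n"
  shows "(\<lambda>x. f x - g x) \<in> sobolev n"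
    and "sobolev_norm n (\<lambda>x. f x - g x) \<le> sobolev_norm n f + sobolev_norm n g"
  using sobolev_add[OF f sobolev_cmult(1)[OF g, of "-1"]] sobolev_cmult(2)[OF g, of "-1"] by simp_all

lemma sobolev_zero: "(\<lambda>x. 0) \<in> sobolev n" "sobolev_norm n (\<lambda>x. 0) = 0"
proof -
  have d: "has_weak_deriv j (\<lambda>x. 0) (\<lambda>x. 0)" for j by (simp add: has_weak_deriv_def)
  then show "(\<lambda>x. 0) \<in> sobolev n" by (auto simp: sobolev_def)
  show "sobolev_norm n (\<lambda>x. 0) = 0" using L2_norm_weak_deriv[OF d] by (simp add: sobolev_norm_def)
qed

lemma sobolev_sum:
  assumes "finite I" "\<And>i. i \<in> I \<Longrightarrow> f i \<in> sobolev n"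
  shows "(\<lambda>x. \<Sum>i\<in>I. f i x) \<in> sobolev n \<and>
    sobolev_norm n (\<lambda>x. \<Sum>i\<in>I. f i x) \<le> (\<Sum>i\<in>I. sobolev_norm n (f i))"
  using assms
proof (induction I)
  case empty then show ?case by (simp add: sobolev_zero)
next
  case (insert i I)
  then show ?case
    using sobolev_add[of "f i" n "\<lambda>x. \<Sum>i\<in>I. f i x"] by force
qed

subsection \<open>The Sobolev embedding\<close>

text \<open>
  The fundamental theorem is applied to \<open>f\<^sup>2\<close> on an interval from \<open>x\<close> to a point where \<open>f\<close> is small. This
  gives the embedding with constant \<open>1\<close>.
\<close>

lemma smooth_sup_le:
  assumes s: "smooth f" and f: "f \<in> L2" and f': "deriv f \<in> L2"
  shows "(f x)\<^sup>2 \<le> (L2_norm f)\<^sup>2 + (L2_norm (deriv f))\<^sup>2"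
proof (rule field_le_epsilon)
  fix e :: real assume e: "e > 0"
  \<comment> \<open>A square-integrable function is small somewhere to the right of \<open>x\<close>.\<close>
  have "\<exists>y\<ge>x. (f y)\<^sup>2 < e"
  proof (rule ccontr)
    assume "\<not> ?thesis"
    then have ge: "e \<le> (f y)\<^sup>2" if "y \<ge> x" for y using that by force
    have "integrable lborel (\<lambda>y. e * indicator {x..} y)"
      by (rule Bochner_Integration.integrable_bound[OF L2_integrable_square[OF f]])
         (use ge e in \<open>auto simp: indicator_def\<close>)
    then have "integrable lborel (indicator {x..} :: real \<Rightarrow> real)" using e by simp
    then have fin: "emeasure lborel {x..} < \<infinity>" by (simp add: integrable_indicator_iff)
    then obtain r where r: "emeasure lborel {x..} = ennreal r" "0 \<le> r"
      by (metis ennreal_cases infinity_ennreal_def less_irrefl)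
    have "emeasure lborel {x..x + (r + 1)} \<le> emeasure lborel {x..}" by (rule emeasure_mono) auto
    then have "ennreal (r + 1) \<le> ennreal r" using r by (simp add: emeasure_lborel_Icc_eq)
    then show False using r(2) by (simp add: ennreal_le_iff)
  qed
  then obtain y where y: "x \<le> y" "(f y)\<^sup>2 < e" by blast
  have d: "(f has_real_derivative deriv f z) (at z)" for z using smooth_DERIV[OF s, of 0] by simp
  have c: "continuous_on S f" "continuous_on S (deriv f)" for S
    using smooth_continuous[OF s, of S 0] smooth_continuous[OF s, of S 1] by auto
  have "(LINT z|lborel. (2 * f z * deriv f z) * indicator {x..y} z) = (f y)\<^sup>2 - (f x)\<^sup>2"
  proof (rule integral_FTC_Icc_real[OF y(1)])
    show "((\<lambda>z. (f z)\<^sup>2) has_real_derivative 2 * f z * deriv f z) (at z)" for z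
      using DERIV_power[OF d[of z], where n=2] by (simp add: mult_ac)
    show "isCont (\<lambda>z. 2 * f z * deriv f z) z" for z
      using c[of UNIV] by (auto simp: continuous_on_eq_continuous_at intro!: continuous_intros)
  qed
  then have 1: "(f x)\<^sup>2 \<le> (f y)\<^sup>2 + \<bar>LINT z|lborel. (2 * f z * deriv f z) * indicator {x..y} z\<bar>" by linarith
  have 2: "\<bar>LINT z|lborel. (2 * f z * deriv f z) * indicator {x..y} z\<bar> \<le> (LINT z|lborel. 2 * \<bar>f z * deriv f z\<bar>)"
    unfolding real_norm_def[symmetric]
  proof (rule Bochner_Integration.integral_norm_bound_integral)
    have i: "integrable lborel (\<lambda>z. 2 * (f z * deriv f z))"
      using integrable_L2_mult[OF f f'] by simp
    show "integrable lborel (\<lambda>z. (2 * f z * deriv f z) * indicator {x..y} z)"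
      using integrable_mult_indicator[OF _ i, of "{x..y}"] by (simp add: mult_ac)
    show "integrable lborel (\<lambda>z. 2 * norm (f z * deriv f z))"
      using integrable_abs[OF integrable_L2_mult[OF f f']] by simp
  qed (auto simp: abs_mult indicator_def)
  have 3: "(LINT z|lborel. 2 * \<bar>f z * deriv f z\<bar>) \<le> (L2_norm f)\<^sup>2 + (L2_norm (deriv f))\<^sup>2"
    using L2_abs_mult_le[OF f f'] sum_squares_bound[of "L2_norm f" "L2_norm (deriv f)"] by simp
  show "(f x)\<^sup>2 \<le> (L2_norm f)\<^sup>2 + (L2_norm (deriv f))\<^sup>2 + e" using 1 2 3 y(2) by linarith
qed

text \<open>
  A pointwise bound passes to weak limits: it is tested with the indicator of a bounded part of the set
  where \<open>g\<close> exceeds the bound.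
\<close>

lemma weak_limit_le:
  assumes g: "g \<in> L2" and gn: "\<And>n. gn n \<in> L2" "\<And>n x. gn n x \<le> M"
    and lim: "\<And>h. h \<in> L2 \<Longrightarrow> (\<lambda>n. L2_inner h (gn n)) \<longlonglongrightarrow> L2_inner h g"
  shows "AE x in lborel. g x \<le> M"
proof -
  note [measurable] = L2_measurable[OF g]
  have ae: "AE x in lborel. x \<in> {- real k..real k} \<longrightarrow> g x \<le> M" for k
  proof -
    define A where "A = {x \<in> {- real k..real k}. M < g x}"
    have "{x \<in> space lborel. x \<in> {- real k..real k} \<and> M < g x} \<in> sets lborel" by measurable
    then have [measurable]: "A \<in> sets borel" by (simp add: A_def)
    have "emeasure lborel A \<le> emeasure lborel {- real k..real k}"
      by (rule emeasure_mono) (auto simp: A_def)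
    also have "\<dots> < \<infinity>" by (simp add: emeasure_lborel_Icc_eq)
    finally have fin: "emeasure lborel A < \<infinity>" .
    then have i: "(indicator A :: real \<Rightarrow> real) \<in> L2" "integrable lborel (indicator A :: real \<Rightarrow> real)"
      by (auto intro!: indicator_in_L2 simp: integrable_indicator_iff)
    have "L2_inner (indicator A) (gn n) \<le> (LINT x|lborel. indicator A x * M)" for n
      unfolding L2_inner_def
    proof (rule integral_mono)
      show "integrable lborel (\<lambda>x. indicator A x * gn n x)" by (rule integrable_L2_mult[OF i(1) gn(1)])
      show "integrable lborel (\<lambda>x. indicator A x * M)" by (rule integrable_mult_left) (use i(2) in simp)
      show "indicator A x * gn n x \<le> indicator A x * M" for x
        by (rule mult_left_mono[OF gn(2)]) simp
    qed
    then have "L2_inner (indicator A) g \<le> (LINT x|lborel. indicator A x * M)"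
      by (intro LIMSEQ_le_const2[OF lim[OF i(1)]]) auto
    then have le: "(LINT x|lborel. indicator A x * (g x - M)) \<le> 0"
      using integrable_L2_mult[OF i(1) g] i(2) by (simp add: L2_inner_def right_diff_distrib)
    have int: "integrable lborel (\<lambda>x. indicator A x * (g x - M))"
      using integrable_L2_mult[OF i(1) g] i(2) by (simp add: right_diff_distrib)
    have nn: "0 \<le> indicator A x * (g x - M)" for x by (auto simp: A_def indicator_def)
    have "(LINT x|lborel. indicator A x * (g x - M)) = 0"
      using le by (intro antisym integral_nonneg_AE) (use nn in auto)
    then have "AE x in lborel. indicator A x * (g x - M) = 0"
      using integral_nonneg_eq_0_iff_AE[OF int] nn by simp
    then show ?thesis
    proof eventually_elim
      case (elim x)
      then show ?case by (cases "x \<in> A") (auto simp: A_def)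
    qed
  qed
  then have "AE x in lborel. \<forall>k. x \<in> {- real k..real k} \<longrightarrow> g x \<le> M"
    unfolding AE_all_countable by blast
  then show ?thesis
  proof eventually_elim
    case (elim x)
    obtain k where "\<bar>x\<bar> \<le> real k" using real_arch_simple by blast
    then have "x \<in> {- real k..real k}" by auto
    then show ?case using elim by blast
  qed
qed

lemma weak_limit_abs_le:
  assumes g: "g \<in> L2" and gn: "\<And>n. gn n \<in> L2" "\<And>n x. \<bar>gn n x\<bar> \<le> M"
    and lim: "\<And>h. h \<in> L2 \<Longrightarrow> (\<lambda>n. L2_inner h (gn n)) \<longlonglongrightarrow> L2_inner h g"
  shows "AE x in lborel. \<bar>g x\<bar> \<le> M"
proof -
  have "AE x in lborel. g x \<le> M"
    by (rule weak_limit_le[OF g gn(1) _ lim]) (use gn(2) in \<open>auto simp: abs_le_iff\<close>)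
  moreover have "AE x in lborel. -1 * g x \<le> M"
  proof (rule weak_limit_le[where gn="\<lambda>n x. -1 * gn n x"])
    show "(\<lambda>n. L2_inner h (\<lambda>x. -1 * gn n x)) \<longlonglongrightarrow> L2_inner h (\<lambda>x. -1 * g x)" if "h \<in> L2" for h
      unfolding L2_inner_cmult_right by (intro tendsto_mult_left lim that)
    show "-1 * gn n x \<le> M" for n x using gn(2)[of n x] by linarith
  qed (use g gn(1) in auto)
  ultimately show ?thesis by eventually_elim auto
qed

lemma sobolev_sup_le:
  assumes f: "f \<in> sobolev 1" shows "AE x in lborel. \<bar>f x\<bar> \<le> sobolev_norm 1 f"
proof (rule weak_limit_abs_le)
  let ?g = "weak_deriv 1 f"
  have fL: "f \<in> L2" and g: "has_weak_deriv 1 f ?g" "?g \<in> L2"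
    using sobolev_L2[OF f] sobolev_weak_deriv[OF f, of 1] sobolev_weak_deriv_L2[OF f, of 1] by simp_all
  show "f \<in> L2" by fact
  show "conv (mollifier_seq n) f \<in> L2" for n by (rule conv_L2[OF test_function_mollifier_seq fL])
  show "(\<lambda>n. L2_inner h (conv (mollifier_seq n) f)) \<longlonglongrightarrow> L2_inner h f" if "h \<in> L2" for h
    by (rule mollifier_tendsto[OF that fL])
  show "\<bar>conv (mollifier_seq n) f x\<bar> \<le> sobolev_norm 1 f" for n x
  proof -
    note \<psi> = test_function_mollifier_seq[of n]
    have d: "deriv (conv (mollifier_seq n) f) = conv (mollifier_seq n) ?g"
      using conv_funpow_deriv[OF \<psi> fL, of 1] conv_weak_deriv[OF \<psi> g(1)] by simp
    have "(conv (mollifier_seq n) f x)\<^sup>2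
        \<le> (L2_norm (conv (mollifier_seq n) f))\<^sup>2 + (L2_norm (conv (mollifier_seq n) ?g))\<^sup>2"
      using smooth_sup_le[OF conv_smooth[OF \<psi> fL] conv_L2[OF \<psi> fL]] conv_L2[OF \<psi> g(2)] unfolding d by blast
    also have "\<dots> \<le> (L2_norm f)\<^sup>2 + (L2_norm ?g)\<^sup>2"
      using mollifier_seq_conv_le fL g(2) by (intro add_mono power_mono) auto
    also have "\<dots> = (sobolev_norm 1 f)\<^sup>2"
      using L2_norm_weak_deriv[OF has_weak_deriv_0[OF fL]] by (simp add: sobolev_norm_square)
    finally show ?thesis by (simp add: abs_le_square_iff[symmetric])
  qed
qed

lemma Linf_norm_le_sobolev_norm:
  assumes "f \<in> sobolev n" "1 \<le> n" shows "Linf_norm f \<le> ereal (sobolev_norm n f)"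
  unfolding Linf_norm_def
proof (rule esssup_I)
  have f: "f \<in> sobolev 1" using assms sobolev_mono by blast
  then show "(\<lambda>x. ereal \<bar>f x\<bar>) \<in> borel_measurable lborel" using L2_measurable[OF sobolev_L2] by simp
  show "AE x in lborel. ereal \<bar>f x\<bar> \<le> ereal (sobolev_norm n f)"
    using sobolev_sup_le[OF f] by eventually_elim (use sobolev_norm_mono[OF assms(2), of f] in simp)
qed

subsection \<open>Products\<close>

lemma L2_mult_bounded:
  assumes f: "f \<in> L2" and g: "g \<in> borel_measurable borel" "AE x in lborel. \<bar>g x\<bar> \<le> M"
  shows "(\<lambda>x. f x * g x) \<in> L2" and "L2_norm (\<lambda>x. f x * g x) \<le> M * L2_norm f"
proof -
  note [measurable] = L2_measurable[OF f] g(1)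
  have ae: "AE x in lborel. \<bar>f x * g x\<bar> \<le> M * \<bar>f x\<bar>"
    using g(2)
  proof eventually_elim
    case (elim x)
    then show ?case using mult_right_mono[OF elim, of "\<bar>f x\<bar>"] by (simp add: abs_mult mult.commute)
  qed
  have "0 \<le> M"
  proof (rule ccontr)
    assume neg: "\<not> 0 \<le> M"
    have "AE x::real in lborel. False" using g(2) by eventually_elim (use neg in linarith)
    moreover have "(AE x::real in lborel. False) \<longleftrightarrow> emeasure lborel (UNIV :: real set) = 0"
      by (rule AE_iff_measurable) auto
    ultimately show False by simp
  qed
  then show "(\<lambda>x. f x * g x) \<in> L2" "L2_norm (\<lambda>x. f x * g x) \<le> M * L2_norm f"
    using L2_bound[OF f _ ae] L2_norm_mono_AE[OF f _ ae] by auto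
qed

lemma L2_mult_test_function:
  assumes "f \<in> L2" "test_function \<phi>" shows "(\<lambda>x. f x * \<phi> x) \<in> L2"
proof -
  obtain B where "\<And>x. \<bar>\<phi> x\<bar> \<le> B" using test_function_bounded[OF assms(2)] by metis
  then show ?thesis
    by (intro L2_mult_bounded(1)[OF assms(1) test_function_measurable[OF assms(2)]] AE_I2)
qed

text \<open>
  The product rule holds for a smooth first factor by the definition of the weak derivative of the
  second one. Mollifying the first factor gives the general case, and weak convergence suffices
  because the mollified factor occurs linearly.
\<close>

lemma has_weak_deriv_mult:
  assumes f: "f \<in> L2" "has_weak_deriv 1 f f'" and g: "g \<in> L2" "has_weak_deriv 1 g g'"
    and p: "(\<lambda>x. f' x * g x + f x * g' x) \<in> L2"
  shows "has_weak_deriv 1 (\<lambda>x. f x * g x) (\<lambda>x. f' x * g x + f x * g' x)"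
  unfolding has_weak_deriv_inner
proof (intro conjI allI impI p)
  fix \<phi> assume \<phi>: "test_function \<phi>"
  have \<phi>': "test_function (deriv \<phi>)" using test_function_deriv[OF \<phi>, of 1] by simp
  note L = has_weak_deriv_L2[OF f(2)] has_weak_deriv_L2[OF g(2)]
  let ?f = "\<lambda>n. conv (mollifier_seq n) f" and ?f' = "\<lambda>n. conv (mollifier_seq n) f'"
  have step: "L2_inner (\<lambda>x. g x * deriv \<phi> x) (?f n)
      = - L2_inner (\<lambda>x. g' x * \<phi> x) (?f n) - L2_inner (\<lambda>x. g x * \<phi> x) (?f' n)" for n
  proof -
    note \<psi> = test_function_mollifier_seq[of n]
    have s: "smooth (?f n)" by (rule conv_smooth[OF \<psi> f(1)])
    have t: "test_function (\<lambda>x. ?f n x * \<phi> x)" by (rule test_function_mult_smooth[OF \<phi> s])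
    have d: "(?f n has_real_derivative ?f' n x) (at x)" for x
      using conv_DERIV[OF \<psi> f(1), of x] conv_weak_deriv[OF \<psi> f(2)] by simp
    have "(\<phi> has_real_derivative deriv \<phi> x) (at x)" for x
      using smooth_DERIV[OF test_function_smooth[OF \<phi>], of 0] by simp
    then have "deriv (\<lambda>x. ?f n x * \<phi> x) = (\<lambda>x. ?f n x * deriv \<phi> x + ?f' n x * \<phi> x)"
      by (intro ext DERIV_imp_deriv DERIV_mult' d)
    then have "L2_inner g (\<lambda>x. ?f n x * deriv \<phi> x + ?f' n x * \<phi> x) = - L2_inner g' (\<lambda>x. ?f n x * \<phi> x)"
      using g(2) t unfolding has_weak_deriv_inner by fastforce
    also have "L2_inner g (\<lambda>x. ?f n x * deriv \<phi> x + ?f' n x * \<phi> x)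
        = L2_inner g (\<lambda>x. ?f n x * deriv \<phi> x) + L2_inner g (\<lambda>x. ?f' n x * \<phi> x)"
      using \<phi> \<phi>' by (intro L2_inner_add_right L2_mult_test_function conv_L2 \<psi> f(1) L g(1))
    finally show ?thesis by (simp add: L2_inner_def mult_ac)
  qed
  have "(\<lambda>n. L2_inner (\<lambda>x. g x * deriv \<phi> x) (?f n)) \<longlonglongrightarrow> L2_inner (\<lambda>x. g x * deriv \<phi> x) f"
    by (intro mollifier_tendsto L2_mult_test_function g f \<phi>')
  moreover have "(\<lambda>n. - L2_inner (\<lambda>x. g' x * \<phi> x) (?f n) - L2_inner (\<lambda>x. g x * \<phi> x) (?f' n))
      \<longlonglongrightarrow> - L2_inner (\<lambda>x. g' x * \<phi> x) f - L2_inner (\<lambda>x. g x * \<phi> x) f'"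
    by (intro tendsto_intros mollifier_tendsto L2_mult_test_function g f \<phi> L)
  ultimately have eq: "L2_inner (\<lambda>x. g x * deriv \<phi> x) f
      = - L2_inner (\<lambda>x. g' x * \<phi> x) f - L2_inner (\<lambda>x. g x * \<phi> x) f'"
    unfolding step by (rule LIMSEQ_unique)
  have i: "integrable lborel (\<lambda>x. g' x * \<phi> x * f x)" "integrable lborel (\<lambda>x. g x * \<phi> x * f' x)"
    by (intro integrable_L2_mult L2_mult_test_function g f \<phi> L)+
  have "L2_inner (\<lambda>x. f' x * g x + f x * g' x) \<phi> = (LINT x|lborel. g' x * \<phi> x * f x + g x * \<phi> x * f' x)"
    unfolding L2_inner_def by (rule Bochner_Integration.integral_cong) (auto simp: algebra_simps)
  also have "\<dots> = L2_inner (\<lambda>x. g' x * \<phi> x) f + L2_inner (\<lambda>x. g x * \<phi> x) f'"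
    using i by (simp add: L2_inner_def)
  finally show "L2_inner (\<lambda>x. f x * g x) ((deriv ^^ 1) \<phi>)
      = (-1) ^ 1 * L2_inner (\<lambda>x. f' x * g x + f x * g' x) \<phi>"
    using eq by (simp add: L2_inner_def mult_ac)
qed

text \<open>
  One factor must be bounded, hence \<open>max n 1\<close>. The step differentiates the product; each of the two terms
  contains one derivative, which plays the role of the factor in \<open>H\<^sup>n\<close>.
\<close>

lemma sobolev_mult_exists:
  "\<exists>C\<ge>0. \<forall>f\<in>sobolev n. \<forall>g\<in>sobolev (max n 1).
     (\<lambda>x. f x * g x) \<in> sobolev n \<and>
     sobolev_norm n (\<lambda>x. f x * g x) \<le> C * sobolev_norm n f * sobolev_norm (max n 1) g"
proof (induction n)
  case 0
  show ?case
  proof (intro exI[of _ 1] conjI ballI)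
    fix f g assume f: "f \<in> sobolev 0" and g: "g \<in> sobolev (max 0 1)"
    have fL: "f \<in> L2" by (rule sobolev_L2[OF f])
    have "AE x in lborel. \<bar>g x\<bar> \<le> sobolev_norm 1 g" using g by (intro sobolev_sup_le) simp
    note * = L2_mult_bounded[OF fL L2_measurable[OF sobolev_L2[OF g]] this]
    show "(\<lambda>x. f x * g x) \<in> sobolev 0" using *(1) by (simp add: sobolev_0)
    show "sobolev_norm 0 (\<lambda>x. f x * g x) \<le> 1 * sobolev_norm 0 f * sobolev_norm (max 0 1) g"
      using *(2) by (simp add: sobolev_norm_0[OF *(1)] sobolev_norm_0[OF fL] mult.commute)
  qed simp
next
  case (Suc n)
  then obtain C where C: "0 \<le> C" "\<And>f g. f \<in> sobolev n \<Longrightarrow> g \<in> sobolev (max n 1) \<Longrightarrow>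
     (\<lambda>x. f x * g x) \<in> sobolev n \<and>
     sobolev_norm n (\<lambda>x. f x * g x) \<le> C * sobolev_norm n f * sobolev_norm (max n 1) g" by blast
  show ?case
  proof (intro exI[of _ "3 * C"] conjI ballI)
    show "0 \<le> 3 * C" using C(1) by simp
    fix f g assume f: "f \<in> sobolev (Suc n)" and g: "g \<in> sobolev (max (Suc n) 1)"
    have g: "g \<in> sobolev (Suc n)" using g by simp
    let ?f = "weak_deriv 1 f" and ?g = "weak_deriv 1 g"
    let ?N = "sobolev_norm (Suc n) f * sobolev_norm (Suc n) g"
    have low: "h \<in> sobolev (max n 1)" "h \<in> sobolev n" "sobolev_norm (max n 1) h \<le> sobolev_norm (Suc n) h"
      "sobolev_norm n h \<le> sobolev_norm (Suc n) h" if "h \<in> sobolev (Suc n)" for h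
      using sobolev_mono[OF that] sobolev_norm_mono by auto
    have d: "has_weak_deriv 1 h (weak_deriv 1 h)" "weak_deriv 1 h \<in> sobolev n"
        "sobolev_norm n (weak_deriv 1 h) \<le> sobolev_norm (Suc n) h" if "h \<in> sobolev (Suc n)" for h
      using sobolev_weak_deriv[OF that, of 1] sobolev_weak_deriv_sobolev[OF that, of 1 n] by auto
    have est: "(\<lambda>x. a x * b x) \<in> sobolev n" "sobolev_norm n (\<lambda>x. a x * b x) \<le> C * ?N"
      if ab: "a \<in> sobolev n" "b \<in> sobolev (max n 1)" and le: "sobolev_norm n a \<le> A" "sobolev_norm (max n 1) b \<le> B"
        and N: "A * B = ?N" for a b A B
    proof -
      have "0 \<le> A" using le(1) sobolev_norm_nonneg[of n a] by linarith
      then have "sobolev_norm n a * sobolev_norm (max n 1) b \<le> ?N"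
        unfolding N[symmetric] using le by (intro mult_mono) auto
      then show "sobolev_norm n (\<lambda>x. a x * b x) \<le> C * ?N"
        using C(2)[OF ab] mult_left_mono[OF _ C(1)] by (fastforce simp: mult.assoc)
      show "(\<lambda>x. a x * b x) \<in> sobolev n" using C(2)[OF ab] by blast
    qed
    note p1 = est[OF d(2)[OF f] low(1)[OF g] d(3)[OF f] low(3)[OF g] refl]
    note p0 = est[OF low(2)[OF f] low(1)[OF g] low(4)[OF f] low(3)[OF g] refl]
    have p2: "(\<lambda>x. f x * ?g x) \<in> sobolev n" "sobolev_norm n (\<lambda>x. f x * ?g x) \<le> C * ?N"
      unfolding mult.commute[of "f _" "?g _"]
      by (fact est[OF d(2)[OF g] low(1)[OF f] d(3)[OF g] low(3)[OF f] mult.commute])+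
    note s = sobolev_add[OF p1(1) p2(1)]
    have "has_weak_deriv 1 (\<lambda>x. f x * g x) (\<lambda>x. ?f x * g x + f x * ?g x)"
      using d(1)[OF f] d(1)[OF g] sobolev_L2[OF f] sobolev_L2[OF g] sobolev_L2[OF s(1)]
      by (intro has_weak_deriv_mult)
    note * = sobolev_Suc[OF sobolev_L2[OF p0(1)] this s(1)]
    show "(\<lambda>x. f x * g x) \<in> sobolev (Suc n)" by (rule *(1))
    have "sobolev_norm (Suc n) (\<lambda>x. f x * g x) \<le> 3 * (C * ?N)"
      using *(2) s(2) p1(2) p2(2) p0(2) L2_norm_le_sobolev_norm[OF sobolev_L2[OF p0(1)], of n] by linarith
    then show "sobolev_norm (Suc n) (\<lambda>x. f x * g x)
        \<le> 3 * C * sobolev_norm (Suc n) f * sobolev_norm (max (Suc n) 1) g" by (simp add: mult_ac)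
  qed
qed


subsection \<open>Polynomials of a Sobolev function\<close>

definition mult_const :: "nat \<Rightarrow> real" where
  "mult_const n = (SOME C. C \<ge> 0 \<and> (\<forall>f\<in>sobolev n. \<forall>g\<in>sobolev (max n 1).
     (\<lambda>x. f x * g x) \<in> sobolev n \<and>
     sobolev_norm n (\<lambda>x. f x * g x) \<le> C * sobolev_norm n f * sobolev_norm (max n 1) g))"

lemma mult_const_nonneg: "0 \<le> mult_const n"
  using someI_ex[OF sobolev_mult_exists[of n]] unfolding mult_const_def by blast

lemma sobolev_mult:
  assumes "f \<in> sobolev n" "g \<in> sobolev (max n 1)"
  shows "(\<lambda>x. f x * g x) \<in> sobolev n"
    and "sobolev_norm n (\<lambda>x. f x * g x) \<le> mult_const n * sobolev_norm n f * sobolev_norm (max n 1) g"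
  using someI_ex[OF sobolev_mult_exists[of n]] assms unfolding mult_const_def by blast+

lemma sobolev_power:
  assumes n: "1 \<le> n" and u: "u \<in> sobolev n"
  shows "(\<lambda>x. u x ^ Suc i) \<in> sobolev n \<and>
    sobolev_norm n (\<lambda>x. u x ^ Suc i) \<le> mult_const n ^ i * sobolev_norm n u ^ Suc i"
proof (induction i)
  case 0 then show ?case using u by simp
next
  case (Suc i)
  have mx: "max n 1 = n" using n by simp
  have "(\<lambda>x. u x ^ Suc (Suc i)) = (\<lambda>x. u x ^ Suc i * u x)" by (simp add: mult.commute)
  moreover have "sobolev_norm n (\<lambda>x. u x ^ Suc i * u x)
      \<le> mult_const n * (mult_const n ^ i * sobolev_norm n u ^ Suc i) * sobolev_norm n u"
    using sobolev_mult(2)[of _ n u, unfolded mx, OF conjunct1[OF Suc] u] conjunct2[OF Suc] mult_const_nonneg[of n]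
    by (meson mult_left_mono mult_right_mono order_trans sobolev_norm_nonneg)
  ultimately show ?case
    using sobolev_mult(1)[of _ n u, unfolded mx, OF conjunct1[OF Suc] u] by (simp add: mult_ac)
qed

text \<open>
  At the norm of the data this is the quantity whose reciprocal bounds the lifespan. Up to a constant it
  also bounds the \<open>H\<^sup>n\<close> norm of \<open>F(u)\<close>.
\<close>

definition growth :: "real poly \<Rightarrow> real \<Rightarrow> real" where
  "growth F R = coeff_bound F * (\<Sum>j=1..degree F. R ^ j)"

lemma coeff_le_coeff_bound:
  assumes "j \<in> {1..degree F}" shows "\<bar>coeff F j\<bar> \<le> coeff_bound F"
proof -
  have "1 * \<bar>coeff F j\<bar> \<le> real j * \<bar>coeff F j\<bar>" using assms by (intro mult_right_mono) auto
  also have "\<dots> \<le> coeff_bound F" unfolding coeff_bound_def using assms by (intro Max_ge) auto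
  finally show ?thesis by simp
qed

lemma coeff_bound_pos:
  assumes "1 \<le> degree F" shows "0 < coeff_bound F"
proof -
  have "0 < \<bar>coeff F (degree F)\<bar>" using assms by auto
  also have "\<dots> \<le> coeff_bound F" by (rule coeff_le_coeff_bound) (use assms in auto)
  finally show ?thesis .
qed

lemma growth_mono:
  assumes "1 \<le> degree F" "0 \<le> r" "r \<le> R" shows "growth F r \<le> growth F R"
  unfolding growth_def using coeff_bound_pos[OF assms(1)] assms
  by (intro mult_left_mono sum_mono power_mono) auto

lemma growth_nonneg: "1 \<le> degree F \<Longrightarrow> 0 \<le> R \<Longrightarrow> 0 \<le> growth F R"
  unfolding growth_def using coeff_bound_pos[of F] by (intro mult_nonneg_nonneg sum_nonneg) auto

definition poly_const :: "nat \<Rightarrow> nat \<Rightarrow> real" where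
  "poly_const n k = (1 + mult_const n) ^ k"

lemma sobolev_poly:
  assumes n: "1 \<le> n" and u: "u \<in> sobolev n" and F: "poly F 0 = 0" "1 \<le> degree F"
  shows "(\<lambda>x. poly F (u x)) \<in> sobolev n"
    and "sobolev_norm n (\<lambda>x. poly F (u x)) \<le> poly_const n (degree F) * growth F (sobolev_norm n u)"
proof -
  let ?r = "sobolev_norm n u" and ?k = "degree F"
  have 0: "coeff F 0 = 0" using F(1) by (simp add: poly_0_coeff_0)
  have eq: "(\<lambda>x. poly F (u x)) = (\<lambda>x. \<Sum>j\<in>{1..?k}. coeff F j * u x ^ j)"
  proof
    fix x
    have "poly F (u x) = (\<Sum>j\<in>insert 0 {1..?k}. coeff F j * u x ^ j)"
      unfolding poly_altdef by (rule sum.cong) auto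
    then show "poly F (u x) = (\<Sum>j\<in>{1..?k}. coeff F j * u x ^ j)" using 0 by simp
  qed
  have pw: "(\<lambda>x. u x ^ j) \<in> sobolev n" "sobolev_norm n (\<lambda>x. u x ^ j) \<le> poly_const n ?k * ?r ^ j"
    if j: "j \<in> {1..?k}" for j
  proof -
    obtain i where i: "j = Suc i" using j by (cases j) auto
    have le: "sobolev_norm n (\<lambda>x. u x ^ j) \<le> mult_const n ^ i * ?r ^ j"
      using sobolev_power[OF n u, of i] i by simp
    have "mult_const n ^ i \<le> (1 + mult_const n) ^ i" using mult_const_nonneg by (intro power_mono) auto
    also have "\<dots> \<le> poly_const n ?k"
      unfolding poly_const_def using mult_const_nonneg j i by (intro power_increasing) auto
    finally have "mult_const n ^ i * ?r ^ j \<le> poly_const n ?k * ?r ^ j" by (rule mult_right_mono) simp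
    with le show "sobolev_norm n (\<lambda>x. u x ^ j) \<le> poly_const n ?k * ?r ^ j" by linarith
    show "(\<lambda>x. u x ^ j) \<in> sobolev n" using sobolev_power[OF n u, of i] i by simp
  qed
  have s: "(\<lambda>x. poly F (u x)) \<in> sobolev n \<and>
      sobolev_norm n (\<lambda>x. poly F (u x)) \<le> (\<Sum>j\<in>{1..?k}. sobolev_norm n (\<lambda>x. coeff F j * u x ^ j))"
    unfolding eq by (rule sobolev_sum) (use pw(1) sobolev_cmult(1) in auto)
  then show "(\<lambda>x. poly F (u x)) \<in> sobolev n" by blast
  have "(\<Sum>j\<in>{1..?k}. sobolev_norm n (\<lambda>x. coeff F j * u x ^ j))
      \<le> (\<Sum>j\<in>{1..?k}. coeff_bound F * (poly_const n ?k * ?r ^ j))"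
  proof (rule sum_mono)
    fix j assume j: "j \<in> {1..?k}"
    show "sobolev_norm n (\<lambda>x. coeff F j * u x ^ j) \<le> coeff_bound F * (poly_const n ?k * ?r ^ j)"
      unfolding sobolev_cmult(2)[OF pw(1)[OF j]]
      using coeff_le_coeff_bound[OF j] pw(2)[OF j] by (intro mult_mono) auto
  qed
  also have "\<dots> = poly_const n ?k * growth F ?r"
    by (simp add: growth_def sum_distrib_left mult_ac)
  finally show "sobolev_norm n (\<lambda>x. poly F (u x)) \<le> poly_const n ?k * growth F ?r"
    using s by linarith
qed

section \<open>The nonlinear term\<close>

lemma nonlinearity_sobolev:
  assumes m: "r < m" "2 \<le> m" and a: "a \<in> sobolev m" and u: "u \<in> sobolev m"
  shows "(\<lambda>x. a x * weak_deriv 1 u x) \<in> sobolev r"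
    and "sobolev_norm r (\<lambda>x. a x * weak_deriv 1 u x) \<le> mult_const r * sobolev_norm m a * sobolev_norm m u"
proof -
  have le: "max r 1 \<le> m" using m by simp
  have d: "weak_deriv 1 u \<in> sobolev r" "sobolev_norm r (weak_deriv 1 u) \<le> sobolev_norm m u"
    using sobolev_weak_deriv_sobolev[OF u, of 1 r] m by auto
  note p = sobolev_mult[OF d(1) sobolev_mono[OF a le]]
  have eq: "(\<lambda>x. a x * weak_deriv 1 u x) = (\<lambda>x. weak_deriv 1 u x * a x)" by (simp add: mult.commute)
  show "(\<lambda>x. a x * weak_deriv 1 u x) \<in> sobolev r" unfolding eq by (rule p(1))
  have "mult_const r * sobolev_norm r (weak_deriv 1 u) * sobolev_norm (max r 1) a
      \<le> mult_const r * sobolev_norm m u * sobolev_norm m a"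
    using d(2) sobolev_norm_mono[OF le] mult_const_nonneg[of r] by (intro mult_mono mult_left_mono) auto
  then show "sobolev_norm r (\<lambda>x. a x * weak_deriv 1 u x) \<le> mult_const r * sobolev_norm m a * sobolev_norm m u"
    unfolding eq using p(2) by (simp add: mult_ac)
qed

text \<open>
  Of the terms of the \<open>j\<close>-th derivative of \<open>a u'\<close>, only the one in which every derivative falls on \<open>u\<close> is as
  bad as the derivative itself, which has \<open>m - 1 - j\<close> further derivatives. The sum \<open>R\<close> of the others has
  one more, and this pays for the additional derivative in the energy identity.
\<close>

lemma nonlinearity_deriv:
  assumes "2 \<le> m" "j < m"
  shows "\<exists>C\<ge>0. \<forall>a\<in>sobolev m. \<forall>u\<in>sobolev m. \<exists>R\<in>sobolev (m - j).
     sobolev_norm (m - j) R \<le> C * (sobolev_norm m a * sobolev_norm m u) \<and>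
     has_weak_deriv j (\<lambda>x. a x * weak_deriv 1 u x) (\<lambda>x. a x * weak_deriv (Suc j) u x + R x)"
  using assms(2)
proof (induction j)
  case 0
  show ?case
  proof (intro exI[of _ 0] conjI ballI bexI[of _ "\<lambda>x. 0"])
    fix a u assume "a \<in> sobolev m" "u \<in> sobolev m"
    then have "(\<lambda>x. a x * weak_deriv 1 u x) \<in> L2"
      using nonlinearity_sobolev(1)[of 0 m a u] assms by (simp add: sobolev_0)
    then show "has_weak_deriv 0 (\<lambda>x. a x * weak_deriv 1 u x) (\<lambda>x. a x * weak_deriv (Suc 0) u x + 0)"
      using has_weak_deriv_0 by simp
  qed (auto simp: sobolev_zero)
next
  case (Suc j)
  then obtain C where C: "0 \<le> C" "\<And>a u. a \<in> sobolev m \<Longrightarrow> u \<in> sobolev m \<Longrightarrow> \<exists>R\<in>sobolev (m - j).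
     sobolev_norm (m - j) R \<le> C * (sobolev_norm m a * sobolev_norm m u) \<and>
     has_weak_deriv j (\<lambda>x. a x * weak_deriv 1 u x) (\<lambda>x. a x * weak_deriv (Suc j) u x + R x)"
    by (meson Suc_lessD)
  define r where "r = m - Suc j"
  have r: "m - j = 1 + r" "Suc j + r = m" "1 \<le> r" "max r 1 = r" "1 + r \<le> m"
    using Suc.prems by (auto simp: r_def)
  show ?case
    unfolding r_def[symmetric]
  proof (intro exI[of _ "C + mult_const r"] conjI ballI)
    show "0 \<le> C + mult_const r" using C(1) mult_const_nonneg[of r] by simp
    fix a u assume a: "a \<in> sobolev m" and u: "u \<in> sobolev m"
    obtain R where R: "R \<in> sobolev (1 + r)" "sobolev_norm (1 + r) R \<le> C * (sobolev_norm m a * sobolev_norm m u)"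
      "has_weak_deriv j (\<lambda>x. a x * weak_deriv 1 u x) (\<lambda>x. a x * weak_deriv (Suc j) u x + R x)"
      using C(2)[OF a u] r(1) by auto
    let ?a' = "weak_deriv 1 a" and ?R' = "weak_deriv 1 R"
    let ?v = "weak_deriv (Suc j) u" and ?v' = "weak_deriv (Suc (Suc j)) u"
    have R': "?R' \<in> sobolev r" "sobolev_norm r ?R' \<le> sobolev_norm (1 + r) R" "has_weak_deriv 1 R ?R'"
      using sobolev_weak_deriv_sobolev[OF R(1), of 1 r] sobolev_weak_deriv[OF R(1), of 1] by auto
    have v: "?v \<in> sobolev r" "sobolev_norm r ?v \<le> sobolev_norm m u" "?v \<in> L2"
      using sobolev_weak_deriv_sobolev[OF u, of "Suc j" r] sobolev_weak_deriv_L2[OF u, of "Suc j"] r by auto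
    have a': "?a' \<in> sobolev (max r 1)" "sobolev_norm (max r 1) ?a' \<le> sobolev_norm m a" "has_weak_deriv 1 a ?a'"
      using sobolev_weak_deriv_sobolev[OF a, of 1 r] sobolev_weak_deriv[OF a, of 1] r by auto
    have v': "has_weak_deriv 1 ?v ?v'" "?v' \<in> L2"
      using has_weak_deriv_cancel[OF sobolev_weak_deriv[OF u, of "Suc j"], of 1 ?v']
        sobolev_weak_deriv[OF u, of "Suc (Suc j)"] sobolev_weak_deriv_L2[OF u, of "Suc (Suc j)"] Suc.prems by auto
    have a1: "a \<in> sobolev 1" using sobolev_mono[OF a, of 1] assms(1) by simp
    note aL = sobolev_L2[OF a]
    have va': "(\<lambda>x. ?v x * ?a' x) \<in> sobolev r"
      "sobolev_norm r (\<lambda>x. ?v x * ?a' x) \<le> mult_const r * (sobolev_norm m a * sobolev_norm m u)"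
    proof -
      show "(\<lambda>x. ?v x * ?a' x) \<in> sobolev r" by (rule sobolev_mult(1)[OF v(1) a'(1)])
      have "sobolev_norm r ?v * sobolev_norm (max r 1) ?a' \<le> sobolev_norm m u * sobolev_norm m a"
        using v(2) a'(2) by (intro mult_mono) auto
      then have "mult_const r * (sobolev_norm r ?v * sobolev_norm (max r 1) ?a')
          \<le> mult_const r * (sobolev_norm m u * sobolev_norm m a)"
        by (rule mult_left_mono[OF _ mult_const_nonneg])
      then show "sobolev_norm r (\<lambda>x. ?v x * ?a' x) \<le> mult_const r * (sobolev_norm m a * sobolev_norm m u)"
        using sobolev_mult(2)[OF v(1) a'(1)] by (simp add: mult_ac)
    qed
    have va: "(\<lambda>x. ?v x * a x) \<in> L2" "(\<lambda>x. ?v' x * a x) \<in> L2"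
      using L2_mult_bounded(1)[OF _ L2_measurable[OF aL] sobolev_sup_le[OF a1]] v(3) v'(2) by auto
    have W: "has_weak_deriv 1 (\<lambda>x. ?v x * a x) (\<lambda>x. ?v' x * a x + ?v x * ?a' x)"
      by (rule has_weak_deriv_mult[OF v(3) v'(1) aL a'(3)]) (use va(2) sobolev_L2[OF va'(1)] in auto)
    have W2: "has_weak_deriv 1 (\<lambda>x. ?v x * a x + R x) (\<lambda>x. (?v' x * a x + ?v x * ?a' x) + ?R' x)"
      by (rule has_weak_deriv_add[OF W R'(3) va(1) sobolev_L2[OF R(1)]])
    have "has_weak_deriv j (\<lambda>x. a x * weak_deriv 1 u x) (\<lambda>x. ?v x * a x + R x)"
      using R(3) by (simp add: mult.commute)
    from has_weak_deriv_trans[OF this W2]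
    have "has_weak_deriv (Suc j) (\<lambda>x. a x * weak_deriv 1 u x) (\<lambda>x. a x * ?v' x + (?v x * ?a' x + ?R' x))"
      by (simp add: mult.commute add.assoc)
    moreover have "(\<lambda>x. ?v x * ?a' x + ?R' x) \<in> sobolev r" by (rule sobolev_add(1)[OF va'(1) R'(1)])
    moreover have "sobolev_norm r (\<lambda>x. ?v x * ?a' x + ?R' x)
        \<le> (C + mult_const r) * (sobolev_norm m a * sobolev_norm m u)"
      using sobolev_add(2)[OF va'(1) R'(1)] va'(2) R'(2) R(2) by (simp add: distrib_right)
    ultimately show "\<exists>R\<in>sobolev r. sobolev_norm r R \<le> (C + mult_const r) * (sobolev_norm m a * sobolev_norm m u) \<and>
        has_weak_deriv (Suc j) (\<lambda>x. a x * weak_deriv 1 u x) (\<lambda>x. a x * weak_deriv (Suc (Suc j)) u x + R x)"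
      by (intro bexI[of _ "\<lambda>x. ?v x * ?a' x + ?R' x"] conjI)
  qed
qed

subsection \<open>The commutator with a mollifier\<close>

lemma smooth_ident: "smooth (\<lambda>x. x)"
proof -
  have "differentiable_upto n (\<lambda>x. x)" for n
    using smooth_const by (cases n) (auto simp: differentiable_upto_0 differentiable_upto_Suc smooth_iff_upto)
  then show ?thesis by (simp add: smooth_iff_upto)
qed

lemma funpow_deriv_parity:
  assumes "smooth \<psi>" "\<And>x. \<psi> (- x) = \<psi> x"
  shows "(deriv ^^ n) \<psi> (- x) = (-1) ^ n * (deriv ^^ n) \<psi> x"
proof -
  have "(\<lambda>x. \<psi> (0 + (-1) * x)) = \<psi>" using assms(2) by simp
  then have "(deriv ^^ n) \<psi> = (\<lambda>x. (-1) ^ n * (deriv ^^ n) \<psi> (- x))"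
    using smooth_funpow_deriv_affine[OF assms(1), of n 0 "-1"] by simp
  then have "(deriv ^^ n) \<psi> x = (-1) ^ n * (deriv ^^ n) \<psi> (- x)" by (rule fun_cong)
  then show ?thesis by (simp add: minus_one_power_mult_self)
qed

text \<open>
  As \<open>\<rho>'\<close> is odd, exchanging the roles of \<open>x\<close> and \<open>x - z\<close> turns the form with weight \<open>b x\<close> into minus the
  form with weight \<open>b (x - z)\<close>. Symmetrizing replaces \<open>b x\<close> by half of \<open>b x - b (x - z)\<close>, whose size \<open>L \<bar>z\<bar>\<close> compensates
  the singularity of \<open>\<rho>'\<close>.
\<close>

lemma skew_form_Lipschitz:
  assumes v: "v \<in> L2" and b: "b \<in> borel_measurable borel" "\<And>x. \<bar>b x\<bar> \<le> B"
    and lip: "\<And>x y. \<bar>b x - b y\<bar> \<le> L * \<bar>x - y\<bar>"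
  shows "\<bar>L2_inner (\<lambda>x. v x * b x) (conv (deriv (mollifier_seq n)) v)\<bar> \<le> L * mollifier_moment * (L2_norm v)\<^sup>2"
proof -
  let ?\<rho> = "deriv (mollifier_seq n)"
  have \<rho>: "test_function ?\<rho>" using test_function_deriv[OF test_function_mollifier_seq, of 1 n] by simp
  have odd: "?\<rho> (- z) = - ?\<rho> z" for z
    using funpow_deriv_parity[OF test_function_smooth[OF test_function_mollifier_seq] mollifier_seq_even, of 1 n z] by simp
  have vb: "(\<lambda>x. v x * b x) \<in> L2" by (rule L2_mult_bounded(1)[OF v b(1) AE_I2[OF b(2)]])
  note [measurable] = L2_measurable[OF v] b(1) test_function_measurable[OF \<rho>]
  let ?I = "L2_inner (\<lambda>x. v x * b x) (conv ?\<rho> v)"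
  have I1: "?I = (LINT z|lborel. LINT x|lborel. ?\<rho> z * (v x * b x * v (x - z)))"
    using L2_inner_conv[OF \<rho> vb v] by simp
  have "?I = L2_inner (conv (\<lambda>z. -1 * ?\<rho> z) (\<lambda>x. v x * b x)) v"
    using conv_adjoint[OF \<rho> vb v] odd by simp
  also have "\<dots> = - L2_inner v (conv ?\<rho> (\<lambda>x. v x * b x))"
    unfolding conv_cmult_kernel[abs_def] L2_inner_cmult_left by (simp add: L2_inner_commute)
  also have "\<dots> = - (LINT z|lborel. LINT x|lborel. ?\<rho> z * (v x * (v (x - z) * b (x - z))))"
    using L2_inner_conv[OF \<rho> v vb] by simp
  finally have I2: "?I = - (LINT z|lborel. LINT x|lborel. ?\<rho> z * (v x * (v (x - z) * b (x - z))))" .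
  note k1 = kernel_integrable[OF test_function_integrable[OF \<rho>] vb v]
  note k2 = kernel_integrable[OF test_function_integrable[OF \<rho>] v vb]
  let ?P = "\<lambda>z x. ?\<rho> z * (v x * b x * v (x - z))" and ?Q = "\<lambda>z x. ?\<rho> z * (v x * (v (x - z) * b (x - z)))"
  have z\<rho>: "test_function (\<lambda>z. z * ?\<rho> z)" by (rule test_function_mult_smooth[OF \<rho> smooth_ident])
  note k3 = kernel_integrable[OF test_function_integrable[OF z\<rho>] v v]
  have "2 * ?I = (LINT p|(lborel \<Otimes>\<^sub>M lborel). ?P (fst p) (snd p)) - (LINT p|(lborel \<Otimes>\<^sub>M lborel). ?Q (fst p) (snd p))"
    using lborel_pair.integral_fst'[OF k1] lborel_pair.integral_fst'[OF k2] I1 I2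
    by (simp add: case_prod_unfold)
  also have "\<dots> = (LINT p|(lborel \<Otimes>\<^sub>M lborel). ?P (fst p) (snd p) - ?Q (fst p) (snd p))"
    using k1 k2 by (simp add: case_prod_unfold)
  finally have eq: "2 * ?I = (LINT p|(lborel \<Otimes>\<^sub>M lborel). ?P (fst p) (snd p) - ?Q (fst p) (snd p))" .
  have "\<bar>2 * ?I\<bar> \<le> (LINT p|(lborel \<Otimes>\<^sub>M lborel). L * \<bar>fst p * ?\<rho> (fst p) * (v (snd p) * v (snd p - fst p))\<bar>)"
    unfolding eq real_norm_def[symmetric]
  proof (rule Bochner_Integration.integral_norm_bound_integral)
    show "integrable (lborel \<Otimes>\<^sub>M lborel) (\<lambda>p. ?P (fst p) (snd p) - ?Q (fst p) (snd p))"
      using k1 k2 by (simp add: case_prod_unfold)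
    show "integrable (lborel \<Otimes>\<^sub>M lborel) (\<lambda>p. L * norm (fst p * ?\<rho> (fst p) * (v (snd p) * v (snd p - fst p))))"
      using integrable_norm[OF k3] by (simp add: case_prod_unfold)
    fix p :: "real \<times> real"
    obtain z x where p: "p = (z, x)" by (cases p)
    have "?P z x - ?Q z x = (b x - b (x - z)) * (?\<rho> z * (v x * v (x - z)))" by (simp add: algebra_simps)
    moreover have "\<bar>b x - b (x - z)\<bar> * \<bar>?\<rho> z * (v x * v (x - z))\<bar> \<le> L * \<bar>z\<bar> * \<bar>?\<rho> z * (v x * v (x - z))\<bar>"
      using lip[of x "x - z"] by (intro mult_right_mono) auto
    ultimately show "norm (?P (fst p) (snd p) - ?Q (fst p) (snd p))
        \<le> L * norm (fst p * ?\<rho> (fst p) * (v (snd p) * v (snd p - fst p)))"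
      by (simp add: p abs_mult mult_ac)
  qed
  also have "\<dots> = L * (LINT z|lborel. LINT x|lborel. \<bar>z * ?\<rho> z * (v x * v (x - z))\<bar>)"
    using lborel_pair.integral_fst'[OF integrable_abs[OF k3]] by (simp add: case_prod_unfold)
  also have "\<dots> \<le> L * ((LINT z|lborel. \<bar>z * ?\<rho> z\<bar>) * (L2_norm v * L2_norm v))"
  proof (rule mult_left_mono)
    show "(LINT z|lborel. LINT x|lborel. \<bar>z * ?\<rho> z * (v x * v (x - z))\<bar>)
        \<le> (LINT z|lborel. \<bar>z * ?\<rho> z\<bar>) * (L2_norm v * L2_norm v)"
      using kernel_integral_abs_le[OF test_function_integrable[OF z\<rho>] v v] by simp
    show "0 \<le> L" using lip[of 1 0] abs_ge_zero[of "b 1 - b 0"] by simp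
  qed
  also have "\<dots> = L * mollifier_moment * (L2_norm v)\<^sup>2"
    by (simp add: mollifier_seq_moment power2_eq_square)
  finally have "2 * \<bar>?I\<bar> \<le> L * mollifier_moment * (L2_norm v)\<^sup>2" by (simp add: abs_mult)
  then show ?thesis by linarith
qed

lemma conv_mollifier_abs_le:
  assumes f: "f \<in> L2" and le: "AE x in lborel. \<bar>f x\<bar> \<le> L"
  shows "\<bar>conv (mollifier_seq n) f x\<bar> \<le> L"
proof -
  note \<psi> = test_function_mollifier_seq[of n]
  have i: "integrable lborel (\<lambda>y. mollifier_seq n (x - y))"
    by (rule test_function_integrable[OF test_function_reflect_shift[OF \<psi>]])
  have "\<bar>conv (mollifier_seq n) f x\<bar> \<le> (LINT y|lborel. \<bar>mollifier_seq n (x - y) * f y\<bar>)"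
    unfolding conv_def by (rule integral_abs_bound)
  also have "\<dots> \<le> (LINT y|lborel. mollifier_seq n (x - y) * L)"
  proof (rule integral_mono_AE)
    show "integrable lborel (\<lambda>y. \<bar>mollifier_seq n (x - y) * f y\<bar>)"
      by (intro integrable_abs conv_integrable \<psi> f)
    show "integrable lborel (\<lambda>y. mollifier_seq n (x - y) * L)" using i by simp
    show "AE y in lborel. \<bar>mollifier_seq n (x - y) * f y\<bar> \<le> mollifier_seq n (x - y) * L"
      using le
    proof eventually_elim
      case (elim y)
      then show ?case using mult_left_mono[OF elim mollifier_seq_nonneg[of n "x - y"]]
          mollifier_seq_nonneg[of n "x - y"] by (simp add: abs_mult)
    qed
  qed
  also have "\<dots> = L"
    using integral_reflect_shift[of "mollifier_seq n" x] mollifier_seq_integral[of n] by simp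
  finally show ?thesis .
qed

text \<open>
  A Sobolev function is Lipschitz only up to null sets. Its mollifications are Lipschitz with the bound of
  the weak derivative, and the form is linear in \<open>a\<close>.
\<close>

lemma skew_form_le:
  assumes v: "v \<in> L2" and a: "a \<in> sobolev 2"
  shows "\<bar>L2_inner (\<lambda>x. a x * v x) (conv (deriv (mollifier_seq n)) v)\<bar>
    \<le> sobolev_norm 2 a * mollifier_moment * (L2_norm v)\<^sup>2"
proof -
  let ?\<rho> = "deriv (mollifier_seq n)" and ?a' = "weak_deriv 1 a"
  let ?b = "\<lambda>k. conv (mollifier_seq k) a" and ?h = "conv (deriv (mollifier_seq n)) v"
  have \<rho>: "test_function ?\<rho>" using test_function_deriv[OF test_function_mollifier_seq, of 1 n] by simp
  have aL: "a \<in> L2" by (rule sobolev_L2[OF a])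
  have a': "has_weak_deriv 1 a ?a'" "?a' \<in> L2"
    using sobolev_weak_deriv[OF a, of 1] sobolev_weak_deriv_L2[OF a, of 1] by auto
  have "?a' \<in> sobolev 1" "sobolev_norm 1 ?a' \<le> sobolev_norm 2 a"
    using sobolev_weak_deriv_sobolev[OF a, of 1 1] by auto
  then have ae: "AE x in lborel. \<bar>?a' x\<bar> \<le> sobolev_norm 2 a"
    using sobolev_sup_le[of ?a'] by (auto elim!: eventually_mono)
  have vh: "(\<lambda>x. v x * ?h x) \<in> L2"
    by (rule L2_mult_bounded(1)[OF v conv_measurable[OF \<rho> v] AE_I2[OF conv_abs_le[OF \<rho> v]]])
  have bound: "\<bar>L2_inner (\<lambda>x. v x * ?h x) (?b k)\<bar> \<le> sobolev_norm 2 a * mollifier_moment * (L2_norm v)\<^sup>2" for k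
  proof -
    note \<psi> = test_function_mollifier_seq[of k]
    have d: "(?b k has_real_derivative conv (mollifier_seq k) ?a' x) (at x)" for x
      using conv_DERIV[OF \<psi> aL, of x] conv_weak_deriv[OF \<psi> a'(1)] by simp
    have "\<bar>?b k x - ?b k y\<bar> \<le> sobolev_norm 2 a * \<bar>x - y\<bar>" for x y
      using field_differentiable_bound[of UNIV "?b k" "conv (mollifier_seq k) ?a'" "sobolev_norm 2 a" x y]
        d conv_mollifier_abs_le[OF a'(2) ae] by auto
    from skew_form_Lipschitz[OF v conv_measurable[OF \<psi> aL] conv_abs_le[OF \<psi> aL] this]
    show ?thesis by (simp add: L2_inner_def mult_ac)
  qed
  have "(\<lambda>k. \<bar>L2_inner (\<lambda>x. v x * ?h x) (?b k)\<bar>) \<longlonglongrightarrow> \<bar>L2_inner (\<lambda>x. v x * ?h x) a\<bar>"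
    by (intro tendsto_rabs mollifier_tendsto vh aL)
  then have "\<bar>L2_inner (\<lambda>x. v x * ?h x) a\<bar> \<le> sobolev_norm 2 a * mollifier_moment * (L2_norm v)\<^sup>2"
    by (rule LIMSEQ_le_const2) (use bound in blast)
  then show ?thesis by (simp add: L2_inner_def mult_ac)
qed

text \<open>
  Pairing with this kernel on both sides computes \<open>\<langle>D\<^sup>j f, \<rho> \<star> D\<^sup>j g\<rangle>\<close> without
  differentiating \<open>f\<close> or \<open>g\<close>.
\<close>

definition energy_kernel :: "nat \<Rightarrow> nat \<Rightarrow> real \<Rightarrow> real" where
  "energy_kernel n j x = (-1) ^ j * (deriv ^^ (2 * j)) (mollifier_seq n) x"

lemma test_function_energy_kernel: "test_function (energy_kernel n j)"
  unfolding energy_kernel_def[abs_def]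
  by (intro test_function_cmult test_function_deriv test_function_mollifier_seq)

lemma energy_kernel_even: "energy_kernel n j (- x) = energy_kernel n j x"
  unfolding energy_kernel_def
  using funpow_deriv_parity[OF test_function_smooth[OF test_function_mollifier_seq] mollifier_seq_even, of "2 * j" n x]
  by simp

lemma L2_inner_energy_kernel:
  assumes "f \<in> L2" and f': "has_weak_deriv j f f'" and g': "has_weak_deriv j g g'"
  shows "L2_inner f (conv (energy_kernel n j) g) = L2_inner f' (conv (mollifier_seq n) g')"
proof -
  note \<psi> = test_function_mollifier_seq[of n]
  have "conv ((deriv ^^ (2 * j)) (mollifier_seq n)) g = conv ((deriv ^^ j) (mollifier_seq n)) g'"
    using conv_weak_deriv[OF test_function_deriv[OF \<psi>] g', of j] by (simp add: mult_2 funpow_add)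
  then have "conv (energy_kernel n j) g = (\<lambda>x. (-1) ^ j * conv ((deriv ^^ j) (mollifier_seq n)) g' x)"
    unfolding energy_kernel_def[abs_def] conv_cmult_kernel[abs_def] by simp
  then show ?thesis
    using L2_inner_conv_weak_deriv[OF \<psi> assms(1) has_weak_deriv_L2[OF g'] f']
    by (simp add: L2_inner_cmult_right minus_one_power_mult_self)
qed

lemma L2_inner_energy_kernel_le:
  assumes f: "f \<in> sobolev r" and g: "g \<in> sobolev r" and j: "j \<le> r"
  shows "\<bar>L2_inner f (conv (energy_kernel n j) g)\<bar> \<le> L2_norm (weak_deriv j f) * L2_norm (weak_deriv j g)"
proof -
  note L = sobolev_weak_deriv_L2[OF f j] sobolev_weak_deriv_L2[OF g j]
  have "\<bar>L2_inner f (conv (energy_kernel n j) g)\<bar>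
      \<le> L2_norm (weak_deriv j f) * L2_norm (conv (mollifier_seq n) (weak_deriv j g))"
    unfolding L2_inner_energy_kernel[OF sobolev_L2[OF f] sobolev_weak_deriv[OF f j] sobolev_weak_deriv[OF g j]]
    by (rule L2_Cauchy_Schwarz[OF L(1) conv_L2[OF test_function_mollifier_seq L(2)]])
  also have "\<dots> \<le> L2_norm (weak_deriv j f) * L2_norm (weak_deriv j g)"
    by (rule mult_left_mono[OF mollifier_seq_conv_le[OF L(2)]]) simp
  finally show ?thesis .
qed

text \<open>
  At the top order \<open>m\<close> the pairing involves one derivative more than \<open>a u'\<close> possesses. It is moved to
  the mollifier for the principal part, where the commutator estimate applies, and to the remainder,
  which can afford it.
\<close>

lemma nonlinearity_top_order:
  assumes m: "2 \<le> m"
  shows "\<exists>C\<ge>0. \<forall>a\<in>sobolev m. \<forall>u\<in>sobolev m. \<forall>n.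
    \<bar>L2_inner (\<lambda>x. a x * weak_deriv 1 u x) (conv (energy_kernel n m) u)\<bar>
      \<le> C * (sobolev_norm m a * (sobolev_norm m u)\<^sup>2)"
proof -
  obtain i where i: "m = Suc i" using m by (cases m) auto
  have i': "i < m" "m - i = 1" using i by auto
  obtain C where C: "0 \<le> C" "\<And>a u. a \<in> sobolev m \<Longrightarrow> u \<in> sobolev m \<Longrightarrow> \<exists>R\<in>sobolev 1.
     sobolev_norm 1 R \<le> C * (sobolev_norm m a * sobolev_norm m u) \<and>
     has_weak_deriv i (\<lambda>x. a x * weak_deriv 1 u x) (\<lambda>x. a x * weak_deriv m u x + R x)"
    using nonlinearity_deriv[OF m i'(1)] unfolding i'(2) i[symmetric] by blast
  have mom: "0 \<le> mollifier_moment" unfolding mollifier_moment_def by (rule integral_nonneg_AE) simp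
  show ?thesis
  proof (intro exI[of _ "mollifier_moment + C"] conjI ballI allI)
    show "0 \<le> mollifier_moment + C" using mom C(1) by simp
    fix a u n assume a: "a \<in> sobolev m" and u: "u \<in> sobolev m"
    obtain R where R: "R \<in> sobolev 1" "sobolev_norm 1 R \<le> C * (sobolev_norm m a * sobolev_norm m u)"
      "has_weak_deriv i (\<lambda>x. a x * weak_deriv 1 u x) (\<lambda>x. a x * weak_deriv m u x + R x)"
      using C(2)[OF a u] by blast
    let ?N = "\<lambda>x. a x * weak_deriv 1 u x" and ?v = "weak_deriv m u" and ?\<rho> = "mollifier_seq n"
    note \<psi> = test_function_mollifier_seq[of n]
    have \<psi>': "test_function (deriv ?\<rho>)" using test_function_deriv[OF \<psi>, of 1] by simp
    have NL: "?N \<in> L2" using sobolev_L2[OF nonlinearity_sobolev(1)[OF i'(1) m a u]] .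
    have v: "?v \<in> L2" "has_weak_deriv m u ?v" "L2_norm ?v \<le> sobolev_norm m u"
      using sobolev_weak_deriv_L2[OF u, of m] sobolev_weak_deriv[OF u, of m] L2_norm_weak_deriv_le[of m m u] by auto
    have a2: "a \<in> sobolev 2" and a1: "a \<in> sobolev 1" using sobolev_mono[OF a] m by auto
    have av: "(\<lambda>x. a x * ?v x) \<in> L2"
      using L2_mult_bounded(1)[OF v(1) L2_measurable[OF sobolev_L2[OF a]] sobolev_sup_le[OF a1]]
      by (simp add: mult.commute)
    have R': "R \<in> L2" "weak_deriv 1 R \<in> L2" "has_weak_deriv 1 R (weak_deriv 1 R)"
      "L2_norm (weak_deriv 1 R) \<le> sobolev_norm 1 R"
      using sobolev_L2[OF R(1)] sobolev_weak_deriv_L2[OF R(1)] sobolev_weak_deriv[OF R(1)]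
        L2_norm_weak_deriv_le[of 1 1 R] by auto
    have "2 * m = m + (i + 1)" using i by simp
    then have "(deriv ^^ (2 * m)) ?\<rho> = (deriv ^^ m) ((deriv ^^ i) ((deriv ^^ 1) ?\<rho>))"
      by (simp only: funpow_add comp_apply)
    then have "conv ((deriv ^^ (2 * m)) ?\<rho>) u = conv ((deriv ^^ i) (deriv ?\<rho>)) ?v"
      using conv_weak_deriv[OF test_function_deriv[OF \<psi>'] v(2), of i] by simp
    then have "conv (energy_kernel n m) u = (\<lambda>x. (-1) ^ m * conv ((deriv ^^ i) (deriv ?\<rho>)) ?v x)"
      unfolding energy_kernel_def[abs_def] conv_cmult_kernel[abs_def] by simp
    then have "L2_inner ?N (conv (energy_kernel n m) u)
        = (-1) ^ m * ((-1) ^ i * L2_inner (\<lambda>x. a x * ?v x + R x) (conv (deriv ?\<rho>) ?v))"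
      using L2_inner_conv_weak_deriv[OF \<psi>' NL v(1) R(3)] by (simp add: L2_inner_cmult_right)
    also have "\<dots> = - L2_inner (\<lambda>x. a x * ?v x + R x) (conv (deriv ?\<rho>) ?v)"
      using minus_one_power_mult_self[of i] by (simp add: i)
    also have "\<dots> = - L2_inner (\<lambda>x. a x * ?v x) (conv (deriv ?\<rho>) ?v) - L2_inner R (conv (deriv ?\<rho>) ?v)"
      using L2_inner_add_left[OF av R'(1) conv_L2[OF \<psi>' v(1)]] by simp
    also have "L2_inner R (conv (deriv ?\<rho>) ?v) = - L2_inner (weak_deriv 1 R) (conv ?\<rho> ?v)"
      using L2_inner_conv_weak_deriv[OF \<psi> R'(1) v(1) R'(3)] by simp
    finally have eq: "L2_inner ?N (conv (energy_kernel n m) u)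
        = - L2_inner (\<lambda>x. a x * ?v x) (conv (deriv ?\<rho>) ?v) + L2_inner (weak_deriv 1 R) (conv ?\<rho> ?v)" by simp
    have "\<bar>L2_inner (\<lambda>x. a x * ?v x) (conv (deriv ?\<rho>) ?v)\<bar> \<le> sobolev_norm 2 a * mollifier_moment * (L2_norm ?v)\<^sup>2"
      by (rule skew_form_le[OF v(1) a2])
    also have "\<dots> \<le> sobolev_norm m a * mollifier_moment * (sobolev_norm m u)\<^sup>2"
      using sobolev_norm_mono[OF m, of a] v(3) mom by (intro mult_mono power_mono) auto
    finally have p1: "\<bar>L2_inner (\<lambda>x. a x * ?v x) (conv (deriv ?\<rho>) ?v)\<bar>
        \<le> mollifier_moment * (sobolev_norm m a * (sobolev_norm m u)\<^sup>2)" by (simp add: mult_ac)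
    have "\<bar>L2_inner (weak_deriv 1 R) (conv ?\<rho> ?v)\<bar> \<le> L2_norm (weak_deriv 1 R) * L2_norm (conv ?\<rho> ?v)"
      by (rule L2_Cauchy_Schwarz[OF R'(2) conv_L2[OF \<psi> v(1)]])
    also have "\<dots> \<le> (C * (sobolev_norm m a * sobolev_norm m u)) * sobolev_norm m u"
      using R'(4) R(2) mollifier_seq_conv_le[OF v(1), of n] v(3) C(1) by (intro mult_mono) auto
    finally have p2: "\<bar>L2_inner (weak_deriv 1 R) (conv ?\<rho> ?v)\<bar> \<le> C * (sobolev_norm m a * (sobolev_norm m u)\<^sup>2)"
      by (simp add: power2_eq_square mult_ac)
    show "\<bar>L2_inner ?N (conv (energy_kernel n m) u)\<bar>
        \<le> (mollifier_moment + C) * (sobolev_norm m a * (sobolev_norm m u)\<^sup>2)"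
      unfolding eq distrib_right using p1 p2 by linarith
  qed
qed

lemma nonlinearity_energy_exists:
  assumes m: "2 \<le> m"
  shows "\<exists>C\<ge>0. \<forall>a\<in>sobolev m. \<forall>u\<in>sobolev m. \<forall>n.
    (\<Sum>j\<le>m. \<bar>L2_inner (\<lambda>x. a x * weak_deriv 1 u x) (conv (energy_kernel n j) u)\<bar>)
      \<le> C * (sobolev_norm m a * (sobolev_norm m u)\<^sup>2)"
proof -
  obtain i where i: "m = Suc i" using m by (cases m) auto
  obtain C where C: "0 \<le> C" "\<And>a u n. a \<in> sobolev m \<Longrightarrow> u \<in> sobolev m \<Longrightarrow>
    \<bar>L2_inner (\<lambda>x. a x * weak_deriv 1 u x) (conv (energy_kernel n m) u)\<bar>
      \<le> C * (sobolev_norm m a * (sobolev_norm m u)\<^sup>2)"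
    using nonlinearity_top_order[OF m] by blast
  let ?D = "mult_const i"
  show ?thesis
  proof (intro exI[of _ "real m * ?D + C"] conjI ballI allI)
    show "0 \<le> real m * ?D + C" using C(1) mult_const_nonneg[of i] by simp
    fix a u n assume a: "a \<in> sobolev m" and u: "u \<in> sobolev m"
    let ?N = "\<lambda>x. a x * weak_deriv 1 u x" and ?X = "sobolev_norm m a * (sobolev_norm m u)\<^sup>2"
    have iN: "i < m" and im: "i \<le> m" using i by auto
    note N = nonlinearity_sobolev[OF iN m a u]
    have "\<bar>L2_inner ?N (conv (energy_kernel n j) u)\<bar> \<le> ?D * ?X" if j: "j \<le> i" for j
    proof -
      have "\<bar>L2_inner ?N (conv (energy_kernel n j) u)\<bar> \<le> L2_norm (weak_deriv j ?N) * L2_norm (weak_deriv j u)"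
        by (rule L2_inner_energy_kernel_le[OF N(1) sobolev_mono[OF u im] j])
      also have "\<dots> \<le> (?D * sobolev_norm m a * sobolev_norm m u) * sobolev_norm m u"
        using N(2) L2_norm_weak_deriv_le[OF j, of ?N] L2_norm_weak_deriv_le[of j m u] j i mult_const_nonneg[of i]
        by (intro mult_mono) auto
      finally show ?thesis by (simp add: power2_eq_square mult_ac)
    qed
    then have "(\<Sum>j\<le>i. \<bar>L2_inner ?N (conv (energy_kernel n j) u)\<bar>) \<le> (\<Sum>j\<le>i. ?D * ?X)"
      by (intro sum_mono) auto
    moreover have "(\<Sum>j\<le>i. ?D * ?X) = real m * ?D * ?X" using i by simp
    ultimately have "(\<Sum>j\<le>i. \<bar>L2_inner ?N (conv (energy_kernel n j) u)\<bar>) \<le> real m * ?D * ?X" by linarith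
    moreover have "(\<Sum>j\<le>m. \<bar>L2_inner ?N (conv (energy_kernel n j) u)\<bar>)
        = (\<Sum>j\<le>i. \<bar>L2_inner ?N (conv (energy_kernel n j) u)\<bar>) + \<bar>L2_inner ?N (conv (energy_kernel n m) u)\<bar>"
      unfolding i by simp
    ultimately show "(\<Sum>j\<le>m. \<bar>L2_inner ?N (conv (energy_kernel n j) u)\<bar>) \<le> (real m * ?D + C) * ?X"
      using C(2)[OF a u, of n] by (simp add: distrib_right)
  qed
qed


section \<open>The energy identity\<close>

text \<open>
  The equation is only known when tested against a fixed test function, so a priori nothing is
  differentiable in time uniformly in \<open>x\<close>. The bound on \<open>N\<close> makes the difference quotients of \<open>w\<close>
  bounded functionals on the functions \<open>\<psi> \<star> h\<close>, and this is enough to differentiate the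
  quadratic form.
\<close>

locale linear_dispersive =
  fixes T :: real and w N :: "real \<Rightarrow> real \<Rightarrow> real" and B M :: real
  assumes T: "0 < T"
    and w_L2: "\<And>t. t \<in> {0..T} \<Longrightarrow> w t \<in> L2"
    and w_le: "\<And>t. t \<in> {0..T} \<Longrightarrow> L2_norm (w t) \<le> B"
    and w_cont: "\<And>t. t \<in> {0..T} \<Longrightarrow> ((\<lambda>\<tau>. L2_norm (\<lambda>x. w \<tau> x - w t x)) \<longlongrightarrow> 0) (at t within {0..T})"
    and N_L2: "\<And>t. t \<in> {0<..<T} \<Longrightarrow> N t \<in> L2"
    and N_le: "\<And>t. t \<in> {0<..<T} \<Longrightarrow> L2_norm (N t) \<le> M"
    and eq: "\<And>\<phi> t. test_function \<phi> \<Longrightarrow> t \<in> {0<..<T} \<Longrightarrow>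
      ((\<lambda>\<tau>. L2_inner (w \<tau>) \<phi>) has_real_derivative
        L2_inner (w t) ((deriv ^^ 3) \<phi>) - L2_inner (N t) \<phi>) (at t)"
begin

lemma rhs_le:
  assumes \<psi>: "test_function \<psi>" and h: "h \<in> L2" and t: "t \<in> {0<..<T}"
  shows "\<bar>L2_inner (w t) (conv ((deriv ^^ 3) \<psi>) h) - L2_inner (N t) (conv \<psi> h)\<bar>
    \<le> (B * L1_norm ((deriv ^^ 3) \<psi>) + M * L1_norm \<psi>) * L2_norm h"
proof -
  have t': "t \<in> {0..T}" using t by auto
  have "\<bar>L2_inner (w t) (conv ((deriv ^^ 3) \<psi>) h)\<bar> \<le> L1_norm ((deriv ^^ 3) \<psi>) * (B * L2_norm h)"
    by (rule order_trans[OF L2_inner_conv_le[OF test_function_deriv[OF \<psi>] w_L2[OF t'] h]])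
       (intro mult_left_mono mult_right_mono w_le t' integral_nonneg_AE; simp)
  moreover have "\<bar>L2_inner (N t) (conv \<psi> h)\<bar> \<le> L1_norm \<psi> * (M * L2_norm h)"
    by (rule order_trans[OF L2_inner_conv_le[OF \<psi> N_L2[OF t] h]])
       (intro mult_left_mono mult_right_mono N_le t integral_nonneg_AE; simp)
  moreover have "(B * L1_norm ((deriv ^^ 3) \<psi>) + M * L1_norm \<psi>) * L2_norm h
      = L1_norm ((deriv ^^ 3) \<psi>) * (B * L2_norm h) + L1_norm \<psi> * (M * L2_norm h)"
    by (simp add: algebra_simps)
  ultimately show ?thesis by linarith
qed

text \<open>
  For \<open>h\<close> of compact support \<open>\<psi> \<star> h\<close> is a test function. The general case is a limit of truncations, along
  which the derivatives converge uniformly in time.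
\<close>

lemma DERIV_L2_inner_conv:
  assumes \<psi>: "test_function \<psi>" and h: "h \<in> L2" and t: "t \<in> {0<..<T}"
  shows "((\<lambda>\<tau>. L2_inner (w \<tau>) (conv \<psi> h)) has_real_derivative
    L2_inner (w t) (conv ((deriv ^^ 3) \<psi>) h) - L2_inner (N t) (conv \<psi> h)) (at t)"
proof -
  note \<psi>3 = test_function_deriv[OF \<psi>, of 3]
  define hn where "hn n x = indicator {- real n..real n} x * h x" for n x
  have [measurable]: "h \<in> borel_measurable borel" by (rule L2_measurable[OF h])
  have hn: "hn n \<in> L2" for n
  proof (rule L2_bound[OF h, where C=1])
    show "hn n \<in> borel_measurable borel" unfolding hn_def[abs_def] by measurable
  qed (auto simp: hn_def indicator_def)
  have lim: "(\<lambda>n. L2_norm (\<lambda>x. hn n x - h x)) \<longlonglongrightarrow> 0"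
  proof (rule tendsto_L2_norm_0[OF _ h])
    show "AE x in lborel. (\<lambda>n. hn n x - h x) \<longlonglongrightarrow> 0"
    proof (rule AE_I2)
      fix x :: real
      obtain k where k: "\<bar>x\<bar> \<le> real k" using real_arch_simple by blast
      have "\<forall>\<^sub>F n in sequentially. hn n x - h x = 0"
        using eventually_ge_at_top[of k]
      proof eventually_elim
        case (elim n)
        then have "\<bar>x\<bar> \<le> real n" using k by linarith
        then show ?case by (auto simp: hn_def indicator_def)
      qed
      then show "(\<lambda>n. hn n x - h x) \<longlonglongrightarrow> 0" by (rule tendsto_eventually)
    qed
    show "(\<lambda>x. hn n x - h x) \<in> borel_measurable borel" for n
      by (intro borel_measurable_diff L2_measurable hn h)
  qed (auto simp: hn_def indicator_def)
  define K where "K = B * L1_norm ((deriv ^^ 3) \<psi>) + M * L1_norm \<psi>"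
  let ?g = "\<lambda>h t. L2_inner (w t) (conv ((deriv ^^ 3) \<psi>) h) - L2_inner (N t) (conv \<psi> h)"
  have diff: "L2_inner f (conv \<phi> (\<lambda>x. a x - b x)) = L2_inner f (conv \<phi> a) - L2_inner f (conv \<phi> b)"
    if "test_function \<phi>" "f \<in> L2" "a \<in> L2" "b \<in> L2" for \<phi> f a b
  proof -
    have "conv \<phi> (\<lambda>x. a x - b x) = (\<lambda>x. conv \<phi> a x - conv \<phi> b x)"
      by (intro ext conv_diff that)
    then show ?thesis by (simp add: L2_inner_diff_right conv_L2 that)
  qed
  note gle = rhs_le[OF \<psi>, folded K_def]
  have D: "((\<lambda>\<tau>. L2_inner (w \<tau>) (conv \<psi> (hn n))) has_real_derivative ?g (hn n) \<tau>) (at \<tau>)"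
    if "\<tau> \<in> {0<..<T}" for n \<tau>
  proof -
    have "test_function (conv \<psi> (hn n))"
      by (rule conv_compact_support_test_function[OF \<psi> hn, of "real n"]) (auto simp: hn_def indicator_def)
    from eq[OF this that] show ?thesis by (simp add: conv_funpow_deriv[OF \<psi> hn])
  qed
  have small: "\<forall>\<^sub>F n in sequentially. \<forall>\<tau>\<in>{0<..<T}. \<forall>y. norm (?g (hn n) \<tau> * y - ?g h \<tau> * y) \<le> e * norm y"
    if "e > 0" for e
  proof -
    have "(\<lambda>n. K * L2_norm (\<lambda>x. hn n x - h x)) \<longlonglongrightarrow> K * 0" by (intro tendsto_mult_left lim)
    then have "\<forall>\<^sub>F n in sequentially. K * L2_norm (\<lambda>x. hn n x - h x) < e"
      using that by (intro order_tendstoD(2)[where y="K * 0"]) auto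
    then show ?thesis
    proof eventually_elim
      case (elim n)
      show ?case
      proof (intro ballI allI)
        fix \<tau> y assume \<tau>: "\<tau> \<in> {0<..<T}"
        have \<tau>': "\<tau> \<in> {0..T}" using \<tau> by auto
        have "?g (hn n) \<tau> - ?g h \<tau> = ?g (\<lambda>x. hn n x - h x) \<tau>"
          using diff[OF \<psi>3 w_L2[OF \<tau>'] hn h] diff[OF \<psi> N_L2[OF \<tau>] hn h] by simp
        then have "\<bar>?g (hn n) \<tau> - ?g h \<tau>\<bar> \<le> e"
          using gle[OF L2_diff[OF hn h] \<tau>, of n] elim by simp
        then have "\<bar>?g (hn n) \<tau> - ?g h \<tau>\<bar> * \<bar>y\<bar> \<le> e * \<bar>y\<bar>" by (rule mult_right_mono) simp
        then show "norm (?g (hn n) \<tau> * y - ?g h \<tau> * y) \<le> e * norm y"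
          by (simp flip: abs_mult add: left_diff_distrib)
      qed
    qed
  qed
  have conv: "(\<lambda>n. L2_inner (w \<tau>) (conv \<psi> (hn n))) \<longlonglongrightarrow> L2_inner (w \<tau>) (conv \<psi> h)" if \<tau>: "\<tau> \<in> {0..T}" for \<tau>
  proof -
    let ?c = "L1_norm \<psi> * L2_norm (w \<tau>)"
    have "(\<lambda>n. ?c * L2_norm (\<lambda>x. hn n x - h x)) \<longlonglongrightarrow> ?c * 0" by (intro tendsto_mult_left lim)
    then have l: "(\<lambda>n. ?c * L2_norm (\<lambda>x. hn n x - h x)) \<longlonglongrightarrow> 0" by simp
    have "(\<lambda>n. L2_inner (w \<tau>) (conv \<psi> (hn n)) - L2_inner (w \<tau>) (conv \<psi> h)) \<longlonglongrightarrow> 0"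
    proof (rule Lim_null_comparison[OF always_eventually l], rule allI)
      fix n
      show "norm (L2_inner (w \<tau>) (conv \<psi> (hn n)) - L2_inner (w \<tau>) (conv \<psi> h)) \<le> ?c * L2_norm (\<lambda>x. hn n x - h x)"
        using L2_inner_conv_le[OF \<psi> w_L2[OF \<tau>] L2_diff[OF hn[of n] h]]
        unfolding diff[OF \<psi> w_L2[OF \<tau>] hn[of n] h] by (simp add: mult.assoc)
    qed
    then show ?thesis by (rule LIM_zero_cancel)
  qed
  have "\<exists>g. \<forall>\<tau>\<in>{0<..<T}. (\<lambda>n. L2_inner (w \<tau>) (conv \<psi> (hn n))) \<longlonglongrightarrow> g \<tau> \<and>
      (g has_derivative (\<lambda>y. ?g h \<tau> * y)) (at \<tau> within {0<..<T})"
  proof (rule has_derivative_sequence[OF _ _ small])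
    show "((\<lambda>\<tau>. L2_inner (w \<tau>) (conv \<psi> (hn n))) has_derivative (\<lambda>y. ?g (hn n) \<tau> * y)) (at \<tau> within {0<..<T})"
      if "\<tau> \<in> {0<..<T}" for n \<tau>
      using D[OF that, of n] has_derivative_at_withinI unfolding has_field_derivative_def by blast
    show "t \<in> {0<..<T}" by fact
    show "(\<lambda>n. L2_inner (w t) (conv \<psi> (hn n))) \<longlonglongrightarrow> L2_inner (w t) (conv \<psi> h)"
      using conv[of t] t by auto
  qed auto
  then obtain g where g: "\<And>\<tau>. \<tau> \<in> {0<..<T} \<Longrightarrow> (\<lambda>n. L2_inner (w \<tau>) (conv \<psi> (hn n))) \<longlonglongrightarrow> g \<tau>"
    "\<And>\<tau>. \<tau> \<in> {0<..<T} \<Longrightarrow> (g has_derivative (\<lambda>y. ?g h \<tau> * y)) (at \<tau> within {0<..<T})" by blast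
  have "g \<tau> = L2_inner (w \<tau>) (conv \<psi> h)" if "\<tau> \<in> {0<..<T}" for \<tau>
    using LIMSEQ_unique[OF g(1)[OF that] conv] that by auto
  moreover have "(g has_real_derivative ?g h t) (at t within {0<..<T})"
    using g(2)[OF t] by (simp add: has_field_derivative_def)
  ultimately have "((\<lambda>\<tau>. L2_inner (w \<tau>) (conv \<psi> h)) has_real_derivative ?g h t) (at t within {0<..<T})"
    using has_field_derivative_transform_within[where d=1, OF _ _ t] by force
  then show ?thesis using t by (simp add: at_within_open[OF t])
qed

lemma L2_inner_conv_tendsto:
  assumes \<psi>: "test_function \<psi>" and t: "t \<in> {0..T}"
  shows "((\<lambda>\<tau>. L2_inner (w \<tau>) (conv \<psi> (w \<tau>))) \<longlongrightarrow> L2_inner (w t) (conv \<psi> (w t))) (at t within {0..T})"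
proof -
  let ?c = "L1_norm \<psi> * B"
  have c: "0 \<le> L1_norm \<psi>" by (rule integral_nonneg_AE) simp
  have "((\<lambda>\<tau>. 2 * ?c * L2_norm (\<lambda>x. w \<tau> x - w t x)) \<longlongrightarrow> 2 * ?c * 0) (at t within {0..T})"
    by (intro tendsto_mult_left w_cont t)
  then have l: "((\<lambda>\<tau>. 2 * ?c * L2_norm (\<lambda>x. w \<tau> x - w t x)) \<longlongrightarrow> 0) (at t within {0..T})" by simp
  have "((\<lambda>\<tau>. L2_inner (w \<tau>) (conv \<psi> (w \<tau>)) - L2_inner (w t) (conv \<psi> (w t))) \<longlongrightarrow> 0) (at t within {0..T})"
  proof (rule Lim_null_comparison[OF _ l])
    have "norm (L2_inner (w \<tau>) (conv \<psi> (w \<tau>)) - L2_inner (w t) (conv \<psi> (w t)))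
        \<le> 2 * ?c * L2_norm (\<lambda>x. w \<tau> x - w t x)" if \<tau>: "\<tau> \<in> {0..T}" for \<tau>
    proof -
      note L = w_L2[OF \<tau>] w_L2[OF t]
      let ?d = "\<lambda>x. w \<tau> x - w t x"
      note d = L2_diff[OF L]
      have "conv \<psi> ?d = (\<lambda>x. conv \<psi> (w \<tau>) x - conv \<psi> (w t) x)" by (intro ext conv_diff[OF \<psi> L])
      then have "L2_inner (w \<tau>) (conv \<psi> (w \<tau>)) - L2_inner (w t) (conv \<psi> (w t))
          = L2_inner (w \<tau>) (conv \<psi> ?d) + L2_inner ?d (conv \<psi> (w t))"
        using L conv_L2[OF \<psi>] by (simp add: L2_inner_diff_right L2_inner_diff_left)
      moreover have "\<bar>L2_inner (w \<tau>) (conv \<psi> ?d)\<bar> \<le> ?c * L2_norm ?d"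
        using L2_inner_conv_le[OF \<psi> L(1) d] mult_left_mono[OF mult_right_mono[OF w_le[OF \<tau>], of "L2_norm ?d"] c]
        by (simp add: mult.assoc)
      moreover have "\<bar>L2_inner ?d (conv \<psi> (w t))\<bar> \<le> ?c * L2_norm ?d"
        using L2_inner_conv_le[OF \<psi> d L(2)] mult_left_mono[OF mult_right_mono[OF w_le[OF t], of "L2_norm ?d"] c]
        by (simp add: mult_ac)
      ultimately show ?thesis unfolding real_norm_def by linarith
    qed
    then show "\<forall>\<^sub>F \<tau> in at t within {0..T}. norm (L2_inner (w \<tau>) (conv \<psi> (w \<tau>)) - L2_inner (w t) (conv \<psi> (w t)))
        \<le> 2 * ?c * L2_norm (\<lambda>x. w \<tau> x - w t x)"
      by (auto simp: eventually_at_filter)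
  qed
  then show ?thesis by (rule LIM_zero_cancel)
qed

text \<open>
  By symmetry \<open>E(\<tau>) - E(t) = 2 \<langle>d, \<psi> \<star> w(t)\<rangle> + \<langle>d, \<psi> \<star> d\<rangle>\<close> with \<open>d = w(\<tau>) - w(t)\<close>. The first term is
  differentiable with the function \<open>w(t)\<close> fixed, and the second is \<open>O(\<bar>\<tau> - t\<bar> \<parallel>d\<parallel>)\<close> because \<open>d\<close> is Lipschitz
  as a functional. The dispersive term drops out since \<open>\<psi>'''\<close> is odd when \<open>\<psi>\<close> is even.
\<close>

lemma energy_identity:
  assumes \<psi>: "test_function \<psi>" and even: "\<And>x. \<psi> (- x) = \<psi> x" and t: "t \<in> {0<..<T}"
  shows "((\<lambda>\<tau>. L2_inner (w \<tau>) (conv \<psi> (w \<tau>))) has_real_derivative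
    - 2 * L2_inner (N t) (conv \<psi> (w t))) (at t)"
proof -
  note \<psi>3 = test_function_deriv[OF \<psi>, of 3]
  have t': "t \<in> {0..T}" using t by auto
  note wt = w_L2[OF t']
  have sym: "L2_inner f (conv \<psi> g) = L2_inner g (conv \<psi> f)" if "f \<in> L2" "g \<in> L2" for f g
    using conv_adjoint[OF \<psi> that] even by (simp add: L2_inner_commute)
  have "L2_inner (w t) (conv ((deriv ^^ 3) \<psi>) (w t)) = L2_inner (conv (\<lambda>z. -1 * (deriv ^^ 3) \<psi> z) (w t)) (w t)"
    using conv_adjoint[OF \<psi>3 wt wt] funpow_deriv_parity[OF test_function_smooth[OF \<psi>] even, of 3] by simp
  also have "\<dots> = - L2_inner (w t) (conv ((deriv ^^ 3) \<psi>) (w t))"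
    unfolding conv_cmult_kernel[abs_def] L2_inner_cmult_left by (simp add: L2_inner_commute)
  finally have odd: "L2_inner (w t) (conv ((deriv ^^ 3) \<psi>) (w t)) = 0" by simp
  let ?E = "\<lambda>\<tau>. L2_inner (w \<tau>) (conv \<psi> (w \<tau>))" and ?d = "\<lambda>\<tau> x. w \<tau> x - w t x"
  define K where "K = B * L1_norm ((deriv ^^ 3) \<psi>) + M * L1_norm \<psi>"
  have Lip: "\<bar>L2_inner (?d \<tau>) (conv \<psi> h)\<bar> \<le> K * L2_norm h * \<bar>\<tau> - t\<bar>"
    if h: "h \<in> L2" and \<tau>: "\<tau> \<in> {0<..<T}" for \<tau> h
  proof -
    have "norm (L2_inner (w \<tau>) (conv \<psi> h) - L2_inner (w t) (conv \<psi> h)) \<le> (K * L2_norm h) * norm (\<tau> - t)"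
    proof (rule field_differentiable_bound[OF convex_real_interval(8)[of 0 T]])
      fix s assume s: "s \<in> {0<..<T}"
      show "((\<lambda>\<tau>. L2_inner (w \<tau>) (conv \<psi> h)) has_real_derivative
          L2_inner (w s) (conv ((deriv ^^ 3) \<psi>) h) - L2_inner (N s) (conv \<psi> h)) (at s within {0<..<T})"
        by (rule has_field_derivative_at_within[OF DERIV_L2_inner_conv[OF \<psi> h s]])
      show "norm (L2_inner (w s) (conv ((deriv ^^ 3) \<psi>) h) - L2_inner (N s) (conv \<psi> h)) \<le> K * L2_norm h"
        using rhs_le[OF \<psi> h s] by (simp add: K_def)
    qed (use \<tau> t in auto)
    moreover have "\<tau> \<in> {0..T}" using \<tau> by auto
    ultimately show ?thesis using L2_inner_diff_left[OF w_L2 wt conv_L2[OF \<psi> h]] by simp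
  qed
  have near: "\<forall>\<^sub>F \<tau> in at t. \<tau> \<in> {0<..<T} \<and> \<tau> \<noteq> t"
    using eventually_at_in_open[of "{0<..<T}" t] t by (auto elim!: eventually_mono)
  have wlim: "((\<lambda>\<tau>. L2_norm (?d \<tau>)) \<longlongrightarrow> 0) (at t)"
  proof -
    have "at t within {0..T} = at t" using t by (intro at_within_interior) auto
    then show ?thesis using w_cont[OF t'] by simp
  qed
  have rest: "((\<lambda>\<tau>. L2_inner (?d \<tau>) (conv \<psi> (?d \<tau>)) / (\<tau> - t)) \<longlongrightarrow> 0) (at t)"
  proof (rule Lim_null_comparison)
    show "\<forall>\<^sub>F \<tau> in at t. norm (L2_inner (?d \<tau>) (conv \<psi> (?d \<tau>)) / (\<tau> - t)) \<le> K * L2_norm (?d \<tau>)"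
      using near
    proof eventually_elim
      case (elim \<tau>)
      then have "?d \<tau> \<in> L2" using w_L2[of \<tau>] wt by auto
      from Lip[OF this] elim show ?case by (simp add: abs_divide divide_le_eq)
    qed
    have "((\<lambda>\<tau>. K * L2_norm (?d \<tau>)) \<longlongrightarrow> K * 0) (at t)" by (intro tendsto_mult_left wlim)
    then show "((\<lambda>\<tau>. K * L2_norm (?d \<tau>)) \<longlongrightarrow> 0) (at t)" by simp
  qed
  have "((\<lambda>\<tau>. (L2_inner (w \<tau>) (conv \<psi> (w t)) - L2_inner (w t) (conv \<psi> (w t))) / (\<tau> - t)) \<longlongrightarrow> - L2_inner (N t) (conv \<psi> (w t))) (at t)"
    using DERIV_L2_inner_conv[OF \<psi> wt t] odd by (simp add: has_field_derivative_iff)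
  from tendsto_add[OF tendsto_mult_left[OF this, of 2] rest]
  have "((\<lambda>\<tau>. 2 * ((L2_inner (w \<tau>) (conv \<psi> (w t)) - L2_inner (w t) (conv \<psi> (w t))) / (\<tau> - t))
      + L2_inner (?d \<tau>) (conv \<psi> (?d \<tau>)) / (\<tau> - t)) \<longlongrightarrow> - 2 * L2_inner (N t) (conv \<psi> (w t))) (at t)"
    by simp
  moreover have "\<forall>\<^sub>F \<tau> in at t. 2 * ((L2_inner (w \<tau>) (conv \<psi> (w t)) - L2_inner (w t) (conv \<psi> (w t))) / (\<tau> - t))
      + L2_inner (?d \<tau>) (conv \<psi> (?d \<tau>)) / (\<tau> - t) = (?E \<tau> - ?E t) / (\<tau> - t)"
    using near
  proof eventually_elim
    case (elim \<tau>)
    then have w\<tau>: "w \<tau> \<in> L2" using w_L2[of \<tau>] by auto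
    note L = w\<tau> wt conv_L2[OF \<psi> w\<tau>] conv_L2[OF \<psi> wt]
    have "conv \<psi> (?d \<tau>) = (\<lambda>x. conv \<psi> (w \<tau>) x - conv \<psi> (w t) x)" by (intro ext conv_diff[OF \<psi> w\<tau> wt])
    then have "L2_inner (?d \<tau>) (conv \<psi> (?d \<tau>))
        = ?E \<tau> - L2_inner (w \<tau>) (conv \<psi> (w t)) - (L2_inner (w t) (conv \<psi> (w \<tau>)) - ?E t)"
      using L by (simp add: L2_inner_diff_left L2_inner_diff_right L2_diff)
    also have "L2_inner (w t) (conv \<psi> (w \<tau>)) = L2_inner (w \<tau>) (conv \<psi> (w t))" by (rule sym[OF wt w\<tau>])
    finally have "2 * (L2_inner (w \<tau>) (conv \<psi> (w t)) - ?E t) + L2_inner (?d \<tau>) (conv \<psi> (?d \<tau>)) = ?E \<tau> - ?E t"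
      by simp
    then show ?case by (metis add_divide_distrib times_divide_eq_right)
  qed
  ultimately have "((\<lambda>\<tau>. (?E \<tau> - ?E t) / (\<tau> - t)) \<longlongrightarrow> - 2 * L2_inner (N t) (conv \<psi> (w t))) (at t)"
    by (rule Lim_transform_eventually)
  then show ?thesis by (simp add: has_field_derivative_iff)
qed

text \<open>
  The energies of order \<open>j \<le> r\<close> are mollified, estimated on \<open>[0, \<tau>]\<close> by the mean value theorem, and
  then the mollification is removed. The bound \<open>K\<close> must not depend on the mollification.
\<close>

lemma energy_estimate:
  assumes \<tau>: "\<tau> \<in> {0..T}" and s: "\<And>t. t \<in> {0, \<tau>} \<Longrightarrow> w t \<in> sobolev r"
    and K: "\<And>t n. t \<in> {0<..<\<tau>} \<Longrightarrow> (\<Sum>j\<le>r. \<bar>L2_inner (N t) (conv (energy_kernel n j) (w t))\<bar>) \<le> K"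
  shows "(sobolev_norm r (w \<tau>))\<^sup>2 \<le> (sobolev_norm r (w 0))\<^sup>2 + 2 * \<tau> * K"
proof (cases "\<tau> = 0")
  case False
  then have \<tau>0: "0 < \<tau>" and \<tau>T: "\<tau> \<le> T" using \<tau> by auto
  let ?E = "\<lambda>n t. \<Sum>j\<le>r. L2_inner (w t) (conv (energy_kernel n j) (w t))"
  let ?E' = "\<lambda>n t. \<Sum>j\<le>r. - 2 * L2_inner (N t) (conv (energy_kernel n j) (w t))"
  have E: "?E n t = (\<Sum>j\<le>r. L2_inner (weak_deriv j (w t)) (conv (mollifier_seq n) (weak_deriv j (w t))))"
    if "t \<in> {0, \<tau>}" for n t
    by (rule sum.cong[OF refl], rule L2_inner_energy_kernel)
       (use s[OF that] in \<open>auto intro: sobolev_L2 sobolev_weak_deriv\<close>)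
  have step: "?E n \<tau> \<le> ?E n 0 + 2 * \<tau> * K" for n
  proof -
    have cont: "continuous_on {0..\<tau>} (?E n)"
    proof (intro continuous_on_sum)
      fix j
      have "continuous_on {0..T} (\<lambda>t. L2_inner (w t) (conv (energy_kernel n j) (w t)))"
        unfolding continuous_on_def using L2_inner_conv_tendsto[OF test_function_energy_kernel] by blast
      then show "continuous_on {0..\<tau>} (\<lambda>t. L2_inner (w t) (conv (energy_kernel n j) (w t)))"
        by (rule continuous_on_subset) (use \<tau>T in auto)
    qed
    have d: "(?E n has_real_derivative ?E' n t) (at t)" if "t \<in> {0<..<\<tau>}" for t
      by (intro DERIV_sum energy_identity test_function_energy_kernel energy_kernel_even) (use that \<tau>T in auto)
    obtain t where t: "t \<in> {0<..<\<tau>}" "?E n \<tau> - ?E n 0 = (\<tau> - 0) * ?E' n t"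
    proof -
      have "?E n differentiable (at t)" if "0 < t" "t < \<tau>" for t
        using d[of t] that unfolding real_differentiable_def by auto
      from MVT[OF \<tau>0 cont this] obtain l z where z: "0 < z" "z < \<tau>"
        "(?E n has_real_derivative l) (at z)" "?E n \<tau> - ?E n 0 = (\<tau> - 0) * l" by blast
      have "l = ?E' n z" by (rule DERIV_unique[OF z(3) d]) (use z in auto)
      then show thesis using z by (intro that[of z]) auto
    qed
    have "?E' n t \<le> (\<Sum>j\<le>r. 2 * \<bar>L2_inner (N t) (conv (energy_kernel n j) (w t))\<bar>)"
      by (rule sum_mono) (simp add: abs_if)
    also have "\<dots> \<le> 2 * K" using K[OF t(1), of n] by (simp flip: sum_distrib_left)
    finally have "\<tau> * ?E' n t \<le> \<tau> * (2 * K)" using \<tau>0 by (intro mult_left_mono) auto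
    then show ?thesis using t(2) by simp
  qed
  have lim: "(\<lambda>n. ?E n t) \<longlonglongrightarrow> (sobolev_norm r (w t))\<^sup>2" if t: "t \<in> {0, \<tau>}" for t
  proof -
    have "(\<lambda>n. ?E n t) \<longlonglongrightarrow> (\<Sum>j\<le>r. L2_inner (weak_deriv j (w t)) (weak_deriv j (w t)))"
      unfolding E[OF t] using sobolev_weak_deriv_L2[OF s[OF t]] by (intro tendsto_sum mollifier_tendsto) auto
    then show ?thesis by (simp add: sobolev_norm_square L2_norm_square_inner)
  qed
  show ?thesis
    by (rule LIMSEQ_le[OF lim[of \<tau>] tendsto_add[OF lim[of 0] tendsto_const]]) (use step in auto)
qed simp

end


section \<open>A priori bounds for solutions\<close>

lemma continuous_in_sobolev_norm:
  assumes u: "continuous_in_sobolev m T u" and r: "r \<le> m"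
  shows "continuous_on {0..T} (\<lambda>t. sobolev_norm r (u t))"
  unfolding continuous_on_def
proof (intro ballI)
  fix t assume t: "t \<in> {0..T}"
  have s: "u \<tau> \<in> sobolev r" if "\<tau> \<in> {0..T}" for \<tau>
    using u that sobolev_mono[OF _ r] by (auto simp: continuous_in_sobolev_def)
  have l: "((\<lambda>\<tau>. sobolev_norm m (\<lambda>x. u \<tau> x - u t x)) \<longlongrightarrow> 0) (at t within {0..T})"
    using u t by (auto simp: continuous_in_sobolev_def)
  have "((\<lambda>\<tau>. sobolev_norm r (u \<tau>) - sobolev_norm r (u t)) \<longlongrightarrow> 0) (at t within {0..T})"
  proof (rule Lim_null_comparison[OF _ l])
    have "norm (sobolev_norm r (u \<tau>) - sobolev_norm r (u t)) \<le> sobolev_norm m (\<lambda>x. u \<tau> x - u t x)"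
      if \<tau>: "\<tau> \<in> {0..T}" for \<tau>
    proof -
      note d = sobolev_diff(1)[OF s[OF \<tau>] s[OF t]] and d' = sobolev_diff(1)[OF s[OF t] s[OF \<tau>]]
      have "sobolev_norm r (u \<tau>) \<le> sobolev_norm r (\<lambda>x. u \<tau> x - u t x) + sobolev_norm r (u t)"
        using sobolev_add(2)[OF d s[OF t]] by simp
      moreover have "sobolev_norm r (u t) \<le> sobolev_norm r (\<lambda>x. u t x - u \<tau> x) + sobolev_norm r (u \<tau>)"
        using sobolev_add(2)[OF d' s[OF \<tau>]] by simp
      moreover have "sobolev_norm r (\<lambda>x. u t x - u \<tau> x) = sobolev_norm r (\<lambda>x. u \<tau> x - u t x)"
        using sobolev_cmult(2)[OF d, of "-1"] by simp
      ultimately show ?thesis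
        using sobolev_norm_mono[OF r, of "\<lambda>x. u \<tau> x - u t x"] unfolding real_norm_def by linarith
    qed
    then show "\<forall>\<^sub>F \<tau> in at t within {0..T}. norm (sobolev_norm r (u \<tau>) - sobolev_norm r (u t))
        \<le> sobolev_norm m (\<lambda>x. u \<tau> x - u t x)"
      by (auto simp: eventually_at_filter)
  qed
  then show "((\<lambda>\<tau>. sobolev_norm r (u \<tau>)) \<longlongrightarrow> sobolev_norm r (u t)) (at t within {0..T})"
    by (rule LIM_zero_cancel)
qed

definition nonlinearity :: "real poly \<Rightarrow> (real \<Rightarrow> real) \<Rightarrow> real \<Rightarrow> real" where
  "nonlinearity F v x = poly F (v x) * weak_deriv 1 v x"

lemma nonlinearity_le:
  assumes m: "r < m" "2 \<le> m" and F: "poly F 0 = 0" "1 \<le> degree F"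
    and v: "v \<in> sobolev m" "sobolev_norm m v \<le> b"
  shows "nonlinearity F v \<in> sobolev r"
    and "sobolev_norm r (nonlinearity F v) \<le> mult_const r * poly_const m (degree F) * (growth F b * b)"
proof -
  have m1: "1 \<le> m" using m by simp
  note p = sobolev_poly[OF m1 v(1) F]
  have pc: "0 \<le> poly_const m (degree F)" using mult_const_nonneg[of m] by (simp add: poly_const_def)
  have b: "0 \<le> b" using v(2) sobolev_norm_nonneg[of m v] by linarith
  note g = growth_mono[OF F(2) sobolev_norm_nonneg v(2)] growth_nonneg[OF F(2) b]
  have eq: "nonlinearity F v = (\<lambda>x. poly F (v x) * weak_deriv 1 v x)"
    by (simp add: nonlinearity_def[abs_def])
  note n = nonlinearity_sobolev[OF m p(1) v(1), folded eq]
  show "nonlinearity F v \<in> sobolev r" by (rule n(1))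
  have "sobolev_norm m (\<lambda>x. poly F (v x)) \<le> poly_const m (degree F) * growth F b"
    using p(2) mult_left_mono[OF g(1) pc] by linarith
  then have "sobolev_norm m (\<lambda>x. poly F (v x)) * sobolev_norm m v \<le> (poly_const m (degree F) * growth F b) * b"
    using v(2) pc g(2) by (intro mult_mono) auto
  then have "mult_const r * (sobolev_norm m (\<lambda>x. poly F (v x)) * sobolev_norm m v)
      \<le> mult_const r * ((poly_const m (degree F) * growth F b) * b)"
    by (rule mult_left_mono[OF _ mult_const_nonneg])
  then show "sobolev_norm r (nonlinearity F v) \<le> mult_const r * poly_const m (degree F) * (growth F b * b)"
    using n(2) by (simp add: mult_ac)
qed

lemma gkdv_solution_sobolev: "gkdv_solution m F T u0 u \<Longrightarrow> t \<in> {0..T} \<Longrightarrow> u t \<in> sobolev m"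
  by (auto simp: gkdv_solution_def continuous_in_sobolev_def)

lemma gkdv_solution_initial_norm:
  assumes "gkdv_solution m F T u0 u" "u0 \<in> sobolev m" "0 \<le> T"
  shows "sobolev_norm r (u 0) = sobolev_norm r u0"
proof (rule sobolev_norm_cong_AE)
  show "AE x in lborel. u 0 x = u0 x" using assms(1) by (simp add: gkdv_solution_def)
  show "u 0 \<in> L2" by (rule sobolev_L2[OF gkdv_solution_sobolev[OF assms(1)]]) (use assms(3) in auto)
  show "u0 \<in> L2" by (rule sobolev_L2[OF assms(2)])
qed

lemma gkdv_linear_dispersive:
  assumes sol: "gkdv_solution m (poly F) T u0 u" and m: "2 \<le> m" and T: "0 < T"
    and F: "poly F 0 = 0" "1 \<le> degree F"
  shows "\<exists>B M. linear_dispersive T u (\<lambda>t. nonlinearity F (u t)) B M"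
proof -
  have c: "continuous_in_sobolev m T u" using sol by (simp add: gkdv_solution_def)
  note s = gkdv_solution_sobolev[OF sol]
  have "compact ((\<lambda>t. sobolev_norm m (u t)) ` {0..T})"
    by (intro compact_continuous_image continuous_in_sobolev_norm[OF c]) auto
  then obtain B where "\<forall>y\<in>(\<lambda>t. sobolev_norm m (u t)) ` {0..T}. norm y \<le> B"
    using compact_imp_bounded bounded_iff by blast
  then have B: "sobolev_norm m (u t) \<le> B" if "t \<in> {0..T}" for t using that by auto
  have m0: "0 < m" using m by simp
  note n = nonlinearity_le[OF m0 m F s B]
  define M where "M = mult_const 0 * poly_const m (degree F) * (growth F B * B)"
  have "linear_dispersive T u (\<lambda>t. nonlinearity F (u t)) B M"
  proof
    show "0 < T" by fact
    show "u t \<in> L2" if "t \<in> {0..T}" for t by (rule sobolev_L2[OF s[OF that]])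
    show "L2_norm (u t) \<le> B" if "t \<in> {0..T}" for t
      using L2_norm_le_sobolev_norm[OF sobolev_L2[OF s[OF that]], of m] B[OF that] by linarith
    show "((\<lambda>\<tau>. L2_norm (\<lambda>x. u \<tau> x - u t x)) \<longlongrightarrow> 0) (at t within {0..T})" if t: "t \<in> {0..T}" for t
    proof (rule Lim_null_comparison)
      show "((\<lambda>\<tau>. sobolev_norm m (\<lambda>x. u \<tau> x - u t x)) \<longlongrightarrow> 0) (at t within {0..T})"
        using c t by (auto simp: continuous_in_sobolev_def)
      have "norm (L2_norm (\<lambda>x. u \<tau> x - u t x)) \<le> sobolev_norm m (\<lambda>x. u \<tau> x - u t x)" if "\<tau> \<in> {0..T}" for \<tau>
        using L2_norm_le_sobolev_norm[OF L2_diff[OF sobolev_L2[OF s[OF that]] sobolev_L2[OF s[OF t]]], of m] by simp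
      then show "\<forall>\<^sub>F \<tau> in at t within {0..T}. norm (L2_norm (\<lambda>x. u \<tau> x - u t x)) \<le> sobolev_norm m (\<lambda>x. u \<tau> x - u t x)"
        by (auto simp: eventually_at_filter)
    qed
    show "nonlinearity F (u t) \<in> L2" if "t \<in> {0<..<T}" for t
      using n(1)[of t] that by (simp add: sobolev_0)
    show "L2_norm (nonlinearity F (u t)) \<le> M" if "t \<in> {0<..<T}" for t
      using n[of t] that by (simp add: sobolev_0 sobolev_norm_0 M_def)
    show "((\<lambda>\<tau>. L2_inner (u \<tau>) \<phi>) has_real_derivative
        L2_inner (u t) ((deriv ^^ 3) \<phi>) - L2_inner (nonlinearity F (u t)) \<phi>) (at t)"
      if "test_function \<phi>" "t \<in> {0<..<T}" for \<phi> t
      using sol that unfolding gkdv_solution_def L2_inner_def nonlinearity_def by blast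
  qed
  then show ?thesis by blast
qed

definition energy_const :: "nat \<Rightarrow> real" where
  "energy_const m = (SOME C. C \<ge> 0 \<and> (\<forall>a\<in>sobolev m. \<forall>u\<in>sobolev m. \<forall>n.
    (\<Sum>j\<le>m. \<bar>L2_inner (\<lambda>x. a x * weak_deriv 1 u x) (conv (energy_kernel n j) u)\<bar>)
      \<le> C * (sobolev_norm m a * (sobolev_norm m u)\<^sup>2)))"

lemma energy_const:
  assumes "2 \<le> m"
  shows energy_const_nonneg: "0 \<le> energy_const m"
    and energy_const_le: "a \<in> sobolev m \<Longrightarrow> u \<in> sobolev m \<Longrightarrow>
      (\<Sum>j\<le>m. \<bar>L2_inner (\<lambda>x. a x * weak_deriv 1 u x) (conv (energy_kernel n j) u)\<bar>)
        \<le> energy_const m * (sobolev_norm m a * (sobolev_norm m u)\<^sup>2)"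
  using someI_ex[OF nonlinearity_energy_exists[OF assms]] unfolding energy_const_def by blast+

text \<open>
  The factor \<open>2 ^ k\<close> accounts for \<open>growth F (2 R) \<le> 2 ^ k * growth F R\<close>, and the remaining
  numerical factors are chosen such that an \<open>H\<^sup>m\<close> norm below \<open>2 R\<close> stays strictly below \<open>2 R\<close>.
\<close>

definition lifespan_const :: "nat \<Rightarrow> nat \<Rightarrow> real" where
  "lifespan_const m k = 1 / (16 * 2 ^ k * (energy_const m * poly_const m k + 1))"

lemma lifespan_const_pos:
  assumes "2 \<le> m" shows "0 < lifespan_const m k"
proof -
  have "0 \<le> energy_const m * poly_const m k"
    using energy_const_nonneg[OF assms] mult_const_nonneg[of m] by (simp add: poly_const_def)
  then show ?thesis by (simp add: lifespan_const_def)
qed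

lemma growth_double:
  assumes "1 \<le> degree F" "0 \<le> R" shows "growth F (2 * R) \<le> 2 ^ degree F * growth F R"
proof -
  have "(\<Sum>j=1..degree F. (2 * R) ^ j) \<le> (\<Sum>j=1..degree F. 2 ^ degree F * R ^ j)"
    using assms(2) by (intro sum_mono) (auto simp: power_mult_distrib intro!: mult_right_mono power_increasing)
  then have "coeff_bound F * (\<Sum>j=1..degree F. (2 * R) ^ j) \<le> coeff_bound F * (\<Sum>j=1..degree F. 2 ^ degree F * R ^ j)"
    using coeff_bound_pos[OF assms(1)] by (intro mult_left_mono) auto
  also have "\<dots> = 2 ^ degree F * growth F R" by (simp add: growth_def sum_distrib_left mult_ac)
  finally show ?thesis by (simp add: growth_def)
qed

text \<open>
  A bootstrap: up to the first time at which the norm reaches \<open>2 R\<close> the energy estimate applies with this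
  bound, and it yields \<open>2 R\<^sup>2\<close> for the squared norm.
\<close>

lemma gkdv_norm_less:
  assumes sol: "gkdv_solution m (poly F) T u0 u" and m: "2 \<le> m" and T: "0 < T"
    and F: "poly F 0 = 0" "1 \<le> degree F"
    and R: "0 < R" "sobolev_norm m (u 0) \<le> R" and small: "T * growth F R \<le> 2 * lifespan_const m (degree F)"
    and t: "t \<in> {0..T}"
  shows "sobolev_norm m (u t) < 2 * R"
proof (rule ccontr)
  assume neg: "\<not> ?thesis"
  define S where "S = {\<tau> \<in> {0..T}. 2 * R \<le> sobolev_norm m (u \<tau>)}"
  have c: "continuous_on {0..T} (\<lambda>t. sobolev_norm m (u t))"
    using sol by (intro continuous_in_sobolev_norm[of m]) (auto simp: gkdv_solution_def)
  have "S = {0..T} \<inter> (\<lambda>t. sobolev_norm m (u t)) -` {2 * R..}" by (auto simp: S_def)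
  then have "closed S" using continuous_closed_preimage[OF c, of "{2 * R..}"] by simp
  moreover have "bounded S" by (rule bounded_subset[of "{0..T}"]) (auto simp: S_def)
  ultimately have "compact S" by (simp add: compact_eq_bounded_closed)
  moreover have "S \<noteq> {}" using t neg by (auto simp: S_def)
  \<comment> \<open>The first time at which the norm reaches \<open>2 R\<close>.\<close>
  ultimately obtain \<tau> where \<tau>: "\<tau> \<in> S" "\<And>t. t \<in> S \<Longrightarrow> \<tau> \<le> t"
    using compact_attains_inf[of S] by blast
  have \<tau>T: "\<tau> \<in> {0..T}" and \<tau>R: "2 * R \<le> sobolev_norm m (u \<tau>)" using \<tau>(1) by (auto simp: S_def)
  have less: "sobolev_norm m (u t) \<le> 2 * R" if "t \<in> {0<..<\<tau>}" for t
    using \<tau>(2)[of t] that \<tau>T by (force simp: S_def)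
  obtain B M where "linear_dispersive T u (\<lambda>t. nonlinearity F (u t)) B M"
    using gkdv_linear_dispersive[OF sol m T F] by blast
  then interpret linear_dispersive T u "\<lambda>t. nonlinearity F (u t)" B M .
  let ?C = "energy_const m * poly_const m (degree F)"
  note s = gkdv_solution_sobolev[OF sol]
  have m1: "1 \<le> m" using m by simp
  have pc: "0 \<le> poly_const m (degree F)" using mult_const_nonneg[of m] by (simp add: poly_const_def)
  have C: "0 \<le> ?C" using pc energy_const_nonneg[OF m] by simp
  have g: "0 \<le> growth F R" using growth_nonneg[OF F(2)] R(1) by simp
  have "(sobolev_norm m (u \<tau>))\<^sup>2 \<le> (sobolev_norm m (u 0))\<^sup>2 + 2 * \<tau> * (?C * (growth F (2 * R) * (2 * R)\<^sup>2))"
  proof (rule energy_estimate[OF \<tau>T])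
    show "u t \<in> sobolev m" if "t \<in> {0, \<tau>}" for t using s[of t] that T \<tau>T by auto
    fix t n assume t: "t \<in> {0<..<\<tau>}"
    then have tT: "t \<in> {0..T}" using \<tau>T by auto
    note p = sobolev_poly[OF m1 s[OF tT] F]
    have "sobolev_norm m (\<lambda>x. poly F (u t x)) \<le> poly_const m (degree F) * growth F (2 * R)"
      using p(2) mult_left_mono[OF growth_mono[OF F(2) sobolev_norm_nonneg less[OF t]] pc] by linarith
    then have "sobolev_norm m (\<lambda>x. poly F (u t x)) * (sobolev_norm m (u t))\<^sup>2
        \<le> (poly_const m (degree F) * growth F (2 * R)) * (2 * R)\<^sup>2"
      using less[OF t] pc growth_nonneg[OF F(2), of "2 * R"] R(1) by (intro mult_mono power_mono) auto
    then have "energy_const m * (sobolev_norm m (\<lambda>x. poly F (u t x)) * (sobolev_norm m (u t))\<^sup>2)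
        \<le> energy_const m * ((poly_const m (degree F) * growth F (2 * R)) * (2 * R)\<^sup>2)"
      by (rule mult_left_mono[OF _ energy_const_nonneg[OF m]])
    then show "(\<Sum>j\<le>m. \<bar>L2_inner (nonlinearity F (u t)) (conv (energy_kernel n j) (u t))\<bar>)
        \<le> ?C * (growth F (2 * R) * (2 * R)\<^sup>2)"
      using energy_const_le[OF m p(1) s[OF tT], of n] by (simp add: nonlinearity_def[abs_def] mult_ac)
  qed
  also have "2 * \<tau> * (?C * (growth F (2 * R) * (2 * R)\<^sup>2)) \<le> R\<^sup>2"
  proof -
    have "\<tau> * growth F (2 * R) \<le> T * (2 ^ degree F * growth F R)"
      using \<tau>T growth_double[OF F(2), of R] R(1) growth_nonneg[OF F(2), of "2 * R"] by (intro mult_mono) auto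
    also have "\<dots> \<le> 2 ^ degree F * (2 * lifespan_const m (degree F))"
      using mult_left_mono[OF small, of "2 ^ degree F"] by (simp add: mult_ac)
    also have "\<dots> = 1 / (8 * (?C + 1))" by (simp add: lifespan_const_def)
    finally have "8 * ?C * (\<tau> * growth F (2 * R)) \<le> 8 * ?C * (1 / (8 * (?C + 1)))"
      using C by (intro mult_left_mono) auto
    also have "\<dots> \<le> 1" using C by simp
    finally have "(8 * ?C * (\<tau> * growth F (2 * R))) * R\<^sup>2 \<le> 1 * R\<^sup>2" by (rule mult_right_mono) simp
    then show ?thesis by (simp add: power_mult_distrib mult_ac)
  qed
  finally have "(sobolev_norm m (u \<tau>))\<^sup>2 \<le> (sobolev_norm m (u 0))\<^sup>2 + R\<^sup>2" by simp
  moreover have "(sobolev_norm m (u 0))\<^sup>2 \<le> R\<^sup>2" using R by (intro power_mono) auto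
  moreover have "(2 * R)\<^sup>2 \<le> (sobolev_norm m (u \<tau>))\<^sup>2" using \<tau>R R(1) by (intro power_mono) auto
  moreover have "(2 * R)\<^sup>2 = 4 * R\<^sup>2" "0 < R\<^sup>2" using R(1) by (auto simp: power_mult_distrib)
  ultimately show False by linarith
qed

text \<open>
  The data may vanish, so the bootstrap is run with every \<open>R\<close> slightly larger than the norm of the data.
\<close>

lemma gkdv_norm_le:
  assumes sol: "gkdv_solution m (poly F) T u0 u" and u0: "u0 \<in> sobolev m" and m: "2 \<le> m" and T: "0 < T"
    and F: "poly F 0 = 0" "1 \<le> degree F"
    and small: "T * growth F (sobolev_norm m u0) \<le> lifespan_const m (degree F)" and t: "t \<in> {0..T}"
  shows "sobolev_norm m (u t) \<le> 2 * sobolev_norm m u0"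
proof -
  let ?r = "sobolev_norm m u0"
  have r0: "sobolev_norm m (u 0) = ?r" using gkdv_solution_initial_norm[OF sol u0] T by simp
  have "((\<lambda>R. T * growth F R) \<longlongrightarrow> T * growth F ?r) (at_right ?r)"
    unfolding growth_def by (intro tendsto_intros)
  moreover have "T * growth F ?r < 2 * lifespan_const m (degree F)"
    using small lifespan_const_pos[OF m, of "degree F"] by linarith
  ultimately have "\<forall>\<^sub>F R in at_right ?r. T * growth F R < 2 * lifespan_const m (degree F)"
    by (rule order_tendstoD(2))
  moreover have "\<forall>\<^sub>F R in at_right ?r. ?r < R" by (rule eventually_at_right_less)
  ultimately have ev: "\<forall>\<^sub>F R in at_right ?r. sobolev_norm m (u t) \<le> 2 * R"
  proof eventually_elim
    case (elim R)
    have "0 < R" using elim(2) sobolev_norm_nonneg[of m u0] by linarith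
    then show ?case
      using gkdv_norm_less[OF sol m T F, of R t] elim t r0 by simp
  qed
  have lim: "((\<lambda>R. 2 * R) \<longlongrightarrow> 2 * ?r) (at_right ?r)" by (intro tendsto_intros)
  show ?thesis by (rule tendsto_lowerbound[OF lim ev]) simp
qed

section \<open>The distance between the two solutions\<close>

lemma sum_abs_L2_inner_energy_kernel_le:
  assumes "f \<in> sobolev r" "g \<in> sobolev r"
  shows "(\<Sum>j\<le>r. \<bar>L2_inner f (conv (energy_kernel n j) g)\<bar>) \<le> sobolev_norm r f * sobolev_norm r g"
proof -
  have "(\<Sum>j\<le>r. \<bar>L2_inner f (conv (energy_kernel n j) g)\<bar>)
      \<le> (\<Sum>j\<le>r. L2_norm (weak_deriv j f) * L2_norm (weak_deriv j g))"
    by (rule sum_mono) (use L2_inner_energy_kernel_le[OF assms] in auto)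
  also have "\<dots> = (\<Sum>j\<le>r. \<bar>L2_norm (weak_deriv j f)\<bar> * \<bar>L2_norm (weak_deriv j g)\<bar>)" by simp
  also have "\<dots> \<le> sobolev_norm r f * sobolev_norm r g"
    unfolding sobolev_norm_L2_set by (rule L2_set_mult_ineq)
  finally show ?thesis .
qed

lemma linear_dispersive_diff:
  assumes "linear_dispersive T w N B M" and "linear_dispersive T w' N' B' M'"
  shows "linear_dispersive T (\<lambda>t x. w t x - w' t x) (\<lambda>t x. N t x - N' t x) (B + B') (M + M')"
proof -
  interpret a: linear_dispersive T w N B M by fact
  interpret b: linear_dispersive T w' N' B' M' by fact
  show ?thesis
  proof
    show "0 < T" by (rule a.T)
    show "(\<lambda>x. w t x - w' t x) \<in> L2" if "t \<in> {0..T}" for t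
      by (rule L2_diff[OF a.w_L2[OF that] b.w_L2[OF that]])
    show "L2_norm (\<lambda>x. w t x - w' t x) \<le> B + B'" if "t \<in> {0..T}" for t
      using L2_norm_triangle_diff[OF a.w_L2[OF that] b.w_L2[OF that]] a.w_le[OF that] b.w_le[OF that] by linarith
    show "(\<lambda>x. N t x - N' t x) \<in> L2" if "t \<in> {0<..<T}" for t
      by (rule L2_diff[OF a.N_L2[OF that] b.N_L2[OF that]])
    show "L2_norm (\<lambda>x. N t x - N' t x) \<le> M + M'" if "t \<in> {0<..<T}" for t
      using L2_norm_triangle_diff[OF a.N_L2[OF that] b.N_L2[OF that]] a.N_le[OF that] b.N_le[OF that] by linarith
    show "((\<lambda>\<tau>. L2_norm (\<lambda>x. (w \<tau> x - w' \<tau> x) - (w t x - w' t x))) \<longlongrightarrow> 0) (at t within {0..T})"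
      if t: "t \<in> {0..T}" for t
    proof (rule Lim_null_comparison)
      have "norm (L2_norm (\<lambda>x. (w \<tau> x - w' \<tau> x) - (w t x - w' t x)))
          \<le> L2_norm (\<lambda>x. w \<tau> x - w t x) + L2_norm (\<lambda>x. w' \<tau> x - w' t x)" if \<tau>: "\<tau> \<in> {0..T}" for \<tau>
      proof -
        have "(\<lambda>x. (w \<tau> x - w' \<tau> x) - (w t x - w' t x)) = (\<lambda>x. (w \<tau> x - w t x) - (w' \<tau> x - w' t x))" by auto
        then show ?thesis
          using L2_norm_triangle_diff[OF L2_diff[OF a.w_L2[OF \<tau>] a.w_L2[OF t]] L2_diff[OF b.w_L2[OF \<tau>] b.w_L2[OF t]]]
          by simp
      qed
      then show "\<forall>\<^sub>F \<tau> in at t within {0..T}. norm (L2_norm (\<lambda>x. (w \<tau> x - w' \<tau> x) - (w t x - w' t x)))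
          \<le> L2_norm (\<lambda>x. w \<tau> x - w t x) + L2_norm (\<lambda>x. w' \<tau> x - w' t x)"
        by (auto simp: eventually_at_filter)
      show "((\<lambda>\<tau>. L2_norm (\<lambda>x. w \<tau> x - w t x) + L2_norm (\<lambda>x. w' \<tau> x - w' t x)) \<longlongrightarrow> 0) (at t within {0..T})"
        using tendsto_add[OF a.w_cont[OF t] b.w_cont[OF t]] by simp
    qed
    show "((\<lambda>\<tau>. L2_inner (\<lambda>x. w \<tau> x - w' \<tau> x) \<phi>) has_real_derivative
        L2_inner (\<lambda>x. w t x - w' t x) ((deriv ^^ 3) \<phi>) - L2_inner (\<lambda>x. N t x - N' t x) \<phi>) (at t)"
      if \<phi>: "test_function \<phi>" and t: "t \<in> {0<..<T}" for \<phi> t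
    proof -
      have t': "t \<in> {0..T}" using t by auto
      note L = test_function_L2[OF \<phi>] test_function_L2[OF test_function_deriv[OF \<phi>, of 3]]
      have "((\<lambda>\<tau>. L2_inner (w \<tau>) \<phi> - L2_inner (w' \<tau>) \<phi>) has_real_derivative
          L2_inner (\<lambda>x. w t x - w' t x) ((deriv ^^ 3) \<phi>) - L2_inner (\<lambda>x. N t x - N' t x) \<phi>) (at t)"
        using DERIV_diff[OF a.eq[OF \<phi> t] b.eq[OF \<phi> t]] L
        by (simp add: L2_inner_diff_left a.w_L2[OF t'] b.w_L2[OF t'] a.N_L2[OF t] b.N_L2[OF t] algebra_simps)
      moreover have "L2_inner (\<lambda>x. w \<tau> x - w' \<tau> x) \<phi> = L2_inner (w \<tau>) \<phi> - L2_inner (w' \<tau>) \<phi>"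
        if "\<tau> \<in> {0<..<T}" for \<tau>
        using that by (intro L2_inner_diff_left a.w_L2 b.w_L2 L) auto
      moreover have "\<forall>\<^sub>F \<tau> in nhds t. \<tau> \<in> {0<..<T}" using t by (intro eventually_nhds_in_open) auto
      ultimately show ?thesis
        by (subst DERIV_cong_ev[OF refl _ refl]) (auto elim!: eventually_mono)
    qed
  qed
qed

text \<open>
  The estimate for the difference loses a derivative, so no commutator is needed: each nonlinear term
  is bounded on its own by the \<open>H\<^sup>m\<close> bounds with \<open>m > r\<close>. At the time where the
  norm is maximal the energy estimate becomes a quadratic inequality for the maximum.
\<close>

lemma gkdv_difference_le:
  assumes r: "r < m" "2 \<le> m" and T: "0 < T"
    and G: "poly G 0 = 0" "1 \<le> degree G" and F: "poly F 0 = 0" "1 \<le> degree F"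
    and sol: "gkdv_solution m (poly G) T u0 u" "gkdv_solution m (poly F) T U0 U"
    and K: "\<And>t. t \<in> {0..T} \<Longrightarrow> sobolev_norm r (nonlinearity G (u t)) \<le> K"
    and K': "\<And>t. t \<in> {0..T} \<Longrightarrow> sobolev_norm r (nonlinearity F (U t)) \<le> K'"
    and t: "t \<in> {0..T}"
  shows "sobolev_norm r (\<lambda>x. u t x - U t x) \<le> sobolev_norm r (\<lambda>x. u 0 x - U 0 x) + 2 * T * (K + K')"
proof -
  let ?w = "\<lambda>t x. u t x - U t x" and ?N = "\<lambda>t x. nonlinearity G (u t) x - nonlinearity F (U t) x"
  note s = gkdv_solution_sobolev[OF sol(1)] gkdv_solution_sobolev[OF sol(2)]
  have w: "?w t \<in> sobolev m" if "t \<in> {0..T}" for t by (rule sobolev_diff(1)[OF s(1)[OF that] s(2)[OF that]])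
  have rm: "r \<le> m" using r by simp
  note wr = sobolev_mono[OF w rm]
  have "continuous_in_sobolev m T ?w"
    unfolding continuous_in_sobolev_def
  proof (intro conjI ballI w)
    fix t assume t: "t \<in> {0..T}"
    have lim: "((\<lambda>\<tau>. sobolev_norm m (\<lambda>x. u \<tau> x - u t x) + sobolev_norm m (\<lambda>x. U \<tau> x - U t x)) \<longlongrightarrow> 0 + 0) (at t within {0..T})"
      using sol t by (intro tendsto_add) (auto simp: gkdv_solution_def continuous_in_sobolev_def)
    show "((\<lambda>\<tau>. sobolev_norm m (\<lambda>x. ?w \<tau> x - ?w t x)) \<longlongrightarrow> 0) (at t within {0..T})"
    proof (rule Lim_null_comparison[OF _ lim[unfolded add_0]])
      have "norm (sobolev_norm m (\<lambda>x. ?w \<tau> x - ?w t x))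
          \<le> sobolev_norm m (\<lambda>x. u \<tau> x - u t x) + sobolev_norm m (\<lambda>x. U \<tau> x - U t x)" if \<tau>: "\<tau> \<in> {0..T}" for \<tau>
      proof -
        have "(\<lambda>x. ?w \<tau> x - ?w t x) = (\<lambda>x. (u \<tau> x - u t x) - (U \<tau> x - U t x))" by auto
        then show ?thesis
          using sobolev_diff(2)[OF sobolev_diff(1)[OF s(1)[OF \<tau>] s(1)[OF t]] sobolev_diff(1)[OF s(2)[OF \<tau>] s(2)[OF t]]]
          by simp
      qed
      then show "\<forall>\<^sub>F \<tau> in at t within {0..T}. norm (sobolev_norm m (\<lambda>x. ?w \<tau> x - ?w t x))
          \<le> sobolev_norm m (\<lambda>x. u \<tau> x - u t x) + sobolev_norm m (\<lambda>x. U \<tau> x - U t x)"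
        by (auto simp: eventually_at_filter)
    qed
  qed
  then have cont: "continuous_on {0..T} (\<lambda>t. sobolev_norm r (?w t))"
    using rm by (rule continuous_in_sobolev_norm)
  obtain \<tau> where \<tau>: "\<tau> \<in> {0..T}" "\<And>t. t \<in> {0..T} \<Longrightarrow> sobolev_norm r (?w t) \<le> sobolev_norm r (?w \<tau>)"
    using continuous_attains_sup[OF _ _ cont] T by auto
  let ?W = "sobolev_norm r (?w \<tau>)" and ?V = "sobolev_norm r (?w 0)"
  obtain B M B' M' where "linear_dispersive T u (\<lambda>t. nonlinearity G (u t)) B M"
    "linear_dispersive T U (\<lambda>t. nonlinearity F (U t)) B' M'"
    using gkdv_linear_dispersive[OF sol(1) r(2) T G] gkdv_linear_dispersive[OF sol(2) r(2) T F] by blast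
  then interpret linear_dispersive T ?w ?N "B + B'" "M + M'" by (rule linear_dispersive_diff)
  have n: "nonlinearity G (u t) \<in> sobolev r" "nonlinearity F (U t) \<in> sobolev r" if "t \<in> {0..T}" for t
    using nonlinearity_le(1)[OF r G s(1)[OF that] order_refl] nonlinearity_le(1)[OF r F s(2)[OF that] order_refl] by auto
  have K0: "0 \<le> K + K'"
    using K[OF \<tau>(1)] K'[OF \<tau>(1)] sobolev_norm_nonneg[of r "nonlinearity G (u \<tau>)"]
      sobolev_norm_nonneg[of r "nonlinearity F (U \<tau>)"] by linarith
  have "?W\<^sup>2 \<le> ?V\<^sup>2 + 2 * \<tau> * ((K + K') * ?W)"
  proof (rule energy_estimate[OF \<tau>(1)])
    show "?w t \<in> sobolev r" if "t \<in> {0, \<tau>}" for t using wr[of t] that T \<tau>(1) by auto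
    fix t n assume "t \<in> {0<..<\<tau>}"
    then have t: "t \<in> {0..T}" using \<tau>(1) by auto
    note N = sobolev_diff[OF n[OF t]]
    have "(\<Sum>j\<le>r. \<bar>L2_inner (?N t) (conv (energy_kernel n j) (?w t))\<bar>) \<le> sobolev_norm r (?N t) * sobolev_norm r (?w t)"
      by (rule sum_abs_L2_inner_energy_kernel_le[OF N(1) wr[OF t]])
    also have "\<dots> \<le> (K + K') * ?W"
      using N(2) K[OF t] K'[OF t] \<tau>(2)[OF t] K0 by (intro mult_mono) auto
    finally show "(\<Sum>j\<le>r. \<bar>L2_inner (?N t) (conv (energy_kernel n j) (?w t))\<bar>) \<le> (K + K') * ?W" .
  qed
  also have "2 * \<tau> * ((K + K') * ?W) \<le> (2 * T * (K + K')) * ?W"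
  proof -
    have "\<tau> * ((K + K') * ?W) \<le> T * ((K + K') * ?W)" using \<tau>(1) K0 by (intro mult_right_mono) auto
    then show ?thesis unfolding mult.assoc by linarith
  qed
  finally have sq: "?W\<^sup>2 \<le> ?V\<^sup>2 + (2 * T * (K + K')) * ?W" by simp
  have "?W \<le> ?V + 2 * T * (K + K')"
  proof (rule ccontr)
    assume "\<not> ?thesis"
    then have gt: "?V + 2 * T * (K + K') < ?W" by simp
    have nn: "0 \<le> 2 * T * (K + K')" using T K0 by simp
    have "?V * ?V \<le> ?V * ?W" using gt nn by (intro mult_left_mono) auto
    moreover have "0 < ?W" using gt nn sobolev_norm_nonneg[of r "?w 0"] by linarith
    moreover have "(?V + 2 * T * (K + K')) * ?W < ?W * ?W" using gt \<open>0 < ?W\<close> by (rule mult_strict_right_mono)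
    ultimately show False using sq by (simp add: power2_eq_square distrib_right)
  qed
  then show ?thesis using \<tau>(2)[OF t] by linarith
qed

text \<open>
  The exponents \<open>j + 1\<close> of \<open>\<epsilon>\<close> lie between \<open>2\<close> and \<open>k + 1\<close>, so the larger of the two extreme powers dominates
  all of them, whether \<open>\<epsilon>\<close> is small or large.
\<close>

lemma growth_scale:
  assumes F: "1 \<le> degree F" "degree F \<le> k" and e: "0 < e" and q: "0 \<le> q" and x: "0 \<le> x" "x \<le> q * e"
  shows "growth F x * x \<le> growth F q * q * max (e ^ 2) (e ^ (k + 1))"
proof -
  let ?X = "max (e ^ 2) (e ^ (k + 1))"
  have cb: "0 \<le> coeff_bound F" using coeff_bound_pos[OF F(1)] by simp
  have pw: "e ^ Suc j \<le> ?X" if j: "j \<in> {1..degree F}" for j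
  proof (cases "e \<le> 1")
    case True
    then have "e ^ Suc j \<le> e ^ 2" using j e by (intro power_decreasing) auto
    then show ?thesis by simp
  next
    case False
    then have "e ^ Suc j \<le> e ^ (k + 1)" using j F(2) by (intro power_increasing) auto
    then show ?thesis by simp
  qed
  have "growth F x * x = coeff_bound F * (\<Sum>j=1..degree F. x ^ Suc j)"
    by (simp add: growth_def sum_distrib_left sum_distrib_right mult_ac)
  also have "\<dots> \<le> coeff_bound F * (\<Sum>j=1..degree F. q ^ Suc j * ?X)"
  proof (rule mult_left_mono[OF sum_mono cb])
    fix j assume j: "j \<in> {1..degree F}"
    have "x ^ Suc j \<le> (q * e) ^ Suc j" using x by (rule power_mono[rotated])
    also have "\<dots> = q ^ Suc j * e ^ Suc j" by (rule power_mult_distrib)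
    also have "\<dots> \<le> q ^ Suc j * ?X" using q by (intro mult_left_mono pw j) auto
    finally show "x ^ Suc j \<le> q ^ Suc j * ?X" .
  qed
  also have "\<dots> = growth F q * q * ?X"
    by (simp add: growth_def sum_distrib_left sum_distrib_right mult_ac)
  finally show ?thesis .
qed

lemma KdV_polynomial:
  "poly [:0, 1:] = (\<lambda>z::real. z)" "degree [:0, 1::real:] = 1" "growth [:0, 1:] R = R"
  by (auto simp: growth_def coeff_bound_def)

definition distance_const :: "nat \<Rightarrow> nat \<Rightarrow> real poly \<Rightarrow> real \<Rightarrow> real \<Rightarrow> real \<Rightarrow> real \<Rightarrow> real" where
  "distance_const m r F T c0 C0 C = C + 2 * T *
     (mult_const r * poly_const m 1 * (growth [:0, 1:] (2 * \<bar>c0\<bar>) * (2 * \<bar>c0\<bar>)) +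
      mult_const r * poly_const m (degree F) * (growth F (2 * \<bar>C0\<bar>) * (2 * \<bar>C0\<bar>)))"

lemma KdV_gkdv_distance:
  assumes r: "r < m" "2 \<le> m" and F: "poly F 0 = 0" "1 \<le> degree F" and T: "0 < T" and e: "0 < \<epsilon>"
    and u0: "u0 \<in> sobolev m" "sobolev_norm m u0 \<le> c0 * \<epsilon>" and U0: "U0 \<in> sobolev m" "sobolev_norm m U0 \<le> C0 * \<epsilon>"
    and sols: "gkdv_solution m (\<lambda>z. z) T u0 u" "gkdv_solution m (poly F) T U0 U"
    and dist: "sobolev_norm r (\<lambda>x. u0 x - U0 x) \<le> C * max (\<epsilon> ^ 2) (\<epsilon> ^ (degree F + 1))"
    and T_le: "T * growth F (sobolev_norm m U0) \<le> lifespan_const m (degree F)" "T * sobolev_norm m u0 \<le> lifespan_const m 1"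
    and t: "t \<in> {0..T}"
  shows "sobolev_norm r (\<lambda>x. u t x - U t x) \<le> distance_const m r F T c0 C0 C * max (\<epsilon> ^ 2) (\<epsilon> ^ (degree F + 1))"
proof -
  let ?G = "[:0, 1:] :: real poly" and ?X = "max (\<epsilon> ^ 2) (\<epsilon> ^ (degree F + 1))"
  define D where "D H c = mult_const r * poly_const m (degree H) * (growth H (2 * \<bar>c\<bar>) * (2 * \<bar>c\<bar>))" for H c
  have pc: "0 \<le> mult_const r * poly_const m j" for j
    using mult_const_nonneg[of m] mult_const_nonneg[of r] by (simp add: poly_const_def)
  have bound: "sobolev_norm r (nonlinearity H (v t)) \<le> D H c * ?X"
    if H: "poly H 0 = 0" "1 \<le> degree H" "degree H \<le> degree F" and sol: "gkdv_solution m (poly H) T v0 v"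
      and v0: "v0 \<in> sobolev m" "sobolev_norm m v0 \<le> c * \<epsilon>"
      and small: "T * growth H (sobolev_norm m v0) \<le> lifespan_const m (degree H)" and t: "t \<in> {0..T}" for H v0 v c t
  proof -
    have "c * \<epsilon> \<le> \<bar>c\<bar> * \<epsilon>" using e by (intro mult_right_mono) auto
    then have le: "2 * sobolev_norm m v0 \<le> (2 * \<bar>c\<bar>) * \<epsilon>" using v0(2) unfolding mult.assoc by linarith
    have "sobolev_norm r (nonlinearity H (v t))
        \<le> mult_const r * poly_const m (degree H) * (growth H (2 * sobolev_norm m v0) * (2 * sobolev_norm m v0))"
      by (rule nonlinearity_le(2)[OF r H(1,2) gkdv_solution_sobolev[OF sol t]
            gkdv_norm_le[OF sol v0(1) r(2) T H(1,2) small t]])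
    also have "\<dots> \<le> mult_const r * poly_const m (degree H) * (growth H (2 * \<bar>c\<bar>) * (2 * \<bar>c\<bar>) * ?X)"
      by (rule mult_left_mono[OF growth_scale pc]) (use H e le in auto)
    finally show ?thesis by (simp add: D_def mult_ac)
  qed
  have G: "poly ?G 0 = 0" "1 \<le> degree ?G" "degree ?G \<le> degree F" using F(2) by auto
  have sol: "gkdv_solution m (poly ?G) T u0 u" using sols(1) by (simp add: KdV_polynomial)
  have small: "T * growth ?G (sobolev_norm m u0) \<le> lifespan_const m (degree ?G)"
    using T_le(2) by (simp only: KdV_polynomial)
  have init: "sobolev_norm r (\<lambda>x. u 0 x - U 0 x) = sobolev_norm r (\<lambda>x. u0 x - U0 x)"
  proof (rule sobolev_norm_cong_AE)
    have "AE x in lborel. u 0 x = u0 x" "AE x in lborel. U 0 x = U0 x"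
      using sols by (auto simp: gkdv_solution_def)
    then show "AE x in lborel. u 0 x - U 0 x = u0 x - U0 x" by eventually_elim simp
    have "0 \<in> {0..T}" using T by simp
    then show "(\<lambda>x. u 0 x - U 0 x) \<in> L2"
      by (intro L2_diff sobolev_L2[OF gkdv_solution_sobolev[OF sols(1)]] sobolev_L2[OF gkdv_solution_sobolev[OF sols(2)]])
    show "(\<lambda>x. u0 x - U0 x) \<in> L2" by (rule L2_diff[OF sobolev_L2[OF u0(1)] sobolev_L2[OF U0(1)]])
  qed
  have "sobolev_norm r (\<lambda>x. u t x - U t x)
      \<le> sobolev_norm r (\<lambda>x. u 0 x - U 0 x) + 2 * T * (D ?G c0 * ?X + D F C0 * ?X)"
    by (rule gkdv_difference_le[OF r T G(1,2) F sol sols(2) bound[OF G sol u0 small]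
          bound[OF F order_refl sols(2) U0 T_le(1)] t])
  then show ?thesis
    using dist unfolding init by (simp add: distance_const_def D_def algebra_simps)
qed

lemma ereal_le_mult_inverse:
  assumes "ereal T \<le> ereal c * inverse (ereal g)" "0 \<le> c" "0 \<le> g" shows "T * g \<le> c"
proof (cases "g = 0")
  case False
  then have "T \<le> c * inverse g" using assms(1) by simp
  then show ?thesis using False assms(3) by (simp add: field_simps)
qed (use assms in simp)

lemma time_bound_le:
  assumes T: "ereal T \<le> time_bound c s F U0 u0" and c: "0 \<le> c" and F: "1 \<le> degree F"
  shows "T * growth F (sobolev_norm (s + 1) U0) \<le> c" and "T * sobolev_norm (s + 1) u0 \<le> c"
proof -
  let ?a = "inverse (ereal (growth F (sobolev_norm (s + 1) U0)))" and ?b = "inverse (ereal (sobolev_norm (s + 1) u0))"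
  have "ereal T \<le> ereal c * min ?a ?b" using T by (simp add: time_bound_def growth_def)
  moreover have "ereal c * min ?a ?b \<le> ereal c * ?a" "ereal c * min ?a ?b \<le> ereal c * ?b"
    using c by (intro ereal_mult_left_mono min.cobounded1 min.cobounded2; simp)+
  ultimately have le: "ereal T \<le> ereal c * ?a" "ereal T \<le> ereal c * ?b" using order_trans by blast+
  show "T * growth F (sobolev_norm (s + 1) U0) \<le> c"
    by (rule ereal_le_mult_inverse[OF le(1) c growth_nonneg[OF F sobolev_norm_nonneg]])
  show "T * sobolev_norm (s + 1) u0 \<le> c"
    by (rule ereal_le_mult_inverse[OF le(2) c sobolev_norm_nonneg])
qed

theorem theorem1:
  "\<exists>c :: nat \<Rightarrow> nat \<Rightarrow> real.
     (\<forall>s k. 1 \<le> k \<longrightarrow> 0 < c s k) \<and>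
     (\<forall>(k::nat) (F :: real poly). 1 \<le> k \<and> degree F = k \<and> poly F 0 = 0 \<longrightarrow>
       (\<forall>(c0::real) (C0::real) (C::real) (T::real). 0 < T \<longrightarrow>
         (\<exists>Ct::real. \<forall>(\<epsilon>::real) u0 U0 u U.
            0 < \<epsilon> \<and>
            u0 \<in> sobolev 2 \<and> U0 \<in> sobolev 2 \<and>
            gkdv_solution 2 (\<lambda>z. z) T u0 u \<and>
            gkdv_solution 2 (poly F) T U0 U \<and>
            sobolev_norm 2 u0 \<le> c0 * \<epsilon> \<and>
            sobolev_norm 2 U0 \<le> C0 * \<epsilon> \<and>
            L2_norm (\<lambda>x. u0 x - U0 x) \<le> C * max (\<epsilon> ^ 2) (\<epsilon> ^ (k + 1)) \<and>
            ereal T \<le> time_bound (c 1 k) 1 F U0 u0 \<longrightarrow>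
            (SUP t\<in>{0..T}. ereal (L2_norm (\<lambda>x. u t x - U t x)))
              \<le> ereal (Ct * max (\<epsilon> ^ 2) (\<epsilon> ^ (k + 1))))) \<and>
       (\<forall>(s::nat) (c0::real) (C0::real) (C::real) (T::real). 1 \<le> s \<and> 0 < T \<longrightarrow>
         (\<exists>Ct::real. \<forall>(\<epsilon>::real) u0 U0 u U.
            0 < \<epsilon> \<and>
            u0 \<in> sobolev (s + 1) \<and> U0 \<in> sobolev (s + 1) \<and>
            gkdv_solution (s + 1) (\<lambda>z. z) T u0 u \<and>
            gkdv_solution (s + 1) (poly F) T U0 U \<and>
            sobolev_norm (s + 1) u0 \<le> c0 * \<epsilon> \<and>
            sobolev_norm (s + 1) U0 \<le> C0 * \<epsilon> \<and>
            sobolev_norm s (\<lambda>x. u0 x - U0 x) \<le> C * max (\<epsilon> ^ 2) (\<epsilon> ^ (k + 1)) \<and>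
            ereal T \<le> time_bound (c s k) s F U0 u0 \<longrightarrow>
            (SUP t\<in>{0..T}. Linf_norm (\<lambda>x. u t x - U t x))
              \<le> (SUP t\<in>{0..T}. ereal (sobolev_norm s (\<lambda>x. u t x - U t x))) \<and>
            (SUP t\<in>{0..T}. ereal (sobolev_norm s (\<lambda>x. u t x - U t x)))
              \<le> ereal (Ct * max (\<epsilon> ^ 2) (\<epsilon> ^ (k + 1))))))"
proof -
  \<comment> \<open>The energy estimates start at order two; the maximum makes the constant positive for \<open>s = 0\<close> too.\<close>
  define c where "c s k = min (lifespan_const (max 2 (s + 1)) k) (lifespan_const (max 2 (s + 1)) 1)" for s k
  have c_pos: "0 < c s k" for s k using lifespan_const_pos by (simp add: c_def)
  have small: "T * growth F (sobolev_norm (s + 1) U0) \<le> lifespan_const (s + 1) k"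
      "T * sobolev_norm (s + 1) u0 \<le> lifespan_const (s + 1) 1"
    if "ereal T \<le> time_bound (c s k) s F U0 u0" "1 \<le> s" "1 \<le> degree F" for T s k F U0 u0
    using time_bound_le[OF that(1) less_imp_le[OF c_pos] that(3)] that(2) by (auto simp: c_def max_def split: if_splits)
  show ?thesis
  proof (intro exI[of _ c] conjI allI impI, goal_cases)
    case 1
    show ?case by (rule c_pos)
  next
    case (2 k F c0 C0 C T)
    then have F: "poly F 0 = 0" "1 \<le> degree F" and k: "degree F = k" and T: "0 < T" by auto
    show ?case
    proof (intro exI[of _ "distance_const 2 0 F T c0 C0 C"] allI impI SUP_least, goal_cases)
      case (1 \<epsilon> u0 U0 u U t)
      then have e: "0 < \<epsilon>" and u0: "u0 \<in> sobolev 2" "sobolev_norm 2 u0 \<le> c0 * \<epsilon>"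
        and U0: "U0 \<in> sobolev 2" "sobolev_norm 2 U0 \<le> C0 * \<epsilon>"
        and sols: "gkdv_solution 2 (\<lambda>z. z) T u0 u" "gkdv_solution 2 (poly F) T U0 U"
        and dist: "L2_norm (\<lambda>x. u0 x - U0 x) \<le> C * max (\<epsilon> ^ 2) (\<epsilon> ^ (degree F + 1))"
        and T_le: "ereal T \<le> time_bound (c 1 k) 1 F U0 u0" and t: "t \<in> {0..T}"
        unfolding k by blast+
      have d0: "(\<lambda>x. u0 x - U0 x) \<in> L2" by (rule L2_diff[OF sobolev_L2[OF u0(1)] sobolev_L2[OF U0(1)]])
      have d: "(\<lambda>x. u t x - U t x) \<in> L2"
        by (rule L2_diff[OF sobolev_L2[OF gkdv_solution_sobolev[OF sols(1) t]] sobolev_L2[OF gkdv_solution_sobolev[OF sols(2) t]]])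
      have "sobolev_norm 0 (\<lambda>x. u t x - U t x)
          \<le> distance_const 2 0 F T c0 C0 C * max (\<epsilon> ^ 2) (\<epsilon> ^ (degree F + 1))"
        by (rule KdV_gkdv_distance[OF _ _ F T e u0 U0 sols dist[folded sobolev_norm_0[OF d0]] _ _ t])
           (use small[OF T_le _ F(2)] k in \<open>simp_all add: numeral_2_eq_2\<close>)
      then show ?case by (simp add: sobolev_norm_0[OF d] k)
    qed
  next
    case (3 k F s c0 C0 C T)
    then have F: "poly F 0 = 0" "1 \<le> degree F" and k: "degree F = k" and s: "1 \<le> s" and T: "0 < T" by auto
    show ?case
    proof (intro exI[of _ "distance_const (s + 1) s F T c0 C0 C"] allI impI, goal_cases)
      case (1 \<epsilon> u0 U0 u U)
      then have e: "0 < \<epsilon>" and u0: "u0 \<in> sobolev (s + 1)" "sobolev_norm (s + 1) u0 \<le> c0 * \<epsilon>"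
        and U0: "U0 \<in> sobolev (s + 1)" "sobolev_norm (s + 1) U0 \<le> C0 * \<epsilon>"
        and sols: "gkdv_solution (s + 1) (\<lambda>z. z) T u0 u" "gkdv_solution (s + 1) (poly F) T U0 U"
        and dist: "sobolev_norm s (\<lambda>x. u0 x - U0 x) \<le> C * max (\<epsilon> ^ 2) (\<epsilon> ^ (degree F + 1))"
        and T_le: "ereal T \<le> time_bound (c s k) s F U0 u0"
        unfolding k by blast+
      have "sobolev_norm s (\<lambda>x. u t x - U t x)
          \<le> distance_const (s + 1) s F T c0 C0 C * max (\<epsilon> ^ 2) (\<epsilon> ^ (degree F + 1))" if t: "t \<in> {0..T}" for t
        by (rule KdV_gkdv_distance[OF _ _ F T e u0 U0 sols dist _ _ t]) (use small[OF T_le s F(2)] k s in auto)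
      moreover have "Linf_norm (\<lambda>x. u t x - U t x) \<le> ereal (sobolev_norm s (\<lambda>x. u t x - U t x))" if t: "t \<in> {0..T}" for t
        using sobolev_mono[OF sobolev_diff(1)[OF gkdv_solution_sobolev[OF sols(1) t] gkdv_solution_sobolev[OF sols(2) t]], of s] s
        by (intro Linf_norm_le_sobolev_norm) auto
      ultimately show ?case unfolding k by (intro conjI SUP_subset_mono SUP_least) auto
    qed
  qed
qed

end
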